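(* Let $\Omega$ be an infinite set and let $G$ be a subgroup of $\mathrm{Sym}(\Omega)$ such that every infinite normal subgroup of $G$ is transitive on $\Omega$. Let $\alpha\in\Omega$, let $H:=G_\alpha$ be the stabiliser of $\alpha$ in $G$, and assume that $H$ satisfies the minimal condition on normal subgroups. Suppose that $G$ has arbitrarily large finite normal subgroups. Then $G$ has a unique minimal infinite normal subgroup $M$, and $M$ acts regularly on $\Omega$. For some prime number $p$, $M$ is a divisible abelian $p$-group of finite rank. Moreover, $H$ is finite and acts faithfully and $p$-adic irreducibly by conjugation on $M$.
   Context: A group satisfies the minimal condition on normal subgroups (min-N) if every non-empty set of its normal subgroups has a minimal member with respect to inclusion. "Arbitrarily large finite normal subgroups" means there is no bound on the orders of the finite normal subgroups of $G$. A permutation group acts regularly if it is transitive with trivial point stabilisers. A divisible abelian $p$-group $M$ of finite rank $r$ is isomorphic to a direct sum of $r$ copies of the Prüfer $p$-group $C_{p^\infty}$. Such a direct sum decomposition gives an isomorphism of the endomorphism ring $\mathrm{End}(M)$ with the ring of $r\times r$ matrices over the ring $\hat{\mathbb Z}_p$ of $p$-adic integers, and hence an isomorphism $\mathrm{Aut}(M)\cong \mathrm{GL}(r,\hat{\mathbb Z}_p)\leq \mathrm{GL}(r,\hat{\mathbb Q}_p)$, where $\hat{\mathbb Q}_p$ is the field of $p$-adic numbers. A group $H$ acting faithfully on $M$ is thereby identified with a subgroup of $\mathrm{GL}(r,\hat{\mathbb Q}_p)$, and $H$ is said to act $p$-adic irreducibly on $M$ if this subgroup is irreducible, i.e. the only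 $H$-invariant subspaces of $\hat{\mathbb Q}_p^{\,r}$ are $0$ and the whole space (and $r\geq 1$). *)

theory Defs
  imports "HOL-Algebra.Algebra" Complex_Main
begin

section \<open>Groups\<close>

abbreviation subgrp :: "('a, 'b) monoid_scheme \<Rightarrow> 'a set \<Rightarrow> ('a, 'b) monoid_scheme" where
  "subgrp G H \<equiv> G\<lparr>carrier := H\<rparr>"

definition min_N :: "('a, 'b) monoid_scheme \<Rightarrow> bool" where
  "min_N G \<longleftrightarrow>
     (\<forall>\<N>. \<N> \<noteq> {} \<and> (\<forall>N\<in>\<N>. N \<lhd> G) \<longrightarrow> (\<exists>M\<in>\<N>. \<forall>N\<in>\<N>. N \<subseteq> M \<longrightarrow> N = M))"

definition minimal_infinite_normal :: "'a set \<Rightarrow> ('a, 'b) monoid_scheme \<Rightarrow> bool" where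
  "minimal_infinite_normal M G \<longleftrightarrow>
     M \<lhd> G \<and> infinite M \<and> (\<forall>N. N \<lhd> G \<and> infinite N \<and> N \<subseteq> M \<longrightarrow> N = M)"

definition conj_action :: "('a, 'b) monoid_scheme \<Rightarrow> 'a set \<Rightarrow> 'a \<Rightarrow> 'a \<Rightarrow> 'a" where
  "conj_action G M h = (\<lambda>m\<in>M. h \<otimes>\<^bsub>G\<^esub> m \<otimes>\<^bsub>G\<^esub> inv\<^bsub>G\<^esub> h)"

definition divisible_group :: "('a, 'b) monoid_scheme \<Rightarrow> bool" where
  "divisible_group G \<longleftrightarrow>
     (\<forall>x\<in>carrier G. \<forall>n::nat. n \<ge> 1 \<longrightarrow> (\<exists>y\<in>carrier G. y [^]\<^bsub>G\<^esub> n = x))"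

definition is_p_group :: "nat \<Rightarrow> ('a, 'b) monoid_scheme \<Rightarrow> bool" where
  "is_p_group p G \<longleftrightarrow> (\<forall>x\<in>carrier G. \<exists>k::nat. x [^]\<^bsub>G\<^esub> (p ^ k) = \<one>\<^bsub>G\<^esub>)"

text \<open>Finite rank in the sense of Mal'cev and Pruefer: there is a uniform bound on the number of
  generators needed for the finitely generated subgroups.\<close>

definition finite_rank :: "('a, 'b) monoid_scheme \<Rightarrow> bool" where
  "finite_rank G \<longleftrightarrow>
     (\<exists>r::nat. \<forall>S. finite S \<and> S \<subseteq> carrier G \<longrightarrow>
        (\<exists>T. finite T \<and> card T \<le> r \<and> T \<subseteq> carrier G \<and> generate G T = generate G S))"


section \<open>Permutation groups\<close>

text \<open>A subgroup of \<^term>\<open>BijGroup \<Omega>\<close> acts on \<^term>\<open>\<Omega>\<close> by evaluation, that is, through the inclusion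
  homomorphism \<^term>\<open>\<lambda>g. g\<close>.\<close>

abbreviation transitive_on :: "('a \<Rightarrow> 'a) set \<Rightarrow> 'a set \<Rightarrow> bool" where
  "transitive_on N \<Omega> \<equiv> transitive_action (subgrp (BijGroup \<Omega>) N) \<Omega> (\<lambda>g. g)"

abbreviation point_stabilizer :: "'a set \<Rightarrow> ('a \<Rightarrow> 'a) set \<Rightarrow> 'a \<Rightarrow> ('a \<Rightarrow> 'a) set" where
  "point_stabilizer \<Omega> N \<alpha> \<equiv> stabilizer (subgrp (BijGroup \<Omega>) N) (\<lambda>g. g) \<alpha>"

definition regular_on :: "('a \<Rightarrow> 'a) set \<Rightarrow> 'a set \<Rightarrow> bool" where
  "regular_on N \<Omega> \<longleftrightarrow>
     transitive_on N \<Omega> \<and> (\<forall>\<alpha>\<in>\<Omega>. point_stabilizer \<Omega> N \<alpha> = {\<one>\<^bsub>BijGroup \<Omega>\<^esub>})"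


section \<open>Field of fractions of a domain\<close>

definition fraction_rel :: "('a, 'b) ring_scheme \<Rightarrow> (('a \<times> 'a) \<times> ('a \<times> 'a)) set" where
  "fraction_rel R =
     {((a, b), (c, d)). a \<in> carrier R \<and> b \<in> carrier R - {\<zero>\<^bsub>R\<^esub>} \<and>
        c \<in> carrier R \<and> d \<in> carrier R - {\<zero>\<^bsub>R\<^esub>} \<and> a \<otimes>\<^bsub>R\<^esub> d = c \<otimes>\<^bsub>R\<^esub> b}"

definition fraction :: "('a, 'b) ring_scheme \<Rightarrow> 'a \<Rightarrow> 'a \<Rightarrow> ('a \<times> 'a) set" where
  "fraction R a b = fraction_rel R `` {(a, b)}"

definition fraction_field :: "('a, 'b) ring_scheme \<Rightarrow> ('a \<times> 'a) set ring" where
  "fraction_field R =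
     \<lparr>carrier = {fraction R a b | a b. a \<in> carrier R \<and> b \<in> carrier R - {\<zero>\<^bsub>R\<^esub>}},
      monoid.mult = (\<lambda>P Q. \<Union>(a, b)\<in>P. \<Union>(c, d)\<in>Q. fraction R (a \<otimes>\<^bsub>R\<^esub> c) (b \<otimes>\<^bsub>R\<^esub> d)),
      one = fraction R \<one>\<^bsub>R\<^esub> \<one>\<^bsub>R\<^esub>,
      ring.zero = fraction R \<zero>\<^bsub>R\<^esub> \<one>\<^bsub>R\<^esub>,
      add = (\<lambda>P Q. \<Union>(a, b)\<in>P. \<Union>(c, d)\<in>Q.
               fraction R (a \<otimes>\<^bsub>R\<^esub> d \<oplus>\<^bsub>R\<^esub> c \<otimes>\<^bsub>R\<^esub> b) (b \<otimes>\<^bsub>R\<^esub> d))\<rparr>"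


section \<open>The p-adic integers and the p-adic numbers\<close>

text \<open>The inverse limit of the rings of integers modulo \<open>p ^ n\<close>: the value of a sequence at \<open>n\<close> is
  the least non-negative representative of its residue modulo \<open>p ^ n\<close>.\<close>

definition padic_integers :: "nat \<Rightarrow> (nat \<Rightarrow> int) ring" where
  "padic_integers p =
     \<lparr>carrier = {x. \<forall>n. 0 \<le> x n \<and> x n < int p ^ n \<and> x (Suc n) mod int p ^ n = x n},
      monoid.mult = (\<lambda>x y n. (x n * y n) mod int p ^ n),
      one = (\<lambda>n. 1 mod int p ^ n),
      ring.zero = (\<lambda>n. 0),
      add = (\<lambda>x y n. (x n + y n) mod int p ^ n)\<rparr>"

abbreviation padic_numbers :: "nat \<Rightarrow> ((nat \<Rightarrow> int) \<times> (nat \<Rightarrow> int)) set ring" where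
  "padic_numbers p \<equiv> fraction_field (padic_integers p)"

abbreviation padic_embed :: "nat \<Rightarrow> (nat \<Rightarrow> int) \<Rightarrow> ((nat \<Rightarrow> int) \<times> (nat \<Rightarrow> int)) set" where
  "padic_embed p a \<equiv> fraction (padic_integers p) a \<one>\<^bsub>padic_integers p\<^esub>"


section \<open>Pruefer groups and endomorphisms given by p-adic matrices\<close>

text \<open>The Pruefer group, realised as the group of complex roots of unity of p-power order.\<close>

definition pruefer :: "nat \<Rightarrow> complex monoid" where
  "pruefer p = \<lparr>carrier = {z. \<exists>n::nat. z ^ (p ^ n) = 1}, monoid.mult = (*), one = 1\<rparr>"

text \<open>The endomorphism of the Pruefer group given by the p-adic integer \<open>a\<close>: an element \<open>z\<close> with
  \<open>z ^ (p ^ n) = 1\<close> is raised to the residue of \<open>a\<close> modulo \<open>p ^ n\<close>. The result does not depend on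
  the choice of \<open>n\<close>.\<close>

definition pruefer_power :: "nat \<Rightarrow> (nat \<Rightarrow> int) \<Rightarrow> complex \<Rightarrow> complex" where
  "pruefer_power p a z = z powi a (LEAST n. z ^ (p ^ n) = 1)"

text \<open>The direct sum of \<open>r\<close> copies of the Pruefer group, and the action on it of an \<open>r \<times> r\<close> matrix
  of p-adic integers by matrix-vector multiplication (the Pruefer group is written
  multiplicatively).\<close>

abbreviation pruefer_sum :: "nat \<Rightarrow> nat \<Rightarrow> (nat \<Rightarrow> complex) monoid" where
  "pruefer_sum p r \<equiv> sum_group {..<r} (\<lambda>_. pruefer p)"

definition pruefer_mat_act ::
  "nat \<Rightarrow> nat \<Rightarrow> (nat \<Rightarrow> nat \<Rightarrow> nat \<Rightarrow> int) \<Rightarrow> (nat \<Rightarrow> complex) \<Rightarrow> (nat \<Rightarrow> complex)" where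
  "pruefer_mat_act p r A v = (\<lambda>i\<in>{..<r}. \<Prod>j<r. pruefer_power p (A i j) (v j))"


section \<open>Irreducibility\<close>

text \<open>The space of column vectors of length \<open>r\<close>. A module record also has multiplicative fields,
  which play no role here.\<close>

definition vec_space :: "('a, 'b) ring_scheme \<Rightarrow> nat \<Rightarrow> ('a, nat \<Rightarrow> 'a) module" where
  "vec_space K r =
     \<lparr>carrier = {..<r} \<rightarrow>\<^sub>E carrier K,
      monoid.mult = undefined,
      one = undefined,
      ring.zero = (\<lambda>i\<in>{..<r}. \<zero>\<^bsub>K\<^esub>),
      add = (\<lambda>v w. \<lambda>i\<in>{..<r}. v i \<oplus>\<^bsub>K\<^esub> w i),
      smult = (\<lambda>c v. \<lambda>i\<in>{..<r}. c \<otimes>\<^bsub>K\<^esub> v i)\<rparr>"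

definition matrices :: "('a, 'b) ring_scheme \<Rightarrow> nat \<Rightarrow> (nat \<Rightarrow> nat \<Rightarrow> 'a) set" where
  "matrices R r = {..<r} \<rightarrow>\<^sub>E {..<r} \<rightarrow>\<^sub>E carrier R"

definition mat_vec ::
  "('a, 'b) ring_scheme \<Rightarrow> nat \<Rightarrow> (nat \<Rightarrow> nat \<Rightarrow> 'a) \<Rightarrow> (nat \<Rightarrow> 'a) \<Rightarrow> (nat \<Rightarrow> 'a)" where
  "mat_vec K r A v = (\<lambda>i\<in>{..<r}. \<Oplus>\<^bsub>K\<^esub>j\<in>{..<r}. A i j \<otimes>\<^bsub>K\<^esub> v j)"

definition irreducible_matrices ::
  "('a, 'b) ring_scheme \<Rightarrow> nat \<Rightarrow> (nat \<Rightarrow> nat \<Rightarrow> 'a) set \<Rightarrow> bool" where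
  "irreducible_matrices K r S \<longleftrightarrow>
     r \<ge> 1 \<and>
     (\<forall>W. submodule W K (vec_space K r) \<and> (\<forall>A\<in>S. \<forall>v\<in>W. mat_vec K r A v \<in> W) \<longrightarrow>
        W = {\<zero>\<^bsub>vec_space K r\<^esub>} \<or> W = carrier (vec_space K r))"

text \<open>The matrices over the p-adic integers of the automorphisms of \<open>M\<close> induced by the elements
  of \<open>H\<close> (acting on \<open>M\<close> through \<open>act\<close>), with respect to the direct sum decomposition of \<open>M\<close> given
  by an isomorphism \<open>\<phi>\<close> onto \<open>pruefer_sum p r\<close>.\<close>

definition padic_matrices ::
  "nat \<Rightarrow> nat \<Rightarrow> ('h, 'c) monoid_scheme \<Rightarrow> ('m, 'd) monoid_scheme \<Rightarrow> ('h \<Rightarrow> 'm \<Rightarrow> 'm) \<Rightarrow>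
   ('m \<Rightarrow> nat \<Rightarrow> complex) \<Rightarrow> (nat \<Rightarrow> nat \<Rightarrow> nat \<Rightarrow> int) set" where
  "padic_matrices p r H M act \<phi> =
     {A \<in> matrices (padic_integers p) r.
        \<exists>h\<in>carrier H. \<forall>m\<in>carrier M. \<phi> (act h m) = pruefer_mat_act p r A (\<phi> m)}"

text \<open>Changing the decomposition \<open>\<phi>\<close> conjugates the matrices by a fixed element of
  \<open>GL(r, \<int>\<^sub>p)\<close>, so irreducibility is a property of the action alone.\<close>

definition acts_padic_irreducibly ::
  "nat \<Rightarrow> ('h, 'c) monoid_scheme \<Rightarrow> ('m, 'd) monoid_scheme \<Rightarrow> ('h \<Rightarrow> 'm \<Rightarrow> 'm) \<Rightarrow> bool" where
  "acts_padic_irreducibly p H M act \<longleftrightarrow>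
     (\<exists>r. \<exists>\<phi>\<in>iso M (pruefer_sum p r).
        irreducible_matrices (padic_numbers p) r
          ((\<lambda>A. \<lambda>i\<in>{..<r}. \<lambda>j\<in>{..<r}. padic_embed p (A i j)) ` padic_matrices p r H M act \<phi>))"

end

theory Submission
  imports Defs "HOL-Number_Theory.Cong"
begin

text \<open>
  Transitivity makes an infinite normal subgroup \<open>N\<close> determined by \<open>N \<inter> H\<close> among the infinite normal
  subgroups comparable with it, so min-N of \<open>H\<close> yields a minimal infinite normal subgroup \<open>M\<close> inside
  the union \<open>F\<close> of all finite normal subgroups. By minimality \<open>M\<close> centralises every finite normal
  subgroup, hence \<open>F\<close>; since \<open>C(M) \<inter> H\<close> is normalised by \<open>H\<close> and centralised by \<open>M\<close>, it is normal and
  lies in a point stabiliser, so it is trivial. Thus \<open>C(M) = M = F\<close> is abelian and regular. Applying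
  min-N to the traces on \<open>H\<close> of the centralisers of finite normal subgroups shows that one of these
  traces is trivial, so \<open>H\<close> is finite.

  Every infinite \<open>H\<close>-invariant subgroup of \<open>M\<close> is \<open>M\<close>. If \<open>M\<close> had prime exponent, the intersection of
  the \<open>H\<close>-conjugates of a maximal subgroup would be an infinite proper one. Hence all kernels of
  \<open>x \<mapsto> x\<^sup>q\<close>, \<open>q\<close> prime, are finite, these maps are surjective, and \<open>M\<close> is a divisible \<open>p\<close>-group with
  finite \<open>p\<close>-torsion. An invariant subspace of \<open>\<rat>\<^sub>p\<^sup>r\<close> meets \<open>\<int>\<^sub>p\<^sup>r\<close> in a pure lattice \<open>L\<close>; for
  \<open>L \<noteq> 0\<close> the image of \<open>L \<otimes> \<rat>\<^sub>p/\<int>\<^sub>p\<close> in \<open>M\<close> is infinite and invariant, so it is \<open>M\<close>, which forces \<open>L\<close> to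
  be everything modulo \<open>p\<close> and then everything.
\<close>

section \<open>Fractions\<close>

text \<open>The permutations enter only through a point stabiliser that is core-free, supplements
  every infinite normal subgroup and has min-N. A supplement gives Dedekind's law: if N <= M are
  infinite normal subgroups with equal traces on \<open>H\<close>, then M = N(M \<inter> H) = N.
  Centralisers of finite normal subgroups have finite index, so they meet every infinite subgroup in
  an infinite one. Finiteness of \<open>H\<close> has to precede the structure of \<open>M\<close>:
  a finite intersection of subgroups of finite index again has finite index. In the arithmetic half,
  \<open>M\<close> is an abstract group, while irreducibility is stated with matrices over fractions
  of residue sequences acting on tuples of roots of unity. Symbols \<open>e n a\<close> for the
  classes of a / p^n, with integer vectors a, serve both sides: whether two symbols agree depends on
  p and r alone, so matching symbols gives the isomorphism, and homomorphisms become matrices level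
  by level. Denominators are cleared, and purity of L takes the place of division.\<close>

context "domain"
begin

lemma equiv_fraction_rel: "equiv (carrier R \<times> (carrier R - {\<zero>})) (fraction_rel R)"
proof (rule equivI)
  show "fraction_rel R \<subseteq> (carrier R \<times> (carrier R - {\<zero>})) \<times> (carrier R \<times> (carrier R - {\<zero>}))"
    by (auto simp: fraction_rel_def)
  show "refl_on (carrier R \<times> (carrier R - {\<zero>})) (fraction_rel R)"
    by (auto simp: fraction_rel_def refl_on_def)
  show "sym (fraction_rel R)"
    by (auto simp: fraction_rel_def sym_def)
  show "trans (fraction_rel R)"
  proof (rule transI)
    fix x y z assume xy: "(x, y) \<in> fraction_rel R" and yz: "(y, z) \<in> fraction_rel R"
    obtain a b c d e f where [simp]: "x = (a, b)" "y = (c, d)" "z = (e, f)"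
      by (cases x, cases y, cases z) auto
    have c: "a \<in> carrier R" "b \<in> carrier R" "c \<in> carrier R" "d \<in> carrier R" "e \<in> carrier R"
      "f \<in> carrier R" "b \<noteq> \<zero>" "d \<noteq> \<zero>" "f \<noteq> \<zero>"
      and e1: "a \<otimes> d = c \<otimes> b" and e2: "c \<otimes> f = e \<otimes> d"
      using xy yz by (auto simp: fraction_rel_def)
    \<comment> \<open>Cancelling the middle denominator \<open>d\<close> is where the absence of
      zero divisors enters.\<close>
    have "d \<otimes> (a \<otimes> f) = (a \<otimes> d) \<otimes> f"
      using c by (simp add: m_ac)
    also have "\<dots> = b \<otimes> (c \<otimes> f)"
      unfolding e1 using c by (simp add: m_ac)
    also have "\<dots> = d \<otimes> (e \<otimes> b)"
      unfolding e2 using c by (simp add: m_ac)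
    finally have "a \<otimes> f = e \<otimes> b"
      using c m_lcancel[of d "a \<otimes> f" "e \<otimes> b"] by simp
    with c show "(x, z) \<in> fraction_rel R"
      by (simp add: fraction_rel_def)
  qed
qed

lemma fraction_eq_iff:
  assumes "a \<in> carrier R" "b \<in> carrier R" "b \<noteq> \<zero>" "c \<in> carrier R" "d \<in> carrier R" "d \<noteq> \<zero>"
  shows "fraction R a b = fraction R c d \<longleftrightarrow> a \<otimes> d = c \<otimes> b"
  unfolding fraction_def
  using eq_equiv_class_iff[OF equiv_fraction_rel, of "(a, b)" "(c, d)"] assms
  by (auto simp: fraction_rel_def)

text \<open>The operations of \<open>fraction_field\<close> are unions over all pairs of
  representatives. A nonempty union of one constant set is that set, so well-definedness reduces to
  independence of the representatives.\<close>

lemma UN_fraction: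
  assumes "a \<in> carrier R" "b \<in> carrier R" "b \<noteq> \<zero>" "c \<in> carrier R" "d \<in> carrier R" "d \<noteq> \<zero>"
    and eq: "\<And>a' b' c' d'. (a', b') \<in> fraction R a b \<Longrightarrow> (c', d') \<in> fraction R c d \<Longrightarrow> f a' b' c' d' = Y"
  shows "(\<Union>(a', b')\<in>fraction R a b. \<Union>(c', d')\<in>fraction R c d. f a' b' c' d') = Y"
proof -
  have "(a, b) \<in> fraction R a b" "(c, d) \<in> fraction R c d"
    using assms by (auto simp: fraction_def fraction_rel_def)
  then show ?thesis
    using eq by (intro SUP_eq_const) (auto simp del: SUP_apply intro!: SUP_eq_const)
qed

lemma fraction_mult:
  assumes "a \<in> carrier R" "b \<in> carrier R" "b \<noteq> \<zero>" "c \<in> carrier R" "d \<in> carrier R" "d \<noteq> \<zero>"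
  shows "fraction R a b \<otimes>\<^bsub>fraction_field R\<^esub> fraction R c d = fraction R (a \<otimes> c) (b \<otimes> d)"
proof -
  have "fraction R (a' \<otimes> c') (b' \<otimes> d') = fraction R (a \<otimes> c) (b \<otimes> d)"
    if "(a', b') \<in> fraction R a b" "(c', d') \<in> fraction R c d" for a' b' c' d'
  proof -
    have c: "a' \<in> carrier R" "b' \<in> carrier R" "c' \<in> carrier R" "d' \<in> carrier R" "b' \<noteq> \<zero>" "d' \<noteq> \<zero>"
      and e: "a \<otimes> b' = a' \<otimes> b" "c \<otimes> d' = c' \<otimes> d"
      using that by (auto simp: fraction_def fraction_rel_def)
    have "a' \<otimes> c' \<otimes> (b \<otimes> d) = (a' \<otimes> b) \<otimes> (c' \<otimes> d)"
      using c assms by (simp add: m_ac)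
    also have "\<dots> = a \<otimes> c \<otimes> (b' \<otimes> d')"
      unfolding e[symmetric] using c assms by (simp add: m_ac)
    finally show ?thesis
      using c assms by (subst fraction_eq_iff) (auto simp: integral_iff)
  qed
  from UN_fraction[OF assms this] show ?thesis
    by (simp add: fraction_field_def)
qed

lemma fraction_add:
  assumes "a \<in> carrier R" "b \<in> carrier R" "b \<noteq> \<zero>" "c \<in> carrier R" "d \<in> carrier R" "d \<noteq> \<zero>"
  shows "fraction R a b \<oplus>\<^bsub>fraction_field R\<^esub> fraction R c d = fraction R (a \<otimes> d \<oplus> c \<otimes> b) (b \<otimes> d)"
proof -
  have "fraction R (a' \<otimes> d' \<oplus> c' \<otimes> b') (b' \<otimes> d') = fraction R (a \<otimes> d \<oplus> c \<otimes> b) (b \<otimes> d)"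
    if "(a', b') \<in> fraction R a b" "(c', d') \<in> fraction R c d" for a' b' c' d'
  proof -
    have c: "a' \<in> carrier R" "b' \<in> carrier R" "c' \<in> carrier R" "d' \<in> carrier R" "b' \<noteq> \<zero>" "d' \<noteq> \<zero>"
      and e: "a \<otimes> b' = a' \<otimes> b" "c \<otimes> d' = c' \<otimes> d"
      using that by (auto simp: fraction_def fraction_rel_def)
    have "(a' \<otimes> d' \<oplus> c' \<otimes> b') \<otimes> (b \<otimes> d) = (a' \<otimes> b) \<otimes> (d' \<otimes> d) \<oplus> (c' \<otimes> d) \<otimes> (b' \<otimes> b)"
      using c assms by algebra
    also have "\<dots> = (a \<otimes> d \<oplus> c \<otimes> b) \<otimes> (b' \<otimes> d')"
      unfolding e[symmetric] using c assms by algebra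
    finally show ?thesis
      using c assms by (subst fraction_eq_iff) (auto simp: integral_iff)
  qed
  from UN_fraction[OF assms this] show ?thesis
    by (simp add: fraction_field_def)
qed

lemma fraction_in_carrier:
  "a \<in> carrier R \<Longrightarrow> b \<in> carrier R \<Longrightarrow> b \<noteq> \<zero> \<Longrightarrow> fraction R a b \<in> carrier (fraction_field R)"
  by (auto simp: fraction_field_def)

lemma fraction_cases:
  assumes "x \<in> carrier (fraction_field R)"
  obtains a b where "a \<in> carrier R" "b \<in> carrier R" "b \<noteq> \<zero>" "x = fraction R a b"
  using assms by (auto simp: fraction_field_def)

lemma zero_fraction_field: "\<zero>\<^bsub>fraction_field R\<^esub> = fraction R \<zero> \<one>"
  by (simp add: fraction_field_def)

text \<open>These laws govern finite sums in the fraction field, and \<open>mat_vec\<close> over it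
  is built from such sums.\<close>

lemma abelian_monoid_fraction_field: "abelian_monoid (fraction_field R)"
proof (rule abelian_monoidI)
  fix x y z
  assume "x \<in> carrier (fraction_field R)" "y \<in> carrier (fraction_field R)"
    "z \<in> carrier (fraction_field R)"
  then obtain a b c d e f where
    c: "a \<in> carrier R" "b \<in> carrier R" "c \<in> carrier R" "d \<in> carrier R" "e \<in> carrier R"
      "f \<in> carrier R" "b \<noteq> \<zero>" "d \<noteq> \<zero>" "f \<noteq> \<zero>"
    and xyz: "x = fraction R a b" "y = fraction R c d" "z = fraction R e f"
    by (metis fraction_cases)
  have nz: "b \<otimes> d \<noteq> \<zero>" "d \<otimes> f \<noteq> \<zero>"
    using c by (auto simp: integral_iff)
  have e1: "((a \<otimes> d \<oplus> c \<otimes> b) \<otimes> f \<oplus> e \<otimes> (b \<otimes> d)) = (a \<otimes> (d \<otimes> f) \<oplus> (c \<otimes> f \<oplus> e \<otimes> d) \<otimes> b)"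
    using c by algebra
  have e2: "b \<otimes> d \<otimes> f = b \<otimes> (d \<otimes> f)"
    using c by (simp add: m_assoc)
  have e3: "a \<otimes> d \<oplus> c \<otimes> b = c \<otimes> b \<oplus> a \<otimes> d" "b \<otimes> d = d \<otimes> b"
    using c by (simp_all add: a_comm m_comm)
  have s1: "x \<oplus>\<^bsub>fraction_field R\<^esub> y = fraction R (a \<otimes> d \<oplus> c \<otimes> b) (b \<otimes> d)"
    and s2: "y \<oplus>\<^bsub>fraction_field R\<^esub> z = fraction R (c \<otimes> f \<oplus> e \<otimes> d) (d \<otimes> f)"
    and s3: "y \<oplus>\<^bsub>fraction_field R\<^esub> x = fraction R (c \<otimes> b \<oplus> a \<otimes> d) (d \<otimes> b)"
    unfolding xyz using c by (simp_all only: fraction_add not_False_eq_True)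
  show "x \<oplus>\<^bsub>fraction_field R\<^esub> y \<oplus>\<^bsub>fraction_field R\<^esub> z
      = x \<oplus>\<^bsub>fraction_field R\<^esub> (y \<oplus>\<^bsub>fraction_field R\<^esub> z)"
    unfolding s1 s2 unfolding xyz
    using c nz fraction_add[of "a \<otimes> d \<oplus> c \<otimes> b" "b \<otimes> d" e f]
      fraction_add[of a b "c \<otimes> f \<oplus> e \<otimes> d" "d \<otimes> f"] e1 e2 by simp
  show "x \<oplus>\<^bsub>fraction_field R\<^esub> y = y \<oplus>\<^bsub>fraction_field R\<^esub> x"
    unfolding s1 s3 e3 ..
  show "x \<oplus>\<^bsub>fraction_field R\<^esub> y \<in> carrier (fraction_field R)"
    unfolding s1 using c nz by (intro fraction_in_carrier) simp_all
  show "\<zero>\<^bsub>fraction_field R\<^esub> \<oplus>\<^bsub>fraction_field R\<^esub> x = x"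
    unfolding xyz zero_fraction_field using c by (simp add: fraction_add)
next
  show "\<zero>\<^bsub>fraction_field R\<^esub> \<in> carrier (fraction_field R)"
    unfolding zero_fraction_field by (intro fraction_in_carrier) simp_all
qed

abbreviation embed :: "'a \<Rightarrow> ('a \<times> 'a) set" where
  "embed a \<equiv> fraction R a \<one>"

lemma embed_closed: "a \<in> carrier R \<Longrightarrow> embed a \<in> carrier (fraction_field R)"
  by (simp add: fraction_in_carrier)

lemma embed_add:
  "a \<in> carrier R \<Longrightarrow> b \<in> carrier R \<Longrightarrow> embed a \<oplus>\<^bsub>fraction_field R\<^esub> embed b = embed (a \<oplus> b)"
  by (simp add: fraction_add)

lemma embed_mult:
  "a \<in> carrier R \<Longrightarrow> b \<in> carrier R \<Longrightarrow> embed a \<otimes>\<^bsub>fraction_field R\<^esub> embed b = embed (a \<otimes> b)"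
  by (simp add: fraction_mult)

lemma embed_finsum:
  assumes "finite I" "f \<in> I \<rightarrow> carrier R"
  shows "(\<Oplus>\<^bsub>fraction_field R\<^esub>i\<in>I. embed (f i)) = embed (\<Oplus>i\<in>I. f i)"
proof -
  interpret K: abelian_monoid "fraction_field R"
    by (rule abelian_monoid_fraction_field)
  show ?thesis
    using assms
  proof (induction I)
    case empty
    then show ?case by (simp add: zero_fraction_field)
  next
    case (insert i I)
    then have f: "f \<in> I \<rightarrow> carrier R" "f i \<in> carrier R" by auto
    then have "(\<lambda>i. embed (f i)) \<in> I \<rightarrow> carrier (fraction_field R)"
      using embed_closed by auto
    with insert f show ?case
      by (simp add: embed_closed embed_add finsum_closed)
  qed
qed

section \<open>Integral vectors in a subspace over the fraction field\<close>

abbreviation embed_vec :: "nat \<Rightarrow> (nat \<Rightarrow> 'a) \<Rightarrow> nat \<Rightarrow> ('a \<times> 'a) set" where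
  "embed_vec r v \<equiv> (\<lambda>i\<in>{..<r}. embed (v i))"

lemma mat_vec_embed:
  assumes "A \<in> matrices R r" "v \<in> {..<r} \<rightarrow>\<^sub>E carrier R"
  shows "mat_vec (fraction_field R) r (\<lambda>i\<in>{..<r}. \<lambda>j\<in>{..<r}. embed (A i j)) (embed_vec r v)
    = embed_vec r (mat_vec R r A v)"
proof (rule ext)
  fix i
  interpret K: abelian_monoid "fraction_field R"
    by (rule abelian_monoid_fraction_field)
  show "mat_vec (fraction_field R) r (\<lambda>i\<in>{..<r}. \<lambda>j\<in>{..<r}. embed (A i j)) (embed_vec r v) i
      = embed_vec r (mat_vec R r A v) i"
  proof (cases "i < r")
    case True
    have A: "A i j \<in> carrier R" and v: "v j \<in> carrier R" if "j < r" for j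
      using assms True that by (auto simp: matrices_def)
    have "(\<Oplus>\<^bsub>fraction_field R\<^esub>j\<in>{..<r}.
        (\<lambda>i\<in>{..<r}. \<lambda>j\<in>{..<r}. embed (A i j)) i j \<otimes>\<^bsub>fraction_field R\<^esub> embed_vec r v j)
      = (\<Oplus>\<^bsub>fraction_field R\<^esub>j\<in>{..<r}. embed (A i j \<otimes> v j))"
      using True A v by (intro K.finsum_cong') (auto simp: embed_mult embed_closed)
    also have "\<dots> = embed (\<Oplus>j\<in>{..<r}. A i j \<otimes> v j)"
      using A v by (intro embed_finsum) auto
    finally show ?thesis
      using True by (simp add: mat_vec_def)
  qed (simp add: mat_vec_def)
qed

definition lattice :: "nat \<Rightarrow> (nat \<Rightarrow> ('a \<times> 'a) set) set \<Rightarrow> (nat \<Rightarrow> 'a) set" where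
  "lattice r W = {v \<in> {..<r} \<rightarrow>\<^sub>E carrier R. embed_vec r v \<in> W}"

lemma lattice_zero:
  assumes "submodule W (fraction_field R) (vec_space (fraction_field R) r)"
  shows "(\<lambda>i\<in>{..<r}. \<zero>) \<in> lattice r W"
proof -
  have "\<one>\<^bsub>add_monoid (vec_space (fraction_field R) r)\<^esub> \<in> W"
    using assms by (intro subgroup.one_closed) (simp add: submodule_def)
  then show ?thesis
    by (simp add: lattice_def vec_space_def zero_fraction_field cong: restrict_cong)
qed

lemma lattice_add:
  assumes "submodule W (fraction_field R) (vec_space (fraction_field R) r)"
    and "v \<in> lattice r W" "w \<in> lattice r W"
  shows "(\<lambda>i\<in>{..<r}. v i \<oplus> w i) \<in> lattice r W"
proof -
  have v: "v i \<in> carrier R" "w i \<in> carrier R" if "i < r" for i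
    using assms that by (auto simp: lattice_def)
  have "embed_vec r v \<otimes>\<^bsub>add_monoid (vec_space (fraction_field R) r)\<^esub> embed_vec r w \<in> W"
    using assms by (intro subgroup.m_closed) (auto simp add: submodule_def lattice_def)
  also have "embed_vec r v \<otimes>\<^bsub>add_monoid (vec_space (fraction_field R) r)\<^esub> embed_vec r w
      = embed_vec r (\<lambda>i\<in>{..<r}. v i \<oplus> w i)"
    using v by (simp add: vec_space_def embed_add fun_eq_iff)
  finally have "embed_vec r (\<lambda>i\<in>{..<r}. v i \<oplus> w i) \<in> W" .
  with v show ?thesis
    unfolding lattice_def by (intro CollectI conjI) auto
qed

text \<open>Purity of the lattice: \<open>W\<close> is stable under multiplication by
  \<open>c\<close> and by its inverse, the fraction with numerator \<open>\<one>\<close> and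
  denominator \<open>c\<close>.\<close>

lemma lattice_smult_iff:
  assumes W: "submodule W (fraction_field R) (vec_space (fraction_field R) r)"
    and v: "v \<in> {..<r} \<rightarrow>\<^sub>E carrier R" and c: "c \<in> carrier R" "c \<noteq> \<zero>"
  shows "(\<lambda>i\<in>{..<r}. c \<otimes> v i) \<in> lattice r W \<longleftrightarrow> v \<in> lattice r W"
proof -
  let ?K = "fraction_field R"
  have v': "v i \<in> carrier R" if "i < r" for i
    using v that by auto
  have sm: "k \<odot>\<^bsub>vec_space ?K r\<^esub> x \<in> W" if "k \<in> carrier ?K" "x \<in> W" for k x
    using submodule.smult_closed[OF W that] .
  have 1: "embed c \<odot>\<^bsub>vec_space ?K r\<^esub> embed_vec r v = embed_vec r (\<lambda>i\<in>{..<r}. c \<otimes> v i)"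
    using v' c by (simp add: vec_space_def embed_mult fun_eq_iff)
  have 2: "fraction R \<one> c \<odot>\<^bsub>vec_space ?K r\<^esub> embed_vec r (\<lambda>i\<in>{..<r}. c \<otimes> v i) = embed_vec r v"
    using v' c by (simp add: vec_space_def fraction_mult fraction_eq_iff m_comm fun_eq_iff)
  show ?thesis
    using sm[of "embed c" "embed_vec r v"] sm[of "fraction R \<one> c" "embed_vec r (\<lambda>i\<in>{..<r}. c \<otimes> v i)"]
      1 2 c v v' by (auto simp: lattice_def embed_closed fraction_in_carrier)
qed

lemma lattice_smult:
  assumes W: "submodule W (fraction_field R) (vec_space (fraction_field R) r)"
    and v: "v \<in> lattice r W" and c: "c \<in> carrier R"
  shows "(\<lambda>i\<in>{..<r}. c \<otimes> v i) \<in> lattice r W"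
proof (cases "c = \<zero>")
  case True
  have "v i \<in> carrier R" if "i < r" for i
    using v that by (auto simp: lattice_def)
  then have "(\<lambda>i\<in>{..<r}. c \<otimes> v i) = (\<lambda>i\<in>{..<r}. \<zero>)"
    using True by (intro restrict_ext) simp
  then show ?thesis using lattice_zero[OF W] by simp
next
  case False
  have "v \<in> {..<r} \<rightarrow>\<^sub>E carrier R"
    using v by (simp add: lattice_def)
  from lattice_smult_iff[OF W this c False] v show ?thesis by blast
qed

text \<open>Induction over initial segments of the coordinates: adjoining an entry a / b to
  numerators over c gives the denominator cb, with the old numerators multiplied by b and the new
  one equal to ac.\<close>

lemma common_denominator:
  fixes r :: nat
  assumes "w \<in> {..<r} \<rightarrow>\<^sub>E carrier (fraction_field R)"
  obtains c v where "c \<in> carrier R" "c \<noteq> \<zero>" "v \<in> {..<r} \<rightarrow>\<^sub>E carrier R"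
    "\<And>i. i < r \<Longrightarrow> w i = fraction R (v i) c"
proof -
  have "\<exists>c v. c \<in> carrier R \<and> c \<noteq> \<zero> \<and> v \<in> {..<k} \<rightarrow> carrier R \<and>
      (\<forall>i<k. w i = fraction R (v i) c)" if "k \<le> r" for k
    using that
  proof (induction k)
    case 0
    then show ?case
      by (intro exI[of _ \<one>] exI[of _ "\<lambda>_. \<zero>"]) simp
  next
    case (Suc k)
    then obtain c v where cv: "c \<in> carrier R" "c \<noteq> \<zero>" "v \<in> {..<k} \<rightarrow> carrier R"
      "\<forall>i<k. w i = fraction R (v i) c" by auto
    have "w k \<in> carrier (fraction_field R)"
      using Suc.prems assms by auto
    then obtain a b where ab: "a \<in> carrier R" "b \<in> carrier R" "b \<noteq> \<zero>" "w k = fraction R a b"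
      by (rule fraction_cases)
    have v: "v i \<in> carrier R" if "i < k" for i using cv that by auto
    show ?case
      using cv ab v
      by (intro exI[of _ "c \<otimes> b"] exI[of _ "\<lambda>i. if i = k then a \<otimes> c else v i \<otimes> b"])
         (auto simp: integral_iff less_Suc_eq fraction_eq_iff m_ac)
  qed
  from this[OF order.refl] obtain c v where "c \<in> carrier R" "c \<noteq> \<zero>" "v \<in> {..<r} \<rightarrow> carrier R"
      "\<forall>i<r. w i = fraction R (v i) c" by auto
  then show thesis
    by (intro that[of c "restrict v {..<r}"]) auto
qed

lemma vec_in_iff_numerator_in_lattice:
  assumes W: "submodule W (fraction_field R) (vec_space (fraction_field R) r)"
    and c: "c \<in> carrier R" "c \<noteq> \<zero>" and v: "v \<in> {..<r} \<rightarrow>\<^sub>E carrier R"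
    and w: "w \<in> {..<r} \<rightarrow>\<^sub>E carrier (fraction_field R)" "\<And>i. i < r \<Longrightarrow> w i = fraction R (v i) c"
  shows "w \<in> W \<longleftrightarrow> v \<in> lattice r W"
proof -
  let ?K = "fraction_field R"
  have v': "v i \<in> carrier R" if "i < r" for i
    using v that by auto
  have sm: "k \<odot>\<^bsub>vec_space ?K r\<^esub> x \<in> W" if "k \<in> carrier ?K" "x \<in> W" for k x
    using submodule.smult_closed[OF W that] .
  have 1: "embed c \<odot>\<^bsub>vec_space ?K r\<^esub> w = embed_vec r v"
    using v' c w(2) by (simp add: vec_space_def fraction_mult fraction_eq_iff m_ac fun_eq_iff)
  have "restrict w {..<r} = w" using w(1) by (simp add: PiE_restrict)
  moreover have "fraction R \<one> c \<odot>\<^bsub>vec_space ?K r\<^esub> embed_vec r v = restrict w {..<r}"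
    using v' c w(2) by (simp add: vec_space_def fraction_mult fraction_eq_iff m_ac fun_eq_iff)
  ultimately have 2: "fraction R \<one> c \<odot>\<^bsub>vec_space ?K r\<^esub> embed_vec r v = w" by simp
  show ?thesis
    using sm[of "embed c" w] sm[of "fraction R \<one> c" "embed_vec r v"]
      1 2 c v by (auto simp: lattice_def embed_closed fraction_in_carrier)
qed

text \<open>Every vector over the fraction field is a scalar multiple of an integral one, so
  \<open>W\<close> is zero or everything as soon as its lattice is.\<close>

lemma submodule_eq_zero_or_carrier:
  assumes W: "submodule W (fraction_field R) (vec_space (fraction_field R) r)"
    and L: "\<And>v. v \<in> lattice r W \<Longrightarrow> v \<noteq> (\<lambda>i\<in>{..<r}. \<zero>) \<Longrightarrow> lattice r W = {..<r} \<rightarrow>\<^sub>E carrier R"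
  shows "W = {\<zero>\<^bsub>vec_space (fraction_field R) r\<^esub>} \<or> W = carrier (vec_space (fraction_field R) r)"
proof (cases "\<exists>v \<in> lattice r W. v \<noteq> (\<lambda>i\<in>{..<r}. \<zero>)")
  case True
  then have *: "lattice r W = {..<r} \<rightarrow>\<^sub>E carrier R" using L by blast
  have "W \<subseteq> carrier (vec_space (fraction_field R) r)"
    using subgroup.subset[of W "add_monoid (vec_space (fraction_field R) r)"] W
    by (auto simp: submodule_def)
  moreover have "w \<in> W" if "w \<in> carrier (vec_space (fraction_field R) r)" for w
  proof -
    have w: "w \<in> {..<r} \<rightarrow>\<^sub>E carrier (fraction_field R)" using that by (simp add: vec_space_def)
    then show ?thesis
      using * by (metis common_denominator vec_in_iff_numerator_in_lattice[OF W])
  qed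
  ultimately show ?thesis by blast
next
  case False
  have "w = \<zero>\<^bsub>vec_space (fraction_field R) r\<^esub>" if "w \<in> W" for w
  proof -
    have w: "w \<in> {..<r} \<rightarrow>\<^sub>E carrier (fraction_field R)"
      using that subgroup.subset[of W "add_monoid (vec_space (fraction_field R) r)"] W
      by (auto simp: submodule_def vec_space_def)
    then obtain c v where c: "c \<in> carrier R" "c \<noteq> \<zero>" and v: "v \<in> {..<r} \<rightarrow>\<^sub>E carrier R"
      and eq: "\<And>i. i < r \<Longrightarrow> w i = fraction R (v i) c"
      by (rule common_denominator) blast
    then have "v = (\<lambda>i\<in>{..<r}. \<zero>)"
      using False vec_in_iff_numerator_in_lattice[OF W c v w eq] that by blast
    then have "w i = fraction R \<zero> \<one>" if "i < r" for i
      using eq[OF that] that c by (simp add: fraction_eq_iff)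
    then have "restrict w {..<r} = \<zero>\<^bsub>vec_space (fraction_field R) r\<^esub>"
      by (simp add: vec_space_def zero_fraction_field fun_eq_iff)
    then show ?thesis using w by (simp add: PiE_restrict)
  qed
  moreover have "\<zero>\<^bsub>vec_space (fraction_field R) r\<^esub> \<in> W"
    using subgroup.one_closed[of W "add_monoid (vec_space (fraction_field R) r)"] W
    by (simp add: submodule_def)
  ultimately show ?thesis by blast
qed

end

section \<open>The p-adic integers\<close>

lemma padic_mod:
  assumes "x \<in> carrier (padic_integers p)" "m \<le> n"
  shows "x n mod int p ^ m = x m"
  using assms(2)
proof (induction n rule: dec_induct)
  case base
  then show ?case using assms(1) by (simp add: padic_integers_def)
next
  case (step n)
  have "int p ^ m dvd int p ^ n"
    using step by (simp add: le_imp_power_dvd)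
  then have "x (Suc n) mod int p ^ m = x (Suc n) mod int p ^ n mod int p ^ m"
    by (simp add: mod_mod_cancel)
  also have "x (Suc n) mod int p ^ n = x n"
    using assms(1) by (simp add: padic_integers_def)
  finally show ?case using step by simp
qed

lemma padic_range:
  assumes "x \<in> carrier (padic_integers p)"
  shows "0 \<le> x n" "x n < int p ^ n"
  using assms by (auto simp: padic_integers_def)

text \<open>Integers up to congruence let sums, products and negatives be handled by the congruence
  rules; reduction to the canonical residue is done once here.\<close>

lemma padic_intI:
  assumes "p > 0" "\<And>n. [x (Suc n) = x n] (mod int p ^ n)"
  shows "(\<lambda>n. x n mod int p ^ n) \<in> carrier (padic_integers p)"
proof -
  have "x (Suc n) mod int p ^ Suc n mod int p ^ n = x n mod int p ^ n" for n
  proof -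
    have "x (Suc n) mod int p ^ Suc n mod int p ^ n = x (Suc n) mod int p ^ n"
      by (intro mod_mod_cancel) simp
    then show ?thesis using assms(2)[of n] by (simp add: cong_def)
  qed
  with assms(1) show ?thesis by (simp add: padic_integers_def del: power_Suc)
qed

lemma padic_cong:
  assumes "x \<in> carrier (padic_integers p)"
  shows "[x (Suc n) = x n] (mod int p ^ n)"
  using padic_mod[OF assms, of n "Suc n"] padic_range[OF assms, of n] by (simp add: cong_def)

lemma cring_padic_integers:
  assumes "p > 0"
  shows "cring (padic_integers p)"
proof (rule cringI)
  let ?R = "padic_integers p"
  show "abelian_group ?R"
  proof (rule abelian_groupI)
    fix x y z assume x: "x \<in> carrier ?R" and y: "y \<in> carrier ?R" and z: "z \<in> carrier ?R"
    show "x \<oplus>\<^bsub>?R\<^esub> y \<in> carrier ?R"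
      using padic_intI[OF assms cong_add[OF padic_cong[OF x] padic_cong[OF y]]]
      by (simp add: padic_integers_def)
    show "x \<oplus>\<^bsub>?R\<^esub> y \<oplus>\<^bsub>?R\<^esub> z = x \<oplus>\<^bsub>?R\<^esub> (y \<oplus>\<^bsub>?R\<^esub> z)"
      by (simp add: padic_integers_def mod_simps add.assoc)
    show "x \<oplus>\<^bsub>?R\<^esub> y = y \<oplus>\<^bsub>?R\<^esub> x"
      by (simp add: padic_integers_def add.commute)
    show "\<zero>\<^bsub>?R\<^esub> \<oplus>\<^bsub>?R\<^esub> x = x"
      using x by (simp add: padic_integers_def)
    have "(\<lambda>n. (- x n) mod int p ^ n) \<in> carrier ?R"
      by (intro padic_intI[OF assms]) (simp add: cong_minus_minus_iff padic_cong[OF x])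
    moreover have "(\<lambda>n. (- x n) mod int p ^ n) \<oplus>\<^bsub>?R\<^esub> x = \<zero>\<^bsub>?R\<^esub>"
      by (simp add: padic_integers_def mod_simps)
    ultimately show "\<exists>y\<in>carrier ?R. y \<oplus>\<^bsub>?R\<^esub> x = \<zero>\<^bsub>?R\<^esub>" by blast
  next
    show "\<zero>\<^bsub>?R\<^esub> \<in> carrier ?R" using assms by (simp add: padic_integers_def)
  qed
  show "Group.comm_monoid ?R"
  proof (rule comm_monoidI)
    fix x y z assume x: "x \<in> carrier ?R" and y: "y \<in> carrier ?R" and z: "z \<in> carrier ?R"
    show "x \<otimes>\<^bsub>?R\<^esub> y \<in> carrier ?R"
      using padic_intI[OF assms cong_mult[OF padic_cong[OF x] padic_cong[OF y]]]
      by (simp add: padic_integers_def)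
    show "x \<otimes>\<^bsub>?R\<^esub> y \<otimes>\<^bsub>?R\<^esub> z = x \<otimes>\<^bsub>?R\<^esub> (y \<otimes>\<^bsub>?R\<^esub> z)"
      by (simp add: padic_integers_def mod_simps mult.assoc)
    show "x \<otimes>\<^bsub>?R\<^esub> y = y \<otimes>\<^bsub>?R\<^esub> x"
      by (simp add: padic_integers_def mult.commute)
    show "\<one>\<^bsub>?R\<^esub> \<otimes>\<^bsub>?R\<^esub> x = x"
      using x by (simp add: padic_integers_def mod_simps)
  next
    show "\<one>\<^bsub>?R\<^esub> \<in> carrier ?R"
      using padic_intI[OF assms, of "\<lambda>_. 1"] by (simp add: padic_integers_def)
  qed
  fix x y z assume "x \<in> carrier ?R" and "y \<in> carrier ?R" and "z \<in> carrier ?R"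
  show "(x \<oplus>\<^bsub>?R\<^esub> y) \<otimes>\<^bsub>?R\<^esub> z = x \<otimes>\<^bsub>?R\<^esub> z \<oplus>\<^bsub>?R\<^esub> y \<otimes>\<^bsub>?R\<^esub> z"
    by (simp add: padic_integers_def mod_simps distrib_right)
qed

lemma padic_nonzero_not_dvd:
  assumes "x \<in> carrier (padic_integers p)" "x m \<noteq> 0" "m \<le> n"
  shows "\<not> int p ^ m dvd x n"
  using padic_mod[OF assms(1,3)] assms(2) by (auto simp: dvd_eq_mod_eq_0)

text \<open>Valuations at \<open>q\<close> are additive on products, and valuations below m and
  below n cannot add up to m + n or more.\<close>

lemma prime_power_dvd_mult_split:
  fixes q :: int
  assumes "Factorial_Ring.prime q" "q ^ (m + n) dvd a * b"
  shows "q ^ m dvd a \<or> q ^ n dvd b"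
proof (rule ccontr)
  assume "\<not> ?thesis"
  then have ab: "\<not> q ^ m dvd a" "\<not> q ^ n dvd b" by auto
  then have nz: "a \<noteq> 0" "b \<noteq> 0" by auto
  have nu: "\<not> is_unit q" using assms(1) not_prime_unit by blast
  have "multiplicity q a < m" "multiplicity q b < n"
    using ab nz nu by (auto simp: power_dvd_iff_le_multiplicity)
  moreover have "multiplicity q (a * b) = multiplicity q a + multiplicity q b"
    using assms(1) nz by (intro prime_elem_multiplicity_mult_distrib) auto
  moreover have "m + n \<le> multiplicity q (a * b)"
    using assms(2) nz nu by (simp add: power_dvd_iff_le_multiplicity)
  ultimately show False by simp
qed

lemma domain_padic_integers:
  assumes "Factorial_Ring.prime p"
  shows "domain (padic_integers p)"
proof -
  let ?R = "padic_integers p"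
  have p: "p > 0" using assms prime_gt_0_nat by blast
  interpret R: cring ?R by (rule cring_padic_integers[OF p])
  show ?thesis
  proof (rule domain.intro[OF R.cring_axioms], unfold_locales)
    have "\<one>\<^bsub>?R\<^esub> 1 \<noteq> \<zero>\<^bsub>?R\<^esub> 1"
      using prime_gt_1_nat[OF assms] by (simp add: padic_integers_def)
    then show "\<one>\<^bsub>?R\<^esub> \<noteq> \<zero>\<^bsub>?R\<^esub>" by metis
    fix x y assume xy: "x \<otimes>\<^bsub>?R\<^esub> y = \<zero>\<^bsub>?R\<^esub>" and x: "x \<in> carrier ?R" and y: "y \<in> carrier ?R"
    show "x = \<zero>\<^bsub>?R\<^esub> \<or> y = \<zero>\<^bsub>?R\<^esub>"
    proof (rule ccontr)
      assume "\<not> ?thesis"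
      \<comment> \<open>A nonzero residue at level \<open>m\<close> keeps the valuation below
        \<open>m\<close> at all later levels. Level \<open>m + n\<close> is where the two bounds
        contradict the vanishing of the product.\<close>
      then obtain m n where "x m \<noteq> 0" "y n \<noteq> 0"
        by (auto simp: padic_integers_def fun_eq_iff)
      with x y have "\<not> int p ^ m dvd x (m + n)" "\<not> int p ^ n dvd y (m + n)"
        by (simp_all add: padic_nonzero_not_dvd)
      moreover have "int p ^ (m + n) dvd x (m + n) * y (m + n)"
        using fun_cong[OF xy, of "m + n"] by (simp add: padic_integers_def dvd_eq_mod_eq_0)
      ultimately show False
        using prime_power_dvd_mult_split[of "int p" m n] assms by auto
    qed
  qed
qed

section \<open>Division by powers of p and elimination over the p-adic integers\<close>

definition padic_of_int :: "nat \<Rightarrow> int \<Rightarrow> nat \<Rightarrow> int" where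
  "padic_of_int p a = (\<lambda>n. a mod int p ^ n)"

lemma padic_of_int_closed: "p > 0 \<Longrightarrow> padic_of_int p a \<in> carrier (padic_integers p)"
  unfolding padic_of_int_def by (rule padic_intI) auto

text \<open>Dividing by p^m costs m levels of precision, so the residue of the quotient at level
  \<open>n\<close> is read off from \<open>x\<close> at level \<open>n + m\<close>.\<close>

lemma padic_div_power:
  assumes x: "x \<in> carrier (padic_integers p)" and "x m = 0" and p: "p > 0"
  defines "y \<equiv> \<lambda>n. x (n + m) div int p ^ m"
  shows "y \<in> carrier (padic_integers p)" "x = padic_of_int p (int p ^ m) \<otimes>\<^bsub>padic_integers p\<^esub> y"
proof -
  have dvd: "int p ^ m dvd x (n + m)" for n
    using padic_mod[OF x, of m "n + m"] assms(2) by (simp add: dvd_eq_mod_eq_0)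
  then have xy: "x (n + m) = int p ^ m * y n" for n
    by (simp add: y_def)
  have pm: "int p ^ m > 0" using p by simp
  show y: "y \<in> carrier (padic_integers p)"
  proof -
    have "0 \<le> y n" "y n < int p ^ n" "y (Suc n) mod int p ^ n = y n" for n
    proof -
      have "0 \<le> int p ^ m * y n" "int p ^ m * y n < int p ^ m * int p ^ n"
        using padic_range[OF x, of "n + m"] by (simp_all add: xy power_add mult.commute)
      then show "0 \<le> y n" "y n < int p ^ n"
        using pm by (simp_all add: zero_le_mult_iff)
      have "int p ^ m * (y (Suc n) mod int p ^ n) = x (Suc n + m) mod int p ^ (n + m)"
        by (simp only: mult_mod_right xy power_add mult.commute[of "int p ^ m" "int p ^ n"])
      also have "\<dots> = int p ^ m * y n"
        using padic_mod[OF x, of "n + m" "Suc n + m"] xy[of n] by simp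
      finally have "int p ^ m * (y (Suc n) mod int p ^ n) = int p ^ m * y n" .
      then show "y (Suc n) mod int p ^ n = y n" using p by simp
    qed
    then show ?thesis by (simp add: padic_integers_def)
  qed
  show "x = padic_of_int p (int p ^ m) \<otimes>\<^bsub>padic_integers p\<^esub> y"
  proof
    fix n
    have "x n = x (n + m) mod int p ^ n"
      using padic_mod[OF x, of n "n + m"] by simp
    also have "\<dots> = (int p ^ m * y n) mod int p ^ n"
      by (simp add: xy)
    finally show "x n = (padic_of_int p (int p ^ m) \<otimes>\<^bsub>padic_integers p\<^esub> y) n"
      by (simp add: padic_integers_def padic_of_int_def mod_simps)
  qed
qed

lemma padic_finsum:
  assumes "p > 0" "finite I" "f \<in> I \<rightarrow> carrier (padic_integers p)"
  shows "(\<Oplus>\<^bsub>padic_integers p\<^esub>i\<in>I. f i) n = (\<Sum>i\<in>I. f i n) mod int p ^ n"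
proof -
  interpret R: cring "padic_integers p" by (rule cring_padic_integers) fact
  show ?thesis
    using assms(2,3)
  proof (induction I)
    case empty
    have "\<zero>\<^bsub>padic_integers p\<^esub> n = 0" by (simp add: padic_integers_def)
    then show ?case by simp
  next
    case (insert i I)
    then have "(\<Oplus>\<^bsub>padic_integers p\<^esub>i\<in>insert i I. f i)
        = f i \<oplus>\<^bsub>padic_integers p\<^esub> (\<Oplus>\<^bsub>padic_integers p\<^esub>i\<in>I. f i)"
      by (intro R.finsum_insert) auto
    with insert show ?case
      by (simp add: padic_integers_def mod_simps)
  qed
qed

lemma mat_vec_padic:
  assumes p: "p > 0" and A: "A \<in> matrices (padic_integers p) r"
    and v: "v \<in> {..<r} \<rightarrow>\<^sub>E carrier (padic_integers p)" and "i < r"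
  shows "mat_vec (padic_integers p) r A v i n = (\<Sum>j<r. A i j n * v j n) mod int p ^ n"
proof -
  interpret R: cring "padic_integers p" by (rule cring_padic_integers) fact
  have "mat_vec (padic_integers p) r A v i n
      = (\<Sum>j<r. (A i j \<otimes>\<^bsub>padic_integers p\<^esub> v j) n) mod int p ^ n"
    using assms unfolding mat_vec_def
    by (simp add: restrict_def, intro padic_finsum) (auto simp: matrices_def intro!: R.m_closed)
  then show ?thesis
    by (simp add: padic_integers_def mod_simps mod_sum_eq)
qed

text \<open>The proof is Gaussian elimination without division, which produces nonzero multiples of the unit
  vectors; purity of the lattice then gives the unit vectors themselves.\<close>

lemma lattice_eq_carrier:
  assumes p: "Factorial_Ring.prime p"
    and W: "submodule W (padic_numbers p) (vec_space (padic_numbers p) r)"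
    and unit: "\<And>i. i < r \<Longrightarrow> \<exists>w \<in> domain.lattice (padic_integers p) r W.
      \<forall>j<r. w j 1 = (if j = i then 1 else 0)"
  shows "domain.lattice (padic_integers p) r W = {..<r} \<rightarrow>\<^sub>E carrier (padic_integers p)"
proof -
  let ?R = "padic_integers p"
  interpret R: domain ?R by (rule domain_padic_integers) fact
  let ?L = "R.lattice r W"
  have p1: "p > 1" using p prime_gt_1_nat by blast
  have Lc: "v j \<in> carrier ?R" if "v \<in> ?L" "j < r" for v j
    using that by (auto simp: R.lattice_def)
  have "\<exists>w. \<forall>i<r. w i \<in> ?L \<and> (\<forall>j<r. w i j 1 = (if j = i then 1 else 0)) \<and>
      (\<forall>j<k. j \<noteq> i \<longrightarrow> w i j = \<zero>\<^bsub>?R\<^esub>)" if "k \<le> r" for k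
    using that
  proof (induction k)
    case 0
    have "\<forall>i. \<exists>w. i < r \<longrightarrow> w \<in> ?L \<and> (\<forall>j<r. w j 1 = (if j = i then 1 else 0))"
      using unit by blast
    from choice[OF this] show ?case by auto
  next
    case (Suc k)
    then obtain w where wL: "\<And>i. i < r \<Longrightarrow> w i \<in> ?L"
      and w1: "\<And>i j. i < r \<Longrightarrow> j < r \<Longrightarrow> w i j 1 = (if j = i then 1 else 0)"
      and w0: "\<And>i j. i < r \<Longrightarrow> j < k \<Longrightarrow> j \<noteq> i \<Longrightarrow> w i j = \<zero>\<^bsub>?R\<^esub>"
      by auto
    have k: "k < r" using Suc.prems by simp
    \<comment> \<open>Row i becomes w_kk w_i - w_ik w_k. Modulo p the pivot w_kk is 1 and w_ik is 0,
      so the residues of the unit vectors persist; the zeros in earlier columns survive because both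
      rows vanish there.\<close>
    define u where "u i = (if i = k then w k else
      (\<lambda>j\<in>{..<r}. (\<lambda>j\<in>{..<r}. w k k \<otimes>\<^bsub>?R\<^esub> w i j) j \<oplus>\<^bsub>?R\<^esub>
         (\<lambda>j\<in>{..<r}. (\<ominus>\<^bsub>?R\<^esub> w i k) \<otimes>\<^bsub>?R\<^esub> w k j) j))" for i
    have uL: "u i \<in> ?L" if "i < r" for i
    proof (cases "i = k")
      case True
      then show ?thesis using wL[OF k] by (simp add: u_def)
    next
      case False
      have "w i k \<in> carrier ?R" "w k k \<in> carrier ?R"
        using Lc wL that k by blast+
      then show ?thesis
        unfolding u_def if_not_P[OF False]
        by (intro R.lattice_add[OF W] R.lattice_smult[OF W] R.a_inv_closed wL that k)
    qed
    have ueq: "u i j = (w k k \<otimes>\<^bsub>?R\<^esub> w i j) \<oplus>\<^bsub>?R\<^esub> ((\<ominus>\<^bsub>?R\<^esub> w i k) \<otimes>\<^bsub>?R\<^esub> w k j)"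
      if "i \<noteq> k" "j < r" for i j using that by (simp add: u_def)
    have c: "w i j \<in> carrier ?R" if "i < r" "j < r" for i j
      using Lc wL that by blast
    have neg0: "(\<ominus>\<^bsub>?R\<^esub> w i k) 1 = 0" if "i < r" "i \<noteq> k" for i
    proof -
      have "((\<ominus>\<^bsub>?R\<^esub> w i k) \<oplus>\<^bsub>?R\<^esub> w i k) 1 = 0"
        using c[OF that(1) k] by (simp add: R.l_neg) (simp add: padic_integers_def)
      moreover have "w i k 1 = 0" using w1[OF that(1) k] that by simp
      ultimately have "(\<ominus>\<^bsub>?R\<^esub> w i k) 1 mod int p ^ 1 = 0"
        by (simp add: padic_integers_def)
      moreover have "\<ominus>\<^bsub>?R\<^esub> w i k \<in> carrier ?R" using c[OF that(1) k] by simp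
      ultimately show ?thesis using padic_mod[of "\<ominus>\<^bsub>?R\<^esub> w i k" p 1 1] by simp
    qed
    have u1: "u i j 1 = (if j = i then 1 else 0)" if "i < r" "j < r" for i j
    proof (cases "i = k")
      case True
      then show ?thesis using w1[OF k that(2)] by (simp add: u_def)
    next
      case False
      have "u i j 1 = (w k k 1 * w i j 1 + (\<ominus>\<^bsub>?R\<^esub> w i k) 1 * w k j 1) mod int p ^ 1"
        unfolding ueq[OF False that(2)] by (simp add: padic_integers_def mod_simps)
      then show ?thesis
        using w1[OF k k] w1[OF that] neg0[OF that(1) False] p1 by simp
    qed
    have u0: "u i j = \<zero>\<^bsub>?R\<^esub>" if "i < r" "j < Suc k" "j \<noteq> i" for i j
    proof (cases "i = k")
      case True
      then show ?thesis using w0[OF k, of j] that by (simp add: u_def)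
    next
      case False
      have j: "j < r" using that k by simp
      show ?thesis
      proof (cases "j = k")
        case True
        show ?thesis
          unfolding ueq[OF False j] unfolding True
          using c[OF k k] c[OF that(1) k] by (simp add: R.l_minus R.r_neg R.m_comm[of "w k k"])
      next
        case jk: False
        then have "w i j = \<zero>\<^bsub>?R\<^esub>" "w k j = \<zero>\<^bsub>?R\<^esub>"
          using w0[OF that(1), of j] w0[OF k, of j] that by auto
        then show ?thesis
          unfolding ueq[OF False j] using c[OF k k] c[OF that(1) k] by simp
      qed
    qed
    show ?case using uL u1 u0 by (intro exI[of _ u]) auto
  qed
  from this[OF order.refl] obtain w where wL: "\<And>i. i < r \<Longrightarrow> w i \<in> ?L"
      and w1: "\<And>i j. i < r \<Longrightarrow> j < r \<Longrightarrow> w i j 1 = (if j = i then 1 else 0)"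
      and w0: "\<And>i j. i < r \<Longrightarrow> j < r \<Longrightarrow> j \<noteq> i \<Longrightarrow> w i j = \<zero>\<^bsub>?R\<^esub>"
    by auto
  define e where "e i = (\<lambda>j\<in>{..<r}. if j = i then \<one>\<^bsub>?R\<^esub> else \<zero>\<^bsub>?R\<^esub>)" for i
  have e: "e i \<in> ?L" if i: "i < r" for i
  proof -
    have nz: "w i i \<noteq> \<zero>\<^bsub>?R\<^esub>"
    proof
      assume "w i i = \<zero>\<^bsub>?R\<^esub>"
      then have "w i i 1 = 0" by (simp add: padic_integers_def)
      with w1[OF i i] show False by simp
    qed
    have "(\<lambda>j\<in>{..<r}. w i i \<otimes>\<^bsub>?R\<^esub> e i j) = restrict (w i) {..<r}"
      using Lc[OF wL[OF i]] i w0[OF i] by (intro restrict_ext) (auto simp: e_def)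
    moreover have "restrict (w i) {..<r} = w i"
      using wL[OF i] by (auto simp: R.lattice_def intro: PiE_restrict)
    ultimately have "(\<lambda>j\<in>{..<r}. w i i \<otimes>\<^bsub>?R\<^esub> e i j) \<in> ?L" using wL[OF i] by simp
    then show ?thesis
      using R.lattice_smult_iff[OF W _ Lc[OF wL[OF i] i] nz, of "e i"] by (auto simp: e_def)
  qed
  have "v \<in> ?L" if v: "v \<in> {..<r} \<rightarrow>\<^sub>E carrier ?R" for v
  proof -
    have vc: "v j \<in> carrier ?R" if "j < r" for j using v that by auto
    have "(\<lambda>j\<in>{..<r}. if j < k then v j else \<zero>\<^bsub>?R\<^esub>) \<in> ?L" if "k \<le> r" for k
      using that
    proof (induction k)
      case 0
      have "(\<lambda>j\<in>{..<r}. if j < 0 then v j else \<zero>\<^bsub>?R\<^esub>) = (\<lambda>j\<in>{..<r}. \<zero>\<^bsub>?R\<^esub>)"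
        by (intro restrict_ext) simp
      then show ?case using R.lattice_zero[OF W] by (simp only:)
    next
      case (Suc k)
      have "(\<lambda>j\<in>{..<r}. (\<lambda>j\<in>{..<r}. if j < k then v j else \<zero>\<^bsub>?R\<^esub>) j \<oplus>\<^bsub>?R\<^esub>
          (\<lambda>j\<in>{..<r}. v k \<otimes>\<^bsub>?R\<^esub> e k j) j) \<in> ?L"
        using Suc vc e by (intro R.lattice_add[OF W] R.lattice_smult[OF W]) auto
      also have "(\<lambda>j\<in>{..<r}. (\<lambda>j\<in>{..<r}. if j < k then v j else \<zero>\<^bsub>?R\<^esub>) j \<oplus>\<^bsub>?R\<^esub>
          (\<lambda>j\<in>{..<r}. v k \<otimes>\<^bsub>?R\<^esub> e k j) j) = (\<lambda>j\<in>{..<r}. if j < Suc k then v j else \<zero>\<^bsub>?R\<^esub>)"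
        using Suc.prems vc by (intro restrict_ext) (auto simp: e_def less_Suc_eq)
      finally show ?case .
    qed
    from this[OF order.refl] have "(\<lambda>j\<in>{..<r}. if j < r then v j else \<zero>\<^bsub>?R\<^esub>) \<in> ?L" .
    also have "(\<lambda>j\<in>{..<r}. if j < r then v j else \<zero>\<^bsub>?R\<^esub>) = restrict v {..<r}"
      by (intro restrict_ext) auto
    also have "\<dots> = v" using v by (simp add: PiE_restrict)
    finally show ?thesis .
  qed
  then show ?thesis by (auto simp: R.lattice_def)
qed

section \<open>Coordinates on divisible p-groups of finite rank\<close>

text \<open>The element \<open>e n a\<close> stands for the image in \<open>(\<rat>\<^sub>p/\<int>\<^sub>p)\<^sup>r\<close> of the vector with entries
  \<open>a i / p\<^sup>n\<close>.\<close>

locale pruefer_coords = comm_group G for G (structure) +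
  fixes p r :: nat and e :: "nat \<Rightarrow> (nat \<Rightarrow> int) \<Rightarrow> 'a"
  assumes p: "Factorial_Ring.prime p"
    and closed [simp, intro]: "e n a \<in> carrier G"
    and add: "e n (\<lambda>i. a i + b i) = e n a \<otimes> e n b"
    and lift: "e (Suc n) (\<lambda>i. int p * a i) = e n a"
    and eq_one_iff: "e n a = \<one> \<longleftrightarrow> (\<forall>i<r. int p ^ n dvd a i)"
    and surj: "x \<in> carrier G \<Longrightarrow> \<exists>n a. x = e n a"
begin

lemma p_pos: "p > 0" using p prime_gt_0_nat by blast

lemma neg: "e n (\<lambda>i. - a i) = inv (e n a)"
proof -
  have "e n (\<lambda>i. - a i) \<otimes> e n a = \<one>"
    by (simp add: add[symmetric] eq_one_iff)
  then show ?thesis by (simp add: inv_equality)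
qed

lemma diff: "e n (\<lambda>i. a i - b i) = e n a \<otimes> inv (e n b)"
  using add[of n a "\<lambda>i. - b i"] by (simp add: neg)

lemma eq_iff: "e n a = e n b \<longleftrightarrow> (\<forall>i<r. [a i = b i] (mod int p ^ n))"
proof -
  have "e n a = e n b \<longleftrightarrow> e n a \<otimes> inv (e n b) = \<one>"
    by (metis closed inv_closed inv_equality inv_inv r_inv)
  then show ?thesis
    by (simp add: diff[symmetric] eq_one_iff cong_iff_dvd_diff)
qed

lemma lift_power: "e (n + k) (\<lambda>i. int p ^ k * a i) = e n a"
proof (induction k)
  case (Suc k)
  have "e (n + Suc k) (\<lambda>i. int p ^ Suc k * a i) = e (Suc (n + k)) (\<lambda>i. int p * (int p ^ k * a i))"
    by (simp add: mult.assoc)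
  then show ?case using Suc by (simp only: lift)
qed simp

text \<open>Both elements are lifted to the common level n + m. The criterion mentions
  \<open>p\<close> and \<open>r\<close> but not the group, which lets two coordinate systems be
  matched.\<close>

lemma eq_iff': "e n a = e m b \<longleftrightarrow> (\<forall>i<r. [int p ^ m * a i = int p ^ n * b i] (mod int p ^ (n + m)))"
  using lift_power[of n m a] lift_power[of m n b]
    eq_iff[of "n + m" "\<lambda>i. int p ^ m * a i" "\<lambda>i. int p ^ n * b i"]
  by (simp add: add.commute)

lemma power: "e n a [^] (k::nat) = e n (\<lambda>i. int k * a i)"
proof (induction k)
  case 0
  then show ?case using eq_one_iff[of n "\<lambda>_. 0"] by simp
next
  case (Suc k)
  then show ?case
    using add[of n "\<lambda>i. int k * a i" a] by (simp add: algebra_simps)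
qed

text \<open>If x = a / p^m is killed by p^n, then p^m divides p^n a, and the quotient is a numerator
  of x over p^n.\<close>

lemma killed:
  assumes "x \<in> carrier G" "x [^] (p ^ n) = \<one>"
  obtains a where "x = e n a"
proof -
  obtain m a where x: "x = e m a" using surj assms by blast
  then have "\<forall>i<r. int p ^ m dvd int p ^ n * a i"
    using assms(2) by (simp add: power eq_one_iff)
  moreover have "e m a = e (m + n) (\<lambda>i. int p ^ n * a i)"
    by (simp add: lift_power)
  ultimately have d: "\<forall>i<r. int p ^ m dvd int p ^ n * a i" and xe: "x = e (n + m) (\<lambda>i. int p ^ n * a i)"
    using x by (simp_all add: add.commute)
  let ?b = "\<lambda>i. int p ^ n * a i div int p ^ m"
  have "e n ?b = e (n + m) (\<lambda>i. int p ^ m * ?b i)"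
    by (simp add: lift_power)
  also have "\<dots> = x"
    unfolding xe eq_iff using d by simp
  finally show thesis using that by blast
qed

lemma mult_eq: "e n a \<otimes> e m b = e (n + m) (\<lambda>i. int p ^ m * a i + int p ^ n * b i)"
  by (metis add lift_power add.commute)

lemma hom_eq_mat:
  assumes f: "f \<in> hom G G" and "\<And>j. j < r \<Longrightarrow> f (e n (\<lambda>i. if i = j then 1 else 0)) = e n (\<lambda>i. c i j)"
  shows "f (e n b) = e n (\<lambda>i. \<Sum>j<r. c i j * b j)"
proof -
  interpret f: group_hom G G f
    using f by unfold_locales
  have "f (e n (\<lambda>i. if i < k then b i else 0)) = e n (\<lambda>i. \<Sum>j<k. c i j * b j)" if "k \<le> r" for k
    using that
  proof (induction k)
    case 0
    have "e n (\<lambda>_. 0) = \<one>" by (simp add: eq_one_iff)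
    then show ?case by simp
  next
    case (Suc k)
    define u where "u = (\<lambda>i. if i = k then 1 else 0 :: int)"
    have nat: "f (e n (\<lambda>i. int m * u i)) = e n (\<lambda>i. int m * c i k)" for m
      using assms(2)[of k] Suc.prems by (simp add: power[symmetric] f.hom_nat_pow u_def)
    have "f (e n (\<lambda>i. b k * u i)) = e n (\<lambda>i. b k * c i k)"
    \<comment> \<open>\<open>power\<close> speaks of natural exponents, so a negative coefficient is
      reached through the inverse.\<close>
    proof (cases "b k \<ge> 0")
      case True
      then show ?thesis using nat[of "nat (b k)"] by simp
    next
      case False
      then have "f (inv (e n (\<lambda>i. (- b k) * u i))) = inv (e n (\<lambda>i. (- b k) * c i k))"
        using nat[of "nat (- b k)"] by simp
      then show ?thesis by (simp add: neg[symmetric])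
    qed
    then have "f (e n (\<lambda>i. if i < k then b i else 0) \<otimes> e n (\<lambda>i. b k * u i))
        = e n (\<lambda>i. \<Sum>j<k. c i j * b j) \<otimes> e n (\<lambda>i. b k * c i k)"
      using Suc by simp
    moreover have "(\<lambda>i. (if i < k then b i else 0) + b k * u i) = (\<lambda>i. if i < Suc k then b i else 0)"
      by (auto simp: u_def less_Suc_eq)
    ultimately show ?case
      by (simp add: add[symmetric] mult.commute)
  qed
  from this[OF order.refl] have "f (e n (\<lambda>i. if i < r then b i else 0)) = e n (\<lambda>i. \<Sum>j<r. c i j * b j)" .
  moreover have "e n (\<lambda>i. if i < r then b i else 0) = e n b"
    by (simp add: eq_iff)
  ultimately show ?thesis by simp
qed

text \<open>The image of u_j / p^n, for a unit vector u_j, is killed by p^n and so has a numerator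
  at level n: this is column j modulo p^n. Since u_j / p^n is p times u_j / p^(n+1), consecutive
  levels are congruent and define p-adic integers.\<close>

lemma hom_matrix:
  assumes f: "f \<in> hom G G"
  obtains A where "A \<in> matrices (padic_integers p) r"
    "\<And>n b. f (e n b) = e n (\<lambda>i. \<Sum>j<r. A i j n * b j)"
proof -
  interpret f: group_hom G G f
    using f by unfold_locales
  define u where "u j = (\<lambda>i. if i = j then 1 else 0 :: int)" for j :: nat
  have "\<exists>c. f (e n (u j)) = e n c" for n j
  proof -
    have "f (e n (u j)) [^] (p ^ n) = f (e n (\<lambda>i. int (p ^ n) * u j i))"
      by (simp add: f.hom_nat_pow[symmetric] power)
    also have "e n (\<lambda>i. int (p ^ n) * u j i) = \<one>" by (simp add: eq_one_iff)
    finally have "f (e n (u j)) [^] (p ^ n) = \<one>" by simp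
    from killed[OF f.hom_closed[OF closed] this] show ?thesis by metis
  qed
  then obtain c where c: "f (e n (u j)) = e n (c n j)" for n j by metis
  define A where "A = (\<lambda>i\<in>{..<r}. \<lambda>j\<in>{..<r}. \<lambda>n. c n j i mod int p ^ n)"
  have compat: "[c (Suc n) j i = c n j i] (mod int p ^ n)" if "i < r" for n i j
  proof -
    have "e n (c n j) = f (e (Suc n) (\<lambda>i. int p * u j i))"
      by (simp add: lift c)
    also have "\<dots> = f (e (Suc n) (u j)) [^] p"
      by (simp add: f.hom_nat_pow[symmetric] power)
    also have "\<dots> = e n (c (Suc n) j)"
      by (simp add: c power lift)
    finally show ?thesis using that by (simp add: eq_iff cong_sym_eq)
  qed
  have "A \<in> matrices (padic_integers p) r"
    unfolding matrices_def A_def using compat by (auto intro!: padic_intI p_pos)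
  moreover have "f (e n b) = e n (\<lambda>i. \<Sum>j<r. A i j n * b j)" for n b
  proof (rule hom_eq_mat[OF f])
    fix j assume "j < r"
    then show "f (e n (\<lambda>i. if i = j then 1 else 0)) = e n (\<lambda>i. A i j n)"
      using c[of n j] by (simp add: u_def eq_iff A_def cong_def)
  qed
  ultimately show thesis using that by blast
qed

end

text \<open>By \<open>eq_iff'\<close> an equation between symbols holds in one group exactly if it
  holds in the other, so sending \<open>e n a\<close> to \<open>e' n a\<close> is well defined and
  injective.\<close>

lemma pruefer_coords_iso:
  assumes "pruefer_coords G p r e" "pruefer_coords G' p r e'"
  obtains \<phi> where "\<phi> \<in> iso G G'" "\<And>n a. \<phi> (e n a) = e' n a"
proof -
  interpret A: pruefer_coords G p r e by fact
  interpret B: pruefer_coords G' p r e' by fact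
  have same: "e n a = e m b \<longleftrightarrow> e' n a = e' m b" for n a m b
    by (simp add: A.eq_iff' B.eq_iff')
  define \<phi> where "\<phi> x = (SOME y. \<exists>n a. x = e n a \<and> y = e' n a)" for x
  have \<phi>: "\<phi> (e n a) = e' n a" for n a
  proof -
    have "\<exists>m b. e n a = e m b \<and> \<phi> (e n a) = e' m b"
      unfolding \<phi>_def by (rule someI_ex) blast
    then show ?thesis using same by metis
  qed
  have "\<phi> \<in> hom G G'"
  proof (rule homI)
    fix x y assume "x \<in> carrier G" "y \<in> carrier G"
    then obtain n a m b where "x = e n a" "y = e m b" using A.surj by metis
    then show "\<phi> (x \<otimes>\<^bsub>G\<^esub> y) = \<phi> x \<otimes>\<^bsub>G'\<^esub> \<phi> y" "\<phi> x \<in> carrier G'"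
      by (simp_all add: A.mult_eq B.mult_eq \<phi>)
  qed
  moreover have "inj_on \<phi> (carrier G)"
    by (rule inj_onI) (metis A.surj \<phi> same)
  moreover have "\<phi> ` carrier G = carrier G'"
  proof
    show "\<phi> ` carrier G \<subseteq> carrier G'" using \<phi> A.surj B.closed by (metis image_subsetI)
    show "carrier G' \<subseteq> \<phi> ` carrier G"
      using \<phi> B.surj A.closed by (metis image_eqI subsetI)
  qed
  ultimately show thesis using that \<phi> by (simp add: iso_def bij_betw_def)
qed

subsection \<open>Existence of coordinates\<close>

context comm_group
begin

definition lincomb :: "('i \<Rightarrow> 'a) \<Rightarrow> 'i set \<Rightarrow> ('i \<Rightarrow> int) \<Rightarrow> 'a" where
  "lincomb g I a = (\<Otimes>i\<in>I. g i [^] a i)"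

lemma lincomb_closed: "g \<in> I \<rightarrow> carrier G \<Longrightarrow> lincomb g I a \<in> carrier G"
  unfolding lincomb_def by (intro finprod_closed) auto

lemma lincomb_cong:
  "g \<in> I \<rightarrow> carrier G \<Longrightarrow> (\<And>i. i \<in> I \<Longrightarrow> g i [^] a i = h i [^] b i) \<Longrightarrow> lincomb g I a = lincomb h I b"
  unfolding lincomb_def by (rule sym, rule finprod_cong') auto

lemma lincomb_add:
  assumes "g \<in> I \<rightarrow> carrier G"
  shows "lincomb g I (\<lambda>i. a i + b i) = lincomb g I a \<otimes> lincomb g I b"
proof -
  have "lincomb g I (\<lambda>i. a i + b i) = (\<Otimes>i\<in>I. g i [^] a i \<otimes> g i [^] b i)"
    unfolding lincomb_def using assms by (intro finprod_cong') (auto simp: int_pow_mult Pi_iff)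
  also have "\<dots> = lincomb g I a \<otimes> lincomb g I b"
    unfolding lincomb_def using assms by (intro finprod_multf) auto
  finally show ?thesis .
qed

lemma lincomb_remove:
  assumes "finite I" "g \<in> I \<rightarrow> carrier G" "j \<in> I"
  shows "lincomb g I a = g j [^] a j \<otimes> lincomb g (I - {j}) a"
proof -
  have "lincomb g (insert j (I - {j})) a = g j [^] a j \<otimes> lincomb g (I - {j}) a"
    unfolding lincomb_def using assms by (intro finprod_insert) auto
  then show ?thesis using assms by (simp add: insert_absorb)
qed

lemma lincomb_scale:
  assumes "finite I" "g \<in> I \<rightarrow> carrier G"
  shows "lincomb g I (\<lambda>i. c * a i) = lincomb g I a [^] c"
  using assms
proof (induction I)
  case empty
  then show ?case by (simp add: lincomb_def)
next
  case (insert i I)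
  then have g: "g \<in> I \<rightarrow> carrier G" "g i \<in> carrier G" by auto
  have "lincomb g (insert i I) b = g i [^] b i \<otimes> lincomb g I b" for b
    using lincomb_remove[of "insert i I" g i b] insert by simp
  with insert g show ?case
    by (simp add: int_pow_distrib lincomb_closed int_pow_pow mult.commute)
qed

text \<open>The solutions of x^p = 1 form a vector space over the field with p elements, and a
  spanning set of least size is a basis. Coefficients are integers, so independence is expressed by
  divisibility by p.\<close>

lemma exists_basis_of_p_torsion:
  assumes p: "Factorial_Ring.prime p" and fin: "finite {x \<in> carrier G. x [^] p = \<one>}"
  obtains r and x :: "nat \<Rightarrow> 'a"
  where "\<And>i. i < r \<Longrightarrow> x i \<in> carrier G" "\<And>i. i < r \<Longrightarrow> x i [^] p = \<one>"
    "\<And>y. y \<in> carrier G \<Longrightarrow> y [^] p = \<one> \<Longrightarrow> \<exists>a. y = lincomb x {..<r} a"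
    "\<And>a i. lincomb x {..<r} a = \<one> \<Longrightarrow> i < r \<Longrightarrow> int p dvd a i"
proof -
  let ?K = "{x \<in> carrier G. x [^] p = \<one>}"
  define spans where "spans S \<longleftrightarrow> (\<forall>y\<in>?K. \<exists>a. y = lincomb id S a)" for S
  have "spans ?K"
    unfolding spans_def
  proof
    fix y assume y: "y \<in> ?K"
    have "lincomb id ?K (\<lambda>s. if s = y then 1 else 0)
        = id y [^] (1::int) \<otimes> lincomb id (?K - {y}) (\<lambda>s. if s = y then 1 else 0)"
      using y fin by (subst lincomb_remove[of _ _ y]) auto
    \<comment> \<open>Writing zero as \<open>0 * 0\<close> presents it as a scalar multiple, so that
      \<open>lincomb_scale\<close> turns the combination into a zeroth power.\<close>
    also have "lincomb id (?K - {y}) (\<lambda>s. if s = y then 1 else 0) = lincomb id (?K - {y}) (\<lambda>s. 0 * 0)"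
      by (intro lincomb_cong) auto
    also have "\<dots> = \<one>"
      using fin by (subst lincomb_scale) auto
    finally show "\<exists>a. y = lincomb id ?K a"
      using y by (intro exI[of _ "\<lambda>s. if s = y then 1 else 0"]) (simp add: id_def)
  qed
  then obtain S where S: "S \<subseteq> ?K" "spans S" and min: "\<And>T. T \<subseteq> ?K \<Longrightarrow> spans T \<Longrightarrow> card S \<le> card T"
    using arg_min_nat_lemma[of "\<lambda>S. S \<subseteq> ?K \<and> spans S" ?K card]
    by (metis (no_types, lifting) order.refl)
  have finS: "finite S" using S fin finite_subset by blast
  have idS: "id \<in> T \<rightarrow> carrier G" if "T \<subseteq> S" for T using S that by auto
  have indep: "int p dvd a j" if a: "lincomb id S a = \<one>" and j: "j \<in> S" for a j
  proof (rule ccontr)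
    assume "\<not> int p dvd a j"
    then have "coprime (int p) (a j)"
      using p by (simp add: prime_imp_coprime)
    \<comment> \<open>\<open>c\<close> inverts \<open>a j\<close> modulo p. Raising the relation to
      the power \<open>c\<close> gives \<open>j\<close> the coefficient 1, so \<open>j\<close> is a
      combination of the others and a smaller set spans.\<close>
    then obtain c where c: "[a j * c = 1] (mod int p)"
      by (metis cong_solve_coprime_int coprime_commute)
    have jc: "j \<in> carrier G" "j [^] p = \<one>" using j S by auto
    have "int p dvd a j * c - 1" using c by (simp add: cong_iff_dvd_diff)
    then obtain d where "a j * c - 1 = int p * d" by (elim dvdE)
    then have "a j * c = 1 + int p * d" by simp
    then have "j [^] (a j * c) = j [^] (1::int) \<otimes> j [^] (int p * d)"
      using jc by (simp add: int_pow_mult)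
    also have "j [^] (int p * d) = (j [^] int p) [^] d"
      using jc by (simp add: int_pow_pow)
    finally have jac: "j [^] (a j * c) = j"
      using jc by (simp add: int_pow_int)
    let ?Q = "\<lambda>a. lincomb id (S - {j}) a"
    have Qc: "?Q a \<in> carrier G" for a by (intro lincomb_closed idS) auto
    have "j [^] a j \<otimes> ?Q a = \<one>"
      using lincomb_remove[OF finS idS[OF order.refl] j, of a] a by simp
    then have "(j [^] a j \<otimes> ?Q a) [^] c = \<one>" by simp
    then have jQ: "j \<otimes> ?Q (\<lambda>s. c * a s) = \<one>"
      using jc Qc finS jac by (simp add: int_pow_distrib int_pow_pow lincomb_scale idS)
    have "spans (S - {j})"
      unfolding spans_def
    proof
      fix y assume "y \<in> ?K"
      then obtain b where y: "y = lincomb id S b" using S(2) by (auto simp: spans_def)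
      have "y = j [^] b j \<otimes> ?Q b"
        unfolding y using lincomb_remove[OF finS idS[OF order.refl] j, of b] by simp
      also have "j [^] b j = ?Q (\<lambda>s. - b j * (c * a s))"
      proof -
        have "j = inv (?Q (\<lambda>s. c * a s))"
          using jQ jc Qc by (metis inv_equality)
        then have "j [^] b j = inv (?Q (\<lambda>s. c * a s)) [^] b j" by (rule arg_cong)
        then show ?thesis
          using Qc finS lincomb_scale[of "S - {j}" id "- b j" "\<lambda>s. c * a s"] idS[of "S - {j}"]
          by (simp add: int_pow_inv int_pow_neg Diff_subset)
      qed
      also have "\<dots> \<otimes> ?Q b = ?Q (\<lambda>s. - b j * (c * a s) + b s)"
        by (intro lincomb_add[symmetric] idS) auto
      finally show "\<exists>b. y = ?Q b" by blast
    qed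
    from min[OF _ this] S finS j show False
      by (metis Diff_subset card_Diff1_less leD subset_trans)
  qed
  obtain x where x: "bij_betw x {..<card S} S"
    using finS ex_bij_betw_nat_finite by (metis atLeast0LessThan)
  have reindex: "lincomb x {..<card S} (\<lambda>i. a (x i)) = lincomb id S a" for a
  proof -
    have "lincomb id (x ` {..<card S}) a = lincomb x {..<card S} (\<lambda>i. a (x i))"
      unfolding lincomb_def using x S by (subst finprod_reindex) (auto simp: bij_betw_def)
    then show ?thesis using x by (simp add: bij_betw_def)
  qed
  show thesis
  proof (rule that)
    show "x i \<in> carrier G" "x i [^] p = \<one>" if "i < card S" for i
      using x S that by (auto simp: bij_betw_def)
    show "\<exists>a. y = lincomb x {..<card S} a" if "y \<in> carrier G" "y [^] p = \<one>" for y
      using S(2) that reindex unfolding spans_def by (metis (mono_tags, lifting) mem_Collect_eq)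
    show "int p dvd a i" if a: "lincomb x {..<card S} a = \<one>" and i: "i < card S" for a i
    proof -
      let ?b = "\<lambda>s. a (inv_into {..<card S} x s)"
      have xinv: "inv_into {..<card S} x (x i) = i" if "i < card S" for i
        using x that by (auto simp: bij_betw_def)
      have "lincomb id S ?b = lincomb x {..<card S} (\<lambda>i. ?b (x i))"
        by (rule reindex[symmetric])
      also have "\<dots> = lincomb x {..<card S} a"
        using x S xinv by (intro lincomb_cong) (auto simp: bij_betw_def)
      finally have "lincomb id S ?b = \<one>" using a by simp
      moreover have "x i \<in> S" using x i by (auto simp: bij_betw_def)
      ultimately show ?thesis using indep[of ?b "x i"] xinv[OF i] by simp
    qed
  qed
qed

text \<open>Repeated p-th roots extend a basis of the p-torsion upwards: each basis vector becomes
  the bottom of a tower that generates a copy of the Pruefer group.\<close>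

lemma exists_pruefer_coords:
  assumes p: "Factorial_Ring.prime p"
    and tors: "\<And>x. x \<in> carrier G \<Longrightarrow> \<exists>k::nat. x [^] (p ^ k) = \<one>"
    and div: "\<And>x. x \<in> carrier G \<Longrightarrow> \<exists>y\<in>carrier G. y [^] p = x"
    and fin: "finite {x \<in> carrier G. x [^] p = \<one>}"
  shows "\<exists>r e. pruefer_coords G p r e"
proof -
  obtain r and x :: "nat \<Rightarrow> 'a"
    where x: "\<And>i. i < r \<Longrightarrow> x i \<in> carrier G" "\<And>i. i < r \<Longrightarrow> x i [^] p = \<one>"
    and span: "\<And>y. y \<in> carrier G \<Longrightarrow> y [^] p = \<one> \<Longrightarrow> \<exists>a. y = lincomb x {..<r} a"
    and indep: "\<And>a i. lincomb x {..<r} a = \<one> \<Longrightarrow> i < r \<Longrightarrow> int p dvd a i"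
    by (rule exists_basis_of_p_torsion[OF p fin]) blast
  obtain root where root: "\<And>x. x \<in> carrier G \<Longrightarrow> root x \<in> carrier G"
    "\<And>x. x \<in> carrier G \<Longrightarrow> root x [^] p = x"
    using div by metis
  \<comment> \<open>The index is chosen so that p^n kills level n: level 0 is \<open>\<one>\<close>,
    level 1 is \<open>x i\<close>, and each level is the p-th power of the next.\<close>
  define c where "c n i = (if n = 0 then \<one> else (root ^^ (n - 1)) (x i))" for n i
  have rootn: "(root ^^ n) y \<in> carrier G" if "y \<in> carrier G" for n y
    using that root by (induction n) auto
  have c: "c n i \<in> carrier G" if "i < r" for n i
    using that x rootn by (simp add: c_def)
  have cp: "c (Suc n) i [^] p = c n i" if "i < r" for n i
    using that x root rootn by (cases n) (auto simp: c_def)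
  define e where "e n = lincomb (c n) {..<r}" for n
  have cc: "c n \<in> {..<r} \<rightarrow> carrier G" for n using c by auto
  have e: "e n a \<in> carrier G" for n a
    unfolding e_def by (intro lincomb_closed cc)
  have add: "e n (\<lambda>i. a i + b i) = e n a \<otimes> e n b" for n a b
    unfolding e_def by (intro lincomb_add cc)
  have lift: "e (Suc n) (\<lambda>i. int p * a i) = e n a" for n a
    unfolding e_def
  proof (intro lincomb_cong cc)
    fix i assume "i \<in> {..<r}"
    then show "c (Suc n) i [^] (int p * a i) = c n i [^] a i"
      using c cp by (simp add: int_pow_pow[symmetric] int_pow_int)
  qed
  have pow: "e n (\<lambda>i. m * a i) = e n a [^] m" for n m a
    unfolding e_def using cc by (intro lincomb_scale) auto
  have lifts: "e (n + k) (\<lambda>i. int p ^ k * a i) = e n a" for n k a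
  proof (induction k)
    case (Suc k)
    have "e (n + Suc k) (\<lambda>i. int p ^ Suc k * a i) = e (Suc (n + k)) (\<lambda>i. int p * (int p ^ k * a i))"
      by (simp add: mult.assoc)
    then show ?case using Suc by (simp only: lift)
  qed simp
  have e0: "e 0 a = \<one>" for a
    unfolding e_def lincomb_def by (rule finprod_one_eqI) (simp add: c_def)
  have e1: "e 1 a = lincomb x {..<r} a" for a
    unfolding e_def by (intro lincomb_cong) (auto simp: c_def x)
  have cong: "e n a = e n b" if "\<And>i. i < r \<Longrightarrow> a i = b i" for n a b
    unfolding e_def by (intro lincomb_cong cc) (auto simp: that)
  \<comment> \<open>Multiplying by p^n moves the relation down to level 1, where independence makes
    every \<open>a i\<close> divisible by p; cancelling this p lowers the level by one.\<close>
  have zero: "\<forall>i<r. int p ^ n dvd a i" if "e n a = \<one>" for n a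
    using that
  proof (induction n arbitrary: a)
    case (Suc n)
    have "e 1 a = e (1 + n) (\<lambda>i. int p ^ n * a i)"
      by (simp only: lifts)
    also have "\<dots> = \<one>" using Suc.prems by (simp only: pow) simp
    finally have "\<forall>i<r. int p dvd a i" using indep e1 by metis
    then have a: "a i = int p * (a i div int p)" if "i < r" for i using that by simp
    have "e (Suc n) a = e (Suc n) (\<lambda>i. int p * (a i div int p))"
      by (rule cong) (rule a)
    then have "e n (\<lambda>i. a i div int p) = \<one>" using Suc.prems by (simp only: lift)
    then have *: "\<forall>i<r. int p ^ n dvd a i div int p" by (rule Suc.IH)
    have "int p ^ Suc n dvd int p * (a i div int p)" if "i < r" for i
      using * that by simp
    then show ?case using a by metis
  qed simp
  \<comment> \<open>The p^n-th power of \<open>y\<close> lies in the p-torsion, hence is some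
    \<open>e 1 a\<close>. Dividing \<open>y\<close> by \<open>e (Suc n) a\<close> leaves an element
    killed by p^n, to which the induction applies.\<close>
  have surj: "\<exists>a. y = e n a" if "y \<in> carrier G" "y [^] (p ^ n) = \<one>" for y n
    using that
  proof (induction n arbitrary: y)
    case 0
    then show ?case using e0 by auto
  next
    case (Suc n)
    have "(y [^] (p ^ n)) [^] p = \<one>"
      using Suc.prems by (simp add: nat_pow_pow mult.commute)
    then obtain a where a: "y [^] (p ^ n) = e 1 a"
      using span[of "y [^] (p ^ n)"] Suc.prems e1 by auto
    have "e (Suc n) (\<lambda>i. - a i) [^] (p ^ n) = e (1 + n) (\<lambda>i. int p ^ n * (- a i))"
      by (simp only: pow) (simp add: int_pow_int[symmetric])
    also have "\<dots> = e 1 (\<lambda>i. - a i)" by (simp only: lifts)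
    finally have "(y \<otimes> e (Suc n) (\<lambda>i. - a i)) [^] (p ^ n) = e 1 a \<otimes> e 1 (\<lambda>i. - a i)"
      using Suc.prems e a by (simp add: nat_pow_distrib)
    also have "\<dots> = e 1 (\<lambda>i. 0 * 0)" by (simp add: add[symmetric])
    also have "\<dots> = \<one>" by (simp only: pow) simp
    finally obtain b where b: "y \<otimes> e (Suc n) (\<lambda>i. - a i) = e n b"
      using Suc.IH[of "y \<otimes> e (Suc n) (\<lambda>i. - a i)"] Suc.prems e by auto
    have "e (Suc n) (\<lambda>i. - a i) \<otimes> e (Suc n) a = e (Suc n) (\<lambda>i. 0 * 0)"
      by (simp add: add[symmetric])
    also have "\<dots> = \<one>" by (simp only: pow) simp
    finally have "y = (y \<otimes> e (Suc n) (\<lambda>i. - a i)) \<otimes> e (Suc n) a"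
      using Suc.prems e by (simp add: m_assoc)
    also have "\<dots> = e (Suc n) (\<lambda>i. int p * b i + a i)"
      by (simp only: b add lift)
    finally show ?case by blast
  qed
  have "pruefer_coords G p r e"
  proof unfold_locales
    show "e n a = \<one> \<longleftrightarrow> (\<forall>i<r. int p ^ n dvd a i)" for n a
    proof
      assume "\<forall>i<r. int p ^ n dvd a i"
      then have "e n a = e n (\<lambda>i. int p ^ n * (a i div int p ^ n))"
        by (intro cong) simp
      also have "\<dots> = \<one>" using lifts[of 0 n] e0 by simp
      finally show "e n a = \<one>" .
    qed (rule zero)
    show "\<exists>n a. y = e n a" if "y \<in> carrier G" for y using tors surj that by blast
  qed (use p e add lift in simp_all)
  then show ?thesis by blast
qed

end

subsection \<open>Coordinates on sums of Pruefer groups\<close>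

definition root_of_unity :: "nat \<Rightarrow> int \<Rightarrow> complex" where
  "root_of_unity m k = cis (2 * pi * (real_of_int k / real m))"

lemma root_of_unity_add: "root_of_unity m (k + l) = root_of_unity m k * root_of_unity m l"
  by (simp add: root_of_unity_def cis_mult add_divide_distrib distrib_left)

lemma root_of_unity_0 [simp]: "root_of_unity m 0 = 1"
  by (simp add: root_of_unity_def)

lemma root_of_unity_powi: "root_of_unity m k powi l = root_of_unity m (l * k)"
  by (simp add: root_of_unity_def cis_power_int algebra_simps)

lemma root_of_unity_eq_one_iff:
  assumes "m > 0"
  shows "root_of_unity m k = 1 \<longleftrightarrow> int m dvd k"
proof
  assume "root_of_unity m k = 1"
  then have "cos (2 * pi * (real_of_int k / real m)) = 1"
    by (simp add: root_of_unity_def complex_eq_iff)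
  then obtain l :: int where "2 * pi * (real_of_int k / real m) = l * (2 * pi)"
    by (auto simp: cos_one_2pi_int mult.assoc)
  then have "real_of_int k = real_of_int (l * int m)"
    using assms by (simp add: field_simps)
  then have "k = l * int m" by (simp only: of_int_eq_iff)
  then show "int m dvd k" by simp
next
  assume "int m dvd k"
  then obtain l where "k = int m * l" by (elim dvdE)
  then have "real_of_int k / real m = real_of_int l" using assms by simp
  then show "root_of_unity m k = 1"
    unfolding root_of_unity_def by (simp only: cis_multiple_2pi Ints_of_int)
qed

lemma root_of_unity_surj:
  assumes "m > 0" "z ^ m = 1"
  obtains k where "z = root_of_unity m k"
proof -
  have "z \<in> (\<lambda>k. cis (2 * pi * real k / real m)) ` {..<m}"
    using bij_betw_roots_unity[OF assms(1)] assms(2) by (auto simp: bij_betw_def)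
  then obtain k where "z = root_of_unity m (int k)"
    by (auto simp: root_of_unity_def)
  then show thesis using that by blast
qed

lemma root_of_unity_scale: "l > 0 \<Longrightarrow> root_of_unity (l * m) (int l * k) = root_of_unity m k"
  by (simp add: root_of_unity_def)

lemma comm_group_pruefer:
  assumes "p > 0"
  shows "comm_group (pruefer p)"
proof (rule comm_groupI)
  show "x \<otimes>\<^bsub>pruefer p\<^esub> y \<in> carrier (pruefer p)"
    if "x \<in> carrier (pruefer p)" "y \<in> carrier (pruefer p)" for x y
  proof -
    obtain m n where "x ^ (p ^ m) = 1" "y ^ (p ^ n) = 1"
      using \<open>x \<in> _\<close> \<open>y \<in> _\<close> by (auto simp: pruefer_def)
    then have "x ^ (p ^ m * p ^ n) = 1" "y ^ (p ^ n * p ^ m) = 1"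
      by (simp_all only: power_mult power_one)
    then have "(x * y) ^ (p ^ (m + n)) = 1"
      by (simp only: power_add power_mult_distrib mult.commute[of "p ^ n"]) simp
    then show ?thesis by (auto simp: pruefer_def)
  qed
  show "\<exists>y\<in>carrier (pruefer p). y \<otimes>\<^bsub>pruefer p\<^esub> x = \<one>\<^bsub>pruefer p\<^esub>"
    if "x \<in> carrier (pruefer p)" for x
  proof -
    obtain n where n: "x ^ (p ^ n) = 1" using \<open>x \<in> _\<close> by (auto simp: pruefer_def)
    have "x \<noteq> 0" using n assms by (auto simp: zero_power)
    then show ?thesis
      using n by (intro bexI[of _ "inverse x"]) (auto simp: pruefer_def power_inverse)
  qed
qed (auto simp: pruefer_def mult_ac intro: exI[of _ 0])

text \<open>Sends a / p^n to the tuple of the exp(2 pi i a_k / p^n), the usual identification of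
  Q_p/Z_p with the roots of unity of p-power order.\<close>

definition pruefer_vec :: "nat \<Rightarrow> nat \<Rightarrow> nat \<Rightarrow> (nat \<Rightarrow> int) \<Rightarrow> nat \<Rightarrow> complex" where
  "pruefer_vec p r n a = (\<lambda>i\<in>{..<r}. root_of_unity (p ^ n) (a i))"

lemma carrier_pruefer_sum:
  "p > 0 \<Longrightarrow> carrier (pruefer_sum p r) = {..<r} \<rightarrow>\<^sub>E carrier (pruefer p)"
  using comm_group_pruefer by (subst carrier_sum_group) (auto simp: comm_group_def)

lemma pruefer_coords_pruefer_sum:
  assumes p: "Factorial_Ring.prime p"
  shows "pruefer_coords (pruefer_sum p r) p r (pruefer_vec p r)"
proof -
  have p0: "p > 0" using p prime_gt_0_nat by blast
  interpret P: comm_group "pruefer p" by (rule comm_group_pruefer[OF p0])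
  have "group (pruefer_sum p r)" by (rule sum_group) (rule P.is_group)
  then have S: "comm_group (pruefer_sum p r)"
  proof (rule group.group_comm_groupI)
    fix x y assume "x \<in> carrier (pruefer_sum p r)" "y \<in> carrier (pruefer_sum p r)"
    then have "x i \<in> carrier (pruefer p)" "y i \<in> carrier (pruefer p)" if "i < r" for i
      using that unfolding carrier_pruefer_sum[OF p0] by auto
    then show "x \<otimes>\<^bsub>pruefer_sum p r\<^esub> y = y \<otimes>\<^bsub>pruefer_sum p r\<^esub> x"
      unfolding mult_sum_group by (intro restrict_ext P.m_comm) auto
  qed
  have root: "root_of_unity (p ^ n) k \<in> carrier (pruefer p)" for n k
  proof -
    have "root_of_unity (p ^ n) k ^ (p ^ n) = root_of_unity (p ^ n) k powi int (p ^ n)"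
      by (simp only: power_int_of_nat)
    also have "\<dots> = 1"
      using p0 by (simp only: root_of_unity_powi) (simp add: root_of_unity_eq_one_iff)
    finally show ?thesis by (auto simp: pruefer_def)
  qed
  show ?thesis
  proof (intro pruefer_coords.intro S, unfold_locales)
    show "Factorial_Ring.prime p" by fact
    show "pruefer_vec p r n a \<in> carrier (pruefer_sum p r)" for n a
      using root by (auto simp: carrier_pruefer_sum[OF p0] pruefer_vec_def)
    show "pruefer_vec p r n (\<lambda>i. a i + b i)
        = pruefer_vec p r n a \<otimes>\<^bsub>pruefer_sum p r\<^esub> pruefer_vec p r n b" for n a b
      by (auto simp: pruefer_vec_def root_of_unity_add pruefer_def fun_eq_iff)
    show "pruefer_vec p r (Suc n) (\<lambda>i. int p * a i) = pruefer_vec p r n a" for n a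
      using p0 by (simp add: pruefer_vec_def root_of_unity_scale)
    show "pruefer_vec p r n a = \<one>\<^bsub>pruefer_sum p r\<^esub> \<longleftrightarrow> (\<forall>i<r. int p ^ n dvd a i)" for n a
    proof -
      have "pruefer_vec p r n a = \<one>\<^bsub>pruefer_sum p r\<^esub> \<longleftrightarrow> (\<forall>i<r. root_of_unity (p ^ n) (a i) = 1)"
        by (auto simp: pruefer_vec_def pruefer_def fun_eq_iff)
      then show ?thesis using p0 by (simp add: root_of_unity_eq_one_iff)
    qed
    show "\<exists>n a. x = pruefer_vec p r n a" if x: "x \<in> carrier (pruefer_sum p r)" for x
    proof -
      have "x i \<in> carrier (pruefer p)" if "i < r" for i
        using x that unfolding carrier_pruefer_sum[OF p0] by auto
      then have "\<forall>i. \<exists>n. i < r \<longrightarrow> x i ^ (p ^ n) = 1"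
        by (auto simp: pruefer_def)
      then obtain n where n: "\<And>i. i < r \<Longrightarrow> x i ^ (p ^ n i) = 1" by metis
      \<comment> \<open>The sum bounds every \<open>n i\<close> and so gives one level for all
        coordinates.\<close>
      define N where "N = (\<Sum>i<r. n i)"
      have "x i ^ (p ^ N) = 1" if "i < r" for i
      proof -
        have "n i \<le> N" unfolding N_def using that by (intro member_le_sum) auto
        then have "p ^ N = p ^ n i * p ^ (N - n i)" by (simp add: power_add[symmetric])
        then show ?thesis using n[OF that] by (simp add: power_mult)
      qed
      then have "\<forall>i. \<exists>k. i < r \<longrightarrow> x i = root_of_unity (p ^ N) k"
        using p0 by (metis root_of_unity_surj zero_less_power)
      then obtain a where "\<And>i. i < r \<Longrightarrow> x i = root_of_unity (p ^ N) (a i)" by metis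
      then have "restrict x {..<r} = pruefer_vec p r N a"
        unfolding pruefer_vec_def by (intro restrict_ext) auto
      moreover have "restrict x {..<r} = x" using x unfolding carrier_pruefer_sum[OF p0] by (rule PiE_restrict)
      ultimately show ?thesis by metis
    qed
  qed
qed

text \<open>\<open>pruefer_power\<close> reads \<open>x\<close> at the least level m with z^(p^m) =
  1, which is at most n. As \<open>x n\<close> and \<open>x m\<close> agree modulo p^m, the two
  powers of z coincide.\<close>

lemma pruefer_power_root_of_unity:
  assumes p: "p > 0" and x: "x \<in> carrier (padic_integers p)"
  shows "pruefer_power p x (root_of_unity (p ^ n) k) = root_of_unity (p ^ n) (x n * k)"
proof -
  let ?z = "root_of_unity (p ^ n) k"
  define m where "m = (LEAST n. ?z ^ (p ^ n) = 1)"
  have zn: "?z ^ (p ^ n) = 1"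
  proof -
    have "?z ^ (p ^ n) = ?z powi int (p ^ n)" by (simp only: power_int_of_nat)
    then show ?thesis
      using p by (simp only: root_of_unity_powi) (simp add: root_of_unity_eq_one_iff)
  qed
  then have zm: "?z ^ (p ^ m) = 1" and "m \<le> n"
    unfolding m_def by (rule LeastI, rule Least_le)
  have "x n mod int p ^ m = x m" by (rule padic_mod) fact+
  then have "int p ^ m dvd x n - x m" by (metis mod_mod_trivial mod_eq_dvd_iff)
  then obtain d where d: "x n - x m = int p ^ m * d" by (elim dvdE)
  have z0: "?z \<noteq> 0" using zm p by (auto simp: zero_power)
  have "x n = x m + int p ^ m * d" using d by simp
  then have "?z powi x n = ?z powi x m * (?z powi int (p ^ m)) powi d"
    using z0 by (simp add: power_int_add power_int_mult)
  also have "?z powi int (p ^ m) = 1" using zm by (simp only: power_int_of_nat)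
  finally have "?z powi x m = ?z powi x n" by simp
  then show ?thesis
    unfolding pruefer_power_def m_def[symmetric] by (simp add: root_of_unity_powi)
qed

lemma root_of_unity_sum: "root_of_unity m (\<Sum>i\<in>I. f i) = (\<Prod>i\<in>I. root_of_unity m (f i))"
  by (induction I rule: infinite_finite_induct) (simp_all add: root_of_unity_add)

lemma pruefer_mat_act_vec:
  assumes p: "p > 0" and A: "A \<in> matrices (padic_integers p) r"
  shows "pruefer_mat_act p r A (pruefer_vec p r n b) = pruefer_vec p r n (\<lambda>i. \<Sum>j<r. A i j n * b j)"
  unfolding pruefer_mat_act_def pruefer_vec_def
proof (rule restrict_ext)
  fix i assume "i \<in> {..<r}"
  then have "A i j \<in> carrier (padic_integers p)" if "j < r" for j
    using A that by (auto simp: matrices_def)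
  then show "(\<Prod>j<r. pruefer_power p (A i j) ((\<lambda>i\<in>{..<r}. root_of_unity (p ^ n) (b i)) j))
      = root_of_unity (p ^ n) (\<Sum>j<r. A i j n * b j)"
    by (simp add: root_of_unity_sum pruefer_power_root_of_unity[OF p])
qed

section \<open>Irreducibility\<close>

text \<open>On a finite \<open>D\<close> the surjective map y \<mapsto> y^p would be injective, and
  so would its iterates; but the k-th iterate sends both \<open>x\<close> and \<open>\<one>\<close>
  to \<open>\<one>\<close>.\<close>

lemma (in group) infinite_if_p_divisible:
  assumes D: "subgroup D G" and x: "x \<in> D" "x \<noteq> \<one>" "x [^] (p ^ k :: nat) = \<one>"
    and div: "\<And>y. y \<in> D \<Longrightarrow> \<exists>z\<in>D. z [^] (p :: nat) = y"
  shows "infinite D"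
proof
  assume fin: "finite D"
  have Dc: "y \<in> carrier G" if "y \<in> D" for y using subgroup.mem_carrier[OF D that] .
  have pow: "y [^] (n :: nat) \<in> D" if "y \<in> D" for y n
    using that by (induction n) (auto intro: subgroup.m_closed[OF D] subgroup.one_closed[OF D])
  have "(\<lambda>y. y [^] p) ` D = D"
    using pow div by (auto simp: image_iff) metis
  then have inj: "inj_on (\<lambda>y. y [^] p) D"
    using fin by (intro eq_card_imp_inj_on) auto
  have "inj_on (\<lambda>y. y [^] (p ^ k)) D"
  proof (induction k)
    case 0
    then show ?case using Dc by (auto simp: inj_on_def)
  next
    case (Suc k)
    have "inj_on ((\<lambda>y. y [^] p) \<circ> (\<lambda>y. y [^] (p ^ k))) D"
      by (rule comp_inj_on[OF Suc inj_on_subset[OF inj]]) (auto intro: pow)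
    moreover have "((\<lambda>y. y [^] p) \<circ> (\<lambda>y. y [^] (p ^ k))) y = y [^] (p ^ Suc k)" if "y \<in> D" for y
      using Dc[OF that] by (simp add: nat_pow_pow mult.commute)
    ultimately show ?case by (simp cong: inj_on_cong)
  qed
  from inj_onD[OF this, of x \<one>] have "x = \<one>"
    using x subgroup.one_closed[OF D] by simp
  with x show False by simp
qed

lemma (in pruefer_coords) acts_padic_irreducibly:
  assumes inf: "infinite (carrier G)"
    and act: "\<And>h. h \<in> carrier K \<Longrightarrow> act h \<in> hom G G"
    and irred: "\<And>D. subgroup D G \<Longrightarrow> infinite D \<Longrightarrow>
      (\<And>h x. h \<in> carrier K \<Longrightarrow> x \<in> D \<Longrightarrow> act h x \<in> D) \<Longrightarrow> D = carrier G"
  shows "acts_padic_irreducibly p K G act"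
proof -
  let ?R = "padic_integers p"
  interpret R: domain ?R by (rule domain_padic_integers[OF p])
  have p1: "p > 1" using p prime_gt_1_nat by blast
  obtain \<phi> where \<phi>: "\<phi> \<in> iso G (pruefer_sum p r)" "\<And>n a. \<phi> (e n a) = pruefer_vec p r n a"
    using pruefer_coords_iso[OF pruefer_coords_axioms pruefer_coords_pruefer_sum[OF p]] by blast
  have r: "r \<ge> 1"
  proof (rule ccontr)
    assume "\<not> r \<ge> 1"
    then have "carrier G \<subseteq> {\<one>}" using surj eq_one_iff by fastforce
    then show False using inf finite_subset by blast
  qed
  have mat: "\<exists>A\<in>padic_matrices p r K G act \<phi>. \<forall>n b. act h (e n b) = e n (\<lambda>i. \<Sum>j<r. A i j n * b j)"
    if h: "h \<in> carrier K" for h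
  proof -
    obtain A where A: "A \<in> matrices ?R r" "\<And>n b. act h (e n b) = e n (\<lambda>i. \<Sum>j<r. A i j n * b j)"
      by (rule hom_matrix[OF act[OF h]], rule that)
    have "\<phi> (act h m) = pruefer_mat_act p r A (\<phi> m)" if m: "m \<in> carrier G" for m
    proof -
      obtain n b where "m = e n b" using surj[OF m] by metis
      then show ?thesis by (simp add: A(2) \<phi>(2) pruefer_mat_act_vec[OF p_pos A(1)])
    qed
    then have "A \<in> padic_matrices p r K G act \<phi>" using A(1) h by (auto simp: padic_matrices_def)
    then show ?thesis using A(2) by blast
  qed
  have "W = {\<zero>\<^bsub>vec_space (padic_numbers p) r\<^esub>} \<or> W = carrier (vec_space (padic_numbers p) r)"
    if W: "submodule W (padic_numbers p) (vec_space (padic_numbers p) r)"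
    and inv: "\<And>A v. A \<in> padic_matrices p r K G act \<phi> \<Longrightarrow> v \<in> W \<Longrightarrow>
      mat_vec (padic_numbers p) r (\<lambda>i\<in>{..<r}. \<lambda>j\<in>{..<r}. padic_embed p (A i j)) v \<in> W" for W
  proof (rule R.submodule_eq_zero_or_carrier[OF W])
    let ?L = "R.lattice r W"
    fix w assume wL: "w \<in> ?L" and w0: "w \<noteq> (\<lambda>i\<in>{..<r}. \<zero>\<^bsub>?R\<^esub>)"
    have Lc: "v j \<in> carrier ?R" if "v \<in> ?L" "j < r" for v j
      using that by (auto simp: R.lattice_def)
    let ?s = "\<lambda>c v. \<lambda>i\<in>{..<r}. padic_of_int p c \<otimes>\<^bsub>?R\<^esub> v i"
    have sL: "?s c v \<in> ?L" if "v \<in> ?L" for c v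
      by (intro R.lattice_smult[OF W that] padic_of_int_closed p_pos)
    have s_cong: "[?s c v i n = c * v i n] (mod int p ^ n)" if "i < r" for c v i n
      using that by (simp add: padic_of_int_def padic_integers_def cong_def mod_simps)
    \<comment> \<open>v / p^n = p^m v / p^(n+m), with the new numerator still in the lattice. This
      puts two elements of \<open>D\<close> on a common level.\<close>
    have shift: "e n (\<lambda>i. v i n) = e (n + m) (\<lambda>i. ?s (int p ^ m) v i (n + m))" if v: "v \<in> ?L" for v n m
    proof -
      have "e n (\<lambda>i. v i n) = e n (\<lambda>i. v i (n + m))"
        using padic_mod[OF Lc[OF v], of _ n "n + m"] padic_mod[OF Lc[OF v], of _ n n]
        by (simp add: eq_iff cong_def)
      also have "\<dots> = e (n + m) (\<lambda>i. int p ^ m * v i (n + m))"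
        by (simp only: lift_power)
      also have "\<dots> = e (n + m) (\<lambda>i. ?s (int p ^ m) v i (n + m))"
        unfolding eq_iff using s_cong by (blast intro: cong_sym)
      finally show ?thesis .
    qed
    \<comment> \<open>At level \<open>n\<close> a p-adic numerator matters only modulo p^n, so the
      residues \<open>v i n\<close> represent the class of v / p^n.\<close>
    define D where "D = {x. \<exists>n v. v \<in> ?L \<and> x = e n (\<lambda>i. v i n)}"
    have Dsub: "subgroup D G"
    proof (rule subgroupI)
      show "D \<subseteq> carrier G" by (auto simp: D_def)
      show "D \<noteq> {}" using wL by (auto simp: D_def)
    next
      fix x assume "x \<in> D"
      then obtain n v where v: "v \<in> ?L" "x = e n (\<lambda>i. v i n)" by (auto simp: D_def)
      have "inv x = e n (\<lambda>i. - v i n)" by (simp add: neg v)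
      also have "\<dots> = e n (\<lambda>i. ?s (- 1) v i n)"
        unfolding eq_iff using s_cong[of _ "- 1" v n] by (simp add: cong_sym_eq)
      finally show "inv x \<in> D" using sL[OF v(1)] unfolding D_def by blast
    next
      fix x y assume "x \<in> D" "y \<in> D"
      then obtain n v m u where v: "v \<in> ?L" "x = e n (\<lambda>i. v i n)" and u: "u \<in> ?L" "y = e m (\<lambda>i. u i m)"
        by (auto simp: D_def)
      let ?v = "?s (int p ^ m) v" and ?u = "?s (int p ^ n) u"
      have "x \<otimes> y = e (n + m) (\<lambda>i. ?v i (n + m)) \<otimes> e (n + m) (\<lambda>i. ?u i (n + m))"
        using shift[OF v(1), of n m] shift[OF u(1), of m n] v(2) u(2) by (simp only: add.commute)
      also have "\<dots> = e (n + m) (\<lambda>i. ?v i (n + m) + ?u i (n + m))"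
        by (simp only: add)
      also have "\<dots> = e (n + m) (\<lambda>i. (\<lambda>i\<in>{..<r}. ?v i \<oplus>\<^bsub>?R\<^esub> ?u i) i (n + m))"
        unfolding eq_iff by (simp add: padic_integers_def cong_def)
      finally have "x \<otimes> y = e (n + m) (\<lambda>i. (\<lambda>i\<in>{..<r}. ?v i \<oplus>\<^bsub>?R\<^esub> ?u i) i (n + m))" .
      moreover have "(\<lambda>i\<in>{..<r}. ?v i \<oplus>\<^bsub>?R\<^esub> ?u i) \<in> ?L"
        by (intro R.lattice_add[OF W] sL v u)
      ultimately show "x \<otimes> y \<in> D" unfolding D_def by blast
    qed
    have "infinite D"
    proof -
      have "\<exists>i<r. w i \<noteq> \<zero>\<^bsub>?R\<^esub>"
      proof (rule ccontr)
        assume "\<not> ?thesis"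
        then have "restrict w {..<r} = (\<lambda>i\<in>{..<r}. \<zero>\<^bsub>?R\<^esub>)" by (intro restrict_ext) auto
        moreover have "restrict w {..<r} = w"
          using wL by (auto simp: R.lattice_def intro: PiE_restrict)
        ultimately show False using w0 by simp
      qed
      \<comment> \<open>The class of w / p^N is nontrivial once an entry of \<open>w\<close> is
        nonzero modulo p^N. Since \<open>D\<close> is closed under taking suitable p-th roots, this
        single element makes \<open>D\<close> infinite.\<close>
      then obtain i N where i: "i < r" and N: "w i N \<noteq> 0"
        by (auto simp: padic_integers_def fun_eq_iff)
      let ?x = "e N (\<lambda>i. w i N)"
      show ?thesis
      proof (rule infinite_if_p_divisible[OF Dsub])
        show "?x \<in> D" using wL by (auto simp: D_def)
        show "?x \<noteq> \<one>"
          using padic_nonzero_not_dvd[OF Lc[OF wL i] N order.refl] i by (auto simp: eq_one_iff)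
        show "?x [^] (p ^ N) = \<one>" by (simp add: power eq_one_iff)
        fix y assume "y \<in> D"
        then obtain n v where v: "v \<in> ?L" "y = e n (\<lambda>i. v i n)" by (auto simp: D_def)
        have "e (Suc n) (\<lambda>i. v i (Suc n)) [^] p = e n (\<lambda>i. v i (Suc n))"
          by (simp only: power lift)
        also have "\<dots> = y"
          unfolding v(2) eq_iff using padic_cong[OF Lc[OF v(1)]] by blast
        finally show "\<exists>z\<in>D. z [^] p = y" using v(1) unfolding D_def by blast
      qed
    qed
    moreover have "act h x \<in> D" if h: "h \<in> carrier K" and x: "x \<in> D" for h x
    proof -
      obtain n v where v: "v \<in> ?L" "x = e n (\<lambda>i. v i n)" using x by (auto simp: D_def)
      obtain A where A: "A \<in> padic_matrices p r K G act \<phi>"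
        "act h x = e n (\<lambda>i. \<Sum>j<r. A i j n * v j n)"
        using mat[OF h] v(2) by blast
      have Am: "A \<in> matrices ?R r" using A(1) by (simp add: padic_matrices_def)
      have vc: "v \<in> {..<r} \<rightarrow>\<^sub>E carrier ?R" and vW: "R.embed_vec r v \<in> W"
        using v(1) by (simp_all add: R.lattice_def)
      have "act h x = e n (\<lambda>i. mat_vec ?R r A v i n)"
        unfolding A(2) eq_iff using mat_vec_padic[OF p_pos Am vc] by (simp add: cong_def)
      moreover have "mat_vec ?R r A v \<in> ?L"
      proof -
        have "R.embed_vec r (mat_vec ?R r A v) \<in> W"
          using inv[OF A(1) vW] R.mat_vec_embed[OF Am vc] by simp
        moreover have "mat_vec ?R r A v \<in> {..<r} \<rightarrow>\<^sub>E carrier ?R"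
          unfolding mat_vec_def
        proof (intro PiE_I)
          fix i assume i: "i \<in> {..<r}"
          have "(\<Oplus>\<^bsub>?R\<^esub>j\<in>{..<r}. A i j \<otimes>\<^bsub>?R\<^esub> v j) \<in> carrier ?R"
            using Am vc i by (intro R.finsum_closed) (auto simp: matrices_def intro!: R.m_closed)
          then show "(\<lambda>i\<in>{..<r}. \<Oplus>\<^bsub>?R\<^esub>j\<in>{..<r}. A i j \<otimes>\<^bsub>?R\<^esub> v j) i \<in> carrier ?R"
            using i by simp
        qed simp
        ultimately show ?thesis by (simp only: R.lattice_def mem_Collect_eq)
      qed
      ultimately show ?thesis unfolding D_def by blast
    qed
    ultimately have DG: "D = carrier G" using irred[OF Dsub] by blast
    show "?L = {..<r} \<rightarrow>\<^sub>E carrier ?R"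
    proof (rule lattice_eq_carrier[OF p W])
      fix i assume i: "i < r"
      \<comment> \<open>The class of u / p is that of some v / p^n with v in the lattice. At level n
        + 1 this says that x = pv is congruent to p^n u modulo p^(n+1), so p^n divides x. By purity
        y = x / p^n is in the lattice, and y is congruent to u modulo p.\<close>
      let ?u = "\<lambda>j. if j = i then 1 else 0 :: int"
      have "e 1 ?u \<in> D" using DG by simp
      then obtain n v where v: "v \<in> ?L" "e 1 ?u = e n (\<lambda>i. v i n)" by (auto simp: D_def)
      define x where "x = ?s (int p ^ 1) v"
      have xL: "x \<in> ?L" unfolding x_def by (rule sL[OF v(1)])
      have "e (1 + n) (\<lambda>j. int p ^ n * ?u j) = e (n + 1) (\<lambda>j. x j (n + 1))"
        unfolding lift_power v(2) x_def by (rule shift[OF v(1)])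
      then have c: "[int p ^ n * ?u j = x j (Suc n)] (mod int p ^ Suc n)" if "j < r" for j
        using that by (simp add: eq_iff del: power_Suc)
      have pn: "0 < int p ^ n" "int p ^ n < int p ^ Suc n" using p1 by simp_all
      \<comment> \<open>Both sides are non-negative and below p^(n+1), so the congruence is an
        equality.\<close>
      have xn: "x j (Suc n) = int p ^ n * ?u j" if "j < r" for j
        using c[OF that] padic_range[OF Lc[OF xL that], of "Suc n"] pn
        by (intro cong_less_imp_eq_int[of _ "int p ^ Suc n"])
           (auto simp: cong_sym_eq simp del: power_Suc)
      have x0: "x j n = 0" if "j < r" for j
        using padic_mod[OF Lc[OF xL that], of n "Suc n"] by (simp add: xn[OF that])
      define y where "y = (\<lambda>j\<in>{..<r}. \<lambda>k. x j (k + n) div int p ^ n)"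
      have y: "y j \<in> carrier ?R" "padic_of_int p (int p ^ n) \<otimes>\<^bsub>?R\<^esub> y j = x j" if "j < r" for j
        using padic_div_power(1)[OF Lc[OF xL that] x0[OF that] p_pos]
          padic_div_power(2)[OF Lc[OF xL that] x0[OF that] p_pos, symmetric] that
        by (simp_all only: y_def restrict_apply' lessThan_iff)
      have nz: "padic_of_int p (int p ^ n) \<noteq> \<zero>\<^bsub>?R\<^esub>"
      proof
        assume "padic_of_int p (int p ^ n) = \<zero>\<^bsub>?R\<^esub>"
        then have "padic_of_int p (int p ^ n) (Suc n) = 0" by (simp add: padic_integers_def)
        then show False using pn by (simp add: padic_of_int_def del: power_Suc)
      qed
      have "?s (int p ^ n) y = restrict x {..<r}"
        using y by (intro restrict_ext) simp
      also have "\<dots> = x"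
        using xL by (auto simp: R.lattice_def intro: PiE_restrict)
      finally have "?s (int p ^ n) y \<in> ?L" using xL by simp
      then have "y \<in> ?L"
        using R.lattice_smult_iff[OF W _ padic_of_int_closed[OF p_pos] nz, of y] y
        by (simp add: y_def PiE_iff extensional_def)
      moreover have "\<forall>j<r. y j 1 = (if j = i then 1 else 0)"
        using xn p_pos by (simp add: y_def)
      ultimately show "\<exists>y\<in>?L. \<forall>j<r. y j 1 = (if j = i then 1 else 0)" by blast
    qed
  qed
  then have "irreducible_matrices (padic_numbers p) r
      ((\<lambda>A. \<lambda>i\<in>{..<r}. \<lambda>j\<in>{..<r}. padic_embed p (A i j)) ` padic_matrices p r K G act \<phi>)"
    unfolding irreducible_matrices_def using r by blast
  then show ?thesis using \<phi>(1) unfolding acts_padic_irreducibly_def by blast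
qed

subsection \<open>Finite rank\<close>

context pruefer_coords
begin

lemma finite_killed: "finite {x \<in> carrier G. x [^] (p ^ n) = \<one>}"
proof (rule finite_subset)
  show "{x \<in> carrier G. x [^] (p ^ n) = \<one>} \<subseteq> e n ` ({..<r} \<rightarrow>\<^sub>E {0..<int p ^ n})"
  proof
    fix x assume "x \<in> {x \<in> carrier G. x [^] (p ^ n) = \<one>}"
    then obtain a where "x = e n a" using killed by blast
    also have "e n a = e n (\<lambda>i\<in>{..<r}. a i mod int p ^ n)"
      by (simp add: eq_iff cong_def)
    finally have "x = e n (\<lambda>i\<in>{..<r}. a i mod int p ^ n)" .
    then show "x \<in> e n ` ({..<r} \<rightarrow>\<^sub>E {0..<int p ^ n})"
      using p_pos by (simp only: image_eqI) (intro imageI, auto)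
  qed
qed (auto intro: finite_PiE)

text \<open>A finite \<open>p\<close>-group \<open>B\<close> is generated by representatives of the cosets of \<open>B\<^sup>p\<close>, and there are as
  many of them as solutions of \<open>x\<^sup>p = 1\<close> in \<open>B\<close>.\<close>

lemma finite_p_subgroup_generators:
  assumes B: "subgroup B G" and fin: "finite B" and n: "\<And>x. x \<in> B \<Longrightarrow> x [^] (p ^ n) = \<one>"
  obtains T where "finite T" "card T \<le> card {x \<in> carrier G. x [^] p = \<one>}" "T \<subseteq> B" "generate G T = B"
proof -
  let ?K = "{x \<in> carrier G. x [^] p = \<one>}" and ?M = "G\<lparr>carrier := B\<rparr>"
  have finK: "finite ?K" using finite_killed[of 1] by simp
  have Bc: "y \<in> carrier G" if "y \<in> B" for y using subgroup.mem_carrier[OF B that] .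
  interpret M: group ?M by (rule subgroup_imp_group[OF B])
  have pow: "y [^] (k :: nat) \<in> B" if "y \<in> B" for y k
    using that by (induction k) (auto intro: subgroup.m_closed[OF B] subgroup.one_closed[OF B])
  define Bp where "Bp = (\<lambda>y. y [^] p) ` B"
  have BpB: "Bp \<subseteq> B" using pow by (auto simp: Bp_def)
  have Bp: "subgroup Bp G"
  proof (rule subgroupI)
    show "Bp \<subseteq> carrier G" using BpB Bc by auto
    show "Bp \<noteq> {}" using subgroup.one_closed[OF B] by (auto simp: Bp_def)
    show "inv y \<in> Bp" if "y \<in> Bp" for y
      using that Bc subgroup.m_inv_closed[OF B] by (auto simp: Bp_def nat_pow_inv[symmetric])
    show "y \<otimes> z \<in> Bp" if "y \<in> Bp" "z \<in> Bp" for y z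
      using that Bc subgroup.m_closed[OF B] by (auto simp: Bp_def nat_pow_distrib[symmetric])
  qed
  then have BpM: "subgroup Bp ?M" using subgroup_incl[OF Bp B BpB] by simp
  let ?C = "rcosets\<^bsub>?M\<^esub> Bp"
  have lag: "card ?C * card Bp = card B"
    using M.lagrange[OF BpM] by (simp add: order_def)
  have "card B \<le> card Bp * card ?K"
  proof -
    \<comment> \<open>\<open>B\<close> is counted along the fibres of the p-th power map; dividing
      by one of its points embeds a fibre into \<open>?K\<close>.\<close>
    have "B = (\<Union>y\<in>Bp. {x \<in> B. x [^] p = y})" by (auto simp: Bp_def)
    then have "card B = card (\<Union>y\<in>Bp. {x \<in> B. x [^] p = y})" by (rule arg_cong)
    also have "\<dots> \<le> (\<Sum>y\<in>Bp. card {x \<in> B. x [^] p = y})"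
      using fin by (intro card_UN_le) (simp add: Bp_def)
    also have "\<dots> \<le> (\<Sum>y\<in>Bp. card ?K)"
    proof (rule sum_mono)
      fix y assume "y \<in> Bp"
      then obtain z where z: "z \<in> B" "y = z [^] p" by (auto simp: Bp_def)
      show "card {x \<in> B. x [^] p = y} \<le> card ?K"
      proof (rule card_inj_on_le[OF _ _ finK])
        show "inj_on (\<lambda>x. x \<otimes> inv z) {x \<in> B. x [^] p = y}"
          using Bc z by (intro inj_onI) auto
        show "(\<lambda>x. x \<otimes> inv z) ` {x \<in> B. x [^] p = y} \<subseteq> ?K"
          using Bc z by (auto simp: nat_pow_distrib nat_pow_inv)
      qed
    qed
    finally show ?thesis by simp
  qed
  moreover have "card Bp > 0"
    using fin subgroup.one_closed[OF Bp] BpB by (metis card_gt_0_iff empty_iff finite_subset)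
  ultimately have cardC: "card ?C \<le> card ?K"
    unfolding lag[symmetric] by (simp add: mult.commute)
  have finC: "finite ?C" using fin by (simp add: RCOSETS_def)
  define T where "T = (\<lambda>C. SOME x. x \<in> C) ` ?C"
  have rep: "\<exists>t\<in>T. \<exists>y\<in>B. x = t \<otimes> y [^] p" if x: "x \<in> B" for x
  proof -
    have "Bp #>\<^bsub>?M\<^esub> x \<in> ?C" using x by (auto simp: RCOSETS_def)
    moreover have "\<one> \<otimes> x \<in> Bp #>\<^bsub>?M\<^esub> x"
      using subgroup.one_closed[OF Bp] by (auto simp: r_coset_def)
    ultimately obtain t where "t \<in> T" "t \<in> Bp #>\<^bsub>?M\<^esub> x"
      unfolding T_def by (metis image_eqI someI_ex)
    then obtain b where b: "b \<in> B" "t \<in> T" "t = b [^] p \<otimes> x"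
      by (auto simp: r_coset_def Bp_def)
    then have "x = t \<otimes> (inv b) [^] p"
      using Bc[OF x] Bc[OF b(1)] by (simp add: nat_pow_inv m_ac)
    then show ?thesis using b subgroup.m_inv_closed[OF B b(1)] by blast
  qed
  have TB: "T \<subseteq> B"
  proof
    fix t assume "t \<in> T"
    then obtain x where "x \<in> B" "t = (SOME y. y \<in> Bp #>\<^bsub>?M\<^esub> x)"
      by (auto simp: T_def RCOSETS_def)
    moreover have "\<one> \<otimes> x \<in> Bp #>\<^bsub>?M\<^esub> x"
      using subgroup.one_closed[OF Bp] by (auto simp: r_coset_def)
    ultimately have "t \<in> Bp #>\<^bsub>?M\<^esub> x" by (metis someI_ex)
    then show "t \<in> B"
      using BpB \<open>x \<in> B\<close> subgroup.m_closed[OF B] by (auto simp: r_coset_def)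
  qed
  then have Tc: "T \<subseteq> carrier G" using Bc by blast
  have gT: "subgroup (generate G T) G" by (rule generate_is_subgroup[OF Tc])
  have gTB: "generate G T \<subseteq> B" by (rule generate_subgroup_incl[OF TB B])
  have powT: "y [^] (k :: nat) \<in> generate G T" if "y \<in> generate G T" for y k
    using that by (induction k) (auto intro: subgroup.m_closed[OF gT] subgroup.one_closed[OF gT])
  \<comment> \<open>From B = <T> B^p one gets B = <T> B^(p^k) by iteration, since powers of
    representatives stay in <T>. For k = n the second factor is trivial.\<close>
  have "\<exists>t\<in>generate G T. \<exists>y\<in>B. x = t \<otimes> y [^] (p ^ k)" if x: "x \<in> B" for x k
  proof (induction k)
    case 0
    then show ?case
      using x Bc by (intro bexI[of _ \<one>] bexI[of _ x]) (auto intro: generate.one)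
  next
    case (Suc k)
    then obtain t y where t: "t \<in> generate G T" "y \<in> B" "x = t \<otimes> y [^] (p ^ k)" by blast
    obtain s z where s: "s \<in> T" "z \<in> B" "y = s \<otimes> z [^] p" using rep[OF t(2)] by blast
    have c: "s \<in> carrier G" "z \<in> carrier G" "t \<in> carrier G"
      using s t Tc Bc gTB by auto
    have "x = (t \<otimes> s [^] (p ^ k)) \<otimes> z [^] (p ^ Suc k)"
      unfolding t(3) s(3) using c by (simp add: nat_pow_distrib nat_pow_pow m_assoc)
    moreover have "t \<otimes> s [^] (p ^ k) \<in> generate G T"
      using t(1) powT[OF generate.incl[OF s(1)]] by (intro subgroup.m_closed[OF gT])
    ultimately show ?case using s(2) by blast
  qed
  then have "B \<subseteq> generate G T"
    using n subgroup.mem_carrier[OF gT] by (metis r_one subsetI)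
  with gTB have "generate G T = B" by blast
  moreover have "card T \<le> card ?K" "finite T"
    using card_image_le[OF finC] cardC finC unfolding T_def by (blast intro: order.trans)+
  ultimately show thesis using that TB by blast
qed

text \<open>The bound is the number of solutions of x^p = 1. A finite \<open>S\<close> lies in the
  subgroup killed by a single power of p, which is finite, so the subgroup generated by
  \<open>S\<close> is a finite p-group.\<close>

lemma finite_rank: "finite_rank G"
  unfolding finite_rank_def
proof (rule exI, intro allI impI)
  fix S assume S: "finite S \<and> S \<subseteq> carrier G"
  have "\<exists>n. x [^] (p ^ n) = \<one>" if x: "x \<in> carrier G" for x
  proof -
    obtain n a where "x = e n a" using surj[OF x] by metis
    then have "x [^] (p ^ n) = \<one>" by (simp add: power eq_one_iff)
    then show ?thesis by blast
  qed
  then obtain f where f: "\<And>x. x \<in> carrier G \<Longrightarrow> x [^] (p ^ f x) = \<one>" by metis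
  define n where "n = (\<Sum>x\<in>S. f x)"
  define U where "U = {x \<in> carrier G. x [^] (p ^ n) = \<one>}"
  have "x [^] (p ^ n) = \<one>" if "x \<in> S" for x
  proof -
    have "f x \<le> n" unfolding n_def using S that by (intro member_le_sum) auto
    then have "p ^ n = p ^ f x * p ^ (n - f x)" by (simp add: power_add[symmetric])
    moreover have "x \<in> carrier G" using S that by auto
    ultimately have "x [^] (p ^ n) = (x [^] (p ^ f x)) [^] (p ^ (n - f x))" by (simp add: nat_pow_pow)
    then show ?thesis using f[OF \<open>x \<in> carrier G\<close>] by simp
  qed
  then have "S \<subseteq> U" using S by (auto simp: U_def)
  moreover have "subgroup U G"
    by (rule subgroupI) (auto simp: U_def nat_pow_inv nat_pow_distrib intro: exI[of _ \<one>])
  ultimately have gU: "generate G S \<subseteq> U" by (rule generate_subgroup_incl)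
  have gS: "subgroup (generate G S) G" using S by (intro generate_is_subgroup) auto
  have fin: "finite (generate G S)"
    using gU finite_killed[of n] by (auto simp: U_def intro: finite_subset)
  have kill: "x [^] (p ^ n) = \<one>" if "x \<in> generate G S" for x using gU that by (auto simp: U_def)
  obtain T where "finite T" "card T \<le> card {x \<in> carrier G. x [^] p = \<one>}" "T \<subseteq> generate G S"
      "generate G T = generate G S"
    by (rule finite_p_subgroup_generators[OF gS fin kill])
  then show "\<exists>T. finite T \<and> card T \<le> card {x \<in> carrier G. x [^] p = \<one>} \<and> T \<subseteq> carrier G \<and>
      generate G T = generate G S"
    using subgroup.subset[OF gS] by blast
qed

end

section \<open>Torsion groups with a finite irreducible group of operators\<close>

text \<open>Irreducibility constrains infinite invariant subgroups only: in the application the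
  group is a union of finite invariant ones.\<close>

locale irreducible_operators = comm_group G for G (structure) +
  fixes K :: "('k, 'l) monoid_scheme" and act :: "'k \<Rightarrow> 'a \<Rightarrow> 'a"
  assumes group_K: "group K" and finite_K: "finite (carrier K)"
    and act_hom: "h \<in> carrier K \<Longrightarrow> act h \<in> hom G G"
    and act_mult: "h \<in> carrier K \<Longrightarrow> k \<in> carrier K \<Longrightarrow> x \<in> carrier G \<Longrightarrow>
      act (h \<otimes>\<^bsub>K\<^esub> k) x = act h (act k x)"
    and act_one: "x \<in> carrier G \<Longrightarrow> act \<one>\<^bsub>K\<^esub> x = x"
    and infinite_carrier: "infinite (carrier G)"
    and torsion: "x \<in> carrier G \<Longrightarrow> \<exists>n::nat. n > 0 \<and> x [^] n = \<one>"
    and irreducible: "subgroup D G \<Longrightarrow> infinite D \<Longrightarrow>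
      (\<And>h x. h \<in> carrier K \<Longrightarrow> x \<in> D \<Longrightarrow> act h x \<in> D) \<Longrightarrow> D = carrier G"
begin

lemma act_group_hom: "h \<in> carrier K \<Longrightarrow> group_hom G G (act h)"
  using act_hom by (intro group_hom.intro) (auto intro: group_hom_axioms.intro)

lemma act_closed: "h \<in> carrier K \<Longrightarrow> x \<in> carrier G \<Longrightarrow> act h x \<in> carrier G"
  using act_hom by (auto simp: hom_def)

lemma act_pow: "h \<in> carrier K \<Longrightarrow> x \<in> carrier G \<Longrightarrow> act h (x [^] (n::nat)) = act h x [^] n"
  using group_hom.hom_nat_pow[OF act_group_hom] by blast

lemma subgroup_kernel_pow: "subgroup {x \<in> carrier G. x [^] (n::nat) = \<one>} G"
  by (rule subgroupI) (auto simp: nat_pow_inv nat_pow_distrib intro: exI[of _ \<one>])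

lemma kernel_pow_invariant:
  assumes "h \<in> carrier K" "x \<in> {x \<in> carrier G. x [^] (n::nat) = \<one>}"
  shows "act h x \<in> {x \<in> carrier G. x [^] n = \<one>}"
  using assms act_closed act_pow[of h x n] group_hom.hom_one[OF act_group_hom] by auto

text \<open>Avoiding a fixed element passes to unions of chains, whereas being proper need not;
  hence Zorn's lemma applies in this form.\<close>

lemma exists_max_subgroup_avoiding:
  assumes "x \<in> carrier G" "x \<noteq> \<one>"
  obtains C where "subgroup C G" "x \<notin> C" "\<And>D. subgroup D G \<Longrightarrow> x \<notin> D \<Longrightarrow> C \<subseteq> D \<Longrightarrow> D = C"
proof -
  let ?A = "{C. subgroup C G \<and> x \<notin> C}"
  have "\<exists>C\<in>?A. \<forall>D\<in>?A. C \<subseteq> D \<longrightarrow> D = C"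
  proof (rule subset_Zorn_nonempty)
    have "{\<one>} \<in> ?A" using assms triv_subgroup by auto
    then show "?A \<noteq> {}" by blast
    fix \<C> assume ne: "\<C> \<noteq> {}" and ch: "subset.chain ?A \<C>"
    have sub: "subgroup C G" "x \<notin> C" if "C \<in> \<C>" for C
      using ch that by (auto simp: subset.chain_def)
    have "subgroup (\<Union>\<C>) G"
    proof (rule subgroupI)
      show "\<Union>\<C> \<subseteq> carrier G" using sub subgroup.subset by blast
      show "\<Union>\<C> \<noteq> {}" using ne sub subgroup.one_closed by blast
      show "inv y \<in> \<Union>\<C>" if "y \<in> \<Union>\<C>" for y
        using that subgroup.m_inv_closed[OF sub(1)] by auto
      fix y z assume "y \<in> \<Union>\<C>" "z \<in> \<Union>\<C>"
      then obtain C D where CD: "C \<in> \<C>" "D \<in> \<C>" "y \<in> C" "z \<in> D" by blast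
      have "C \<subseteq> D \<or> D \<subseteq> C" using ch CD by (auto simp: subset.chain_def)
      then show "y \<otimes> z \<in> \<Union>\<C>"
        using CD sub subgroup.m_closed by (metis Union_iff subsetD)
    qed
    then show "\<Union>\<C> \<in> ?A" using sub by auto
  qed
  then show thesis using that by blast
qed

text \<open>\<open>C\<close> has index at most q. Adjoining some \<open>y\<close> outside
  \<open>C\<close> produces x = c y^k; here q does not divide k, as otherwise x = c would be in
  \<open>C\<close>. So k is invertible modulo q, and \<open>y\<close> is a power of \<open>x\<close>
  up to an element of \<open>C\<close>.\<close>

lemma finite_index_if_max_avoiding:
  assumes q: "Factorial_Ring.prime q" and exp: "\<And>y. y \<in> carrier G \<Longrightarrow> y [^] q = \<one>"
    and x: "x \<in> carrier G" and C: "subgroup C G" "x \<notin> C"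
    and max: "\<And>D. subgroup D G \<Longrightarrow> x \<notin> D \<Longrightarrow> C \<subseteq> D \<Longrightarrow> D = C"
    and y: "y \<in> carrier G"
  shows "\<exists>j\<in>{0..<int q}. y \<otimes> x [^] j \<in> C"
proof (cases "y \<in> C")
  case True
  then show ?thesis using prime_gt_0_nat[OF q] y x by (intro bexI[of _ 0]) auto
next
  case False
  have Cc: "c \<in> carrier G" if "c \<in> C" for c using subgroup.mem_carrier[OF C(1) that] .
  have expi: "z [^] (int q * d) = \<one>" if "z \<in> carrier G" for z d
    using exp[OF that] that int_pow_pow[of z "int q" d] by (simp add: int_pow_int)
  have powc: "z [^] k = z [^] l" if "z \<in> carrier G" "[k = l] (mod int q)" for z k l
  proof -
    obtain d where "k = l + int q * d" using \<open>[k = l] (mod int q)\<close> by (metis cong_iff_lin cong_sym)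
    then show ?thesis using that(1) expi[OF that(1)] by (simp add: int_pow_mult)
  qed
  define D where "D = {c \<otimes> y [^] k | c k. c \<in> C \<and> k \<in> (UNIV :: int set)}"
  have "subgroup D G"
  proof (rule subgroupI)
    show "D \<subseteq> carrier G" using Cc y by (auto simp: D_def)
    show "D \<noteq> {}" using subgroup.one_closed[OF C(1)] by (auto simp: D_def)
  next
    fix a assume "a \<in> D"
    then obtain c and k :: int where a: "c \<in> C" "a = c \<otimes> y [^] k" by (auto simp: D_def)
    have "inv a = inv c \<otimes> y [^] (- k)"
      using a Cc y by (simp add: inv_mult int_pow_neg)
    then show "inv a \<in> D" using a subgroup.m_inv_closed[OF C(1)] by (auto simp: D_def)
  next
    fix a b assume "a \<in> D" "b \<in> D"
    then obtain c d and k l :: int where ab: "c \<in> C" "a = c \<otimes> y [^] k" "d \<in> C" "b = d \<otimes> y [^] l"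
      by (auto simp: D_def)
    have "a \<otimes> b = (c \<otimes> d) \<otimes> y [^] (k + l)"
      using ab Cc y by (simp add: int_pow_mult m_ac)
    then show "a \<otimes> b \<in> D" using ab subgroup.m_closed[OF C(1)] by (auto simp: D_def)
  qed
  moreover have "C \<subseteq> D"
  proof
    fix c assume "c \<in> C"
    then have "c = c \<otimes> y [^] (0::int)" using Cc by simp
    then show "c \<in> D" using \<open>c \<in> C\<close> unfolding D_def by blast
  qed
  moreover have "D \<noteq> C"
  proof -
    have "\<one> \<otimes> y [^] (1::int) \<in> D" unfolding D_def using subgroup.one_closed[OF C(1)] by blast
    then show ?thesis using False y by auto
  qed
  ultimately have "x \<in> D" using max by blast
  then obtain c and k :: int where c: "c \<in> C" "x = c \<otimes> y [^] k" by (auto simp: D_def)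
  have "\<not> int q dvd k"
  proof
    assume "int q dvd k"
    then obtain d where "k = int q * d" by (elim dvdE)
    then have "x = c" using c Cc y expi by simp
    then show False using c C by simp
  qed
  then have "coprime k (int q)"
    using q by (metis coprime_commute prime_imp_coprime prime_nat_int_transfer)
  then obtain l where l: "[k * l = 1] (mod int q)" by (rule cong_solve_coprime_int[THEN exE])
  define j where "j = (- l) mod int q"
  have "x [^] j = x [^] (- l)"
    using x by (intro powc) (simp_all add: j_def cong_def)
  also have "\<dots> = c [^] (- l) \<otimes> inv (y [^] (k * l))"
    using c Cc y by (simp add: int_pow_distrib int_pow_pow int_pow_neg inv_mult)
  also have "y [^] (k * l) = y" using powc[OF y l] y by simp
  finally have xj: "x [^] j = c [^] (- l) \<otimes> inv y" .
  have "y \<otimes> x [^] j = c [^] (- l)"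
    unfolding xj using y c(1) Cc m_lcomm[of y "c [^] (- l)" "inv y"] by simp
  moreover have "c [^] (- l) \<in> C"
    using subgroup_int_pow_closed[OF C(1) c(1)] .
  moreover have "j \<in> {0..<int q}"
    using prime_gt_0_nat[OF q] by (simp add: j_def)
  ultimately show ?thesis by (intro bexI[of _ j]) (simp_all only:)
qed

lemma finite_kernel_pow:
  fixes q :: nat
  assumes q: "Factorial_Ring.prime q"
  shows "finite {x \<in> carrier G. x [^] q = \<one>}"
proof (rule ccontr)
  assume "infinite {x \<in> carrier G. x [^] q = \<one>}"
  from irreducible[OF subgroup_kernel_pow[of q] this kernel_pow_invariant[where n = q]]
  have exp: "y [^] q = \<one>" if "y \<in> carrier G" for y using that by blast
  have "\<not> carrier G \<subseteq> {\<one>}" using infinite_carrier finite_subset by blast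
  then obtain x where x: "x \<in> carrier G" "x \<noteq> \<one>" by blast
  obtain C where C: "subgroup C G" "x \<notin> C"
    and max: "\<And>D. subgroup D G \<Longrightarrow> x \<notin> D \<Longrightarrow> C \<subseteq> D \<Longrightarrow> D = C"
    using exists_max_subgroup_avoiding[OF x] by metis
  obtain f where f: "\<And>y. y \<in> carrier G \<Longrightarrow> f y \<in> {0..<int q}"
    "\<And>y. y \<in> carrier G \<Longrightarrow> y \<otimes> x [^] f y \<in> C"
    using finite_index_if_max_avoiding[OF q exp x(1) C max] by metis
  have Cc: "c \<in> carrier G" if "c \<in> C" for c using subgroup.mem_carrier[OF C(1) that] .
  define D where "D = {y \<in> carrier G. \<forall>h\<in>carrier K. act h y \<in> C}"
  have "subgroup D G"
  proof (rule subgroupI)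
    show "D \<noteq> {}"
      using group_hom.hom_one[OF act_group_hom] subgroup.one_closed[OF C(1)]
      by (auto simp: D_def intro: exI[of _ \<one>])
    show "inv y \<in> D" if "y \<in> D" for y
      using that subgroup.m_inv_closed[OF C(1)] group_hom.hom_inv[OF act_group_hom]
      by (auto simp: D_def)
    show "y \<otimes> z \<in> D" if "y \<in> D" "z \<in> D" for y z
      using that subgroup.m_closed[OF C(1)] act_hom by (auto simp: D_def hom_def)
  qed (auto simp: D_def)
  moreover have "infinite D"
  proof
    assume finD: "finite D"
    \<comment> \<open>\<open>F y\<close> records for each operator h which coset of \<open>C\<close>
      contains \<open>act h y\<close>. It takes finitely many values, so some fibre is infinite, and
      dividing its elements by one of them gives members of \<open>D\<close>.\<close>
    define F where "F y = (\<lambda>h\<in>carrier K. f (act h y))" for y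
    have "F ` carrier G \<subseteq> carrier K \<rightarrow>\<^sub>E {0..<int q}"
      using f(1) act_closed by (auto simp: F_def)
    then have "finite (F ` carrier G)"
      by (rule finite_subset) (auto intro: finite_PiE finite_K)
    then obtain y0 where y0: "y0 \<in> carrier G" and inf: "infinite {y \<in> carrier G. F y = F y0}"
      using pigeonhole_infinite[OF infinite_carrier] by blast
    have "(\<lambda>y. y \<otimes> inv y0) ` {y \<in> carrier G. F y = F y0} \<subseteq> D"
    proof (rule image_subsetI)
      fix y assume "y \<in> {y \<in> carrier G. F y = F y0}"
      then have y: "y \<in> carrier G" "F y = F y0" by auto
      have "act h (y \<otimes> inv y0) \<in> C" if h: "h \<in> carrier K" for h
      proof -
        have fe: "f (act h y) = f (act h y0)" using fun_cong[OF y(2), of h] h by (simp add: F_def)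
        have c: "act h y \<in> carrier G" "act h y0 \<in> carrier G" using act_closed h y y0 by auto
        have "(act h y \<otimes> x [^] f (act h y)) \<otimes> inv (act h y0 \<otimes> x [^] f (act h y0)) \<in> C"
          by (rule subgroup.m_closed[OF C(1) f(2)[OF c(1)] subgroup.m_inv_closed[OF C(1) f(2)[OF c(2)]]])
        also have "(act h y \<otimes> x [^] f (act h y)) \<otimes> inv (act h y0 \<otimes> x [^] f (act h y0))
            = act h y \<otimes> inv (act h y0)"
        proof -
          let ?X = "x [^] f (act h y0)"
          have X: "?X \<in> carrier G" using x(1) by simp
          have "?X \<otimes> (inv ?X \<otimes> inv (act h y0)) = inv (act h y0)"
            using X c(2) by (simp add: m_assoc[symmetric])
          then show ?thesis
            unfolding fe using c X by (simp add: inv_mult_group m_assoc)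
        qed
        also have "\<dots> = act h (y \<otimes> inv y0)"
          using group_hom.hom_inv[OF act_group_hom[OF h] y0] act_hom[OF h] y(1) y0 by (simp add: hom_mult)
        finally show ?thesis .
      qed
      then show "y \<otimes> inv y0 \<in> D" using y y0 by (simp add: D_def)
    qed
    moreover have "inj_on (\<lambda>y. y \<otimes> inv y0) {y \<in> carrier G. F y = F y0}"
      using y0 by (intro inj_onI) auto
    ultimately show False using finD inf by (meson finite_imageD finite_subset)
  qed
  moreover have "act h y \<in> D" if "h \<in> carrier K" "y \<in> D" for h y
    using that act_closed act_mult[symmetric] group.is_monoid[OF group_K]
    by (auto simp: D_def intro: monoid.m_closed)
  ultimately have "D = carrier G" by (rule irreducible)
  then have "act \<one>\<^bsub>K\<^esub> x \<in> C"
    using x(1) monoid.one_closed[OF group.is_monoid[OF group_K]] by (auto simp: D_def)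
  then show False using C act_one[OF x(1)] by simp
qed

text \<open>The fibres of y \<mapsto> y^q are translates of the finite kernel, so the image is
  infinite; it is also an invariant subgroup.\<close>

lemma prime_divisible:
  fixes q :: nat
  assumes q: "Factorial_Ring.prime q" and x: "x \<in> carrier G"
  obtains y where "y \<in> carrier G" "y [^] q = x"
proof -
  let ?D = "(\<lambda>y. y [^] q) ` carrier G"
  have "subgroup ?D G"
  proof (rule subgroupI)
    fix y assume "y \<in> ?D"
    then obtain a where "a \<in> carrier G" "y = a [^] q" by auto
    then show "inv y \<in> ?D" by (intro image_eqI[of _ _ "inv a"]) (auto simp: nat_pow_inv)
  next
    fix y z assume "y \<in> ?D" "z \<in> ?D"
    then obtain a b where "a \<in> carrier G" "y = a [^] q" "b \<in> carrier G" "z = b [^] q" by auto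
    then show "y \<otimes> z \<in> ?D"
      by (intro image_eqI[of _ _ "a \<otimes> b"]) (auto simp: nat_pow_distrib)
  qed auto
  moreover have "infinite ?D"
  proof
    assume "finite ?D"
    then obtain y0 where y0: "y0 \<in> carrier G" and inf: "infinite {y \<in> carrier G. y [^] q = y0 [^] q}"
      using pigeonhole_infinite[OF infinite_carrier] by blast
    have "(\<lambda>y. y \<otimes> inv y0) ` {y \<in> carrier G. y [^] q = y0 [^] q} \<subseteq> {x \<in> carrier G. x [^] q = \<one>}"
      using y0 by (auto simp: nat_pow_distrib nat_pow_inv)
    moreover have "inj_on (\<lambda>y. y \<otimes> inv y0) {y \<in> carrier G. y [^] q = y0 [^] q}"
      using y0 by (intro inj_onI) auto
    ultimately show False using finite_kernel_pow[OF q] inf by (meson finite_imageD finite_subset)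
  qed
  moreover have "act h y \<in> ?D" if "h \<in> carrier K" "y \<in> ?D" for h y
    using that act_pow act_closed by auto
  ultimately have "?D = carrier G" by (rule irreducible)
  then show thesis using x that by (metis imageE)
qed

lemma divisible: "divisible_group G"
proof -
  have "\<exists>y\<in>carrier G. y [^] n = x" if "n \<ge> 1" "x \<in> carrier G" for n :: nat and x
    using that
  proof (induction n arbitrary: x rule: less_induct)
    case (less n)
    show ?case
    proof (cases "n = 1")
      case True
      then show ?thesis using less.prems by auto
    next
      case False
      then obtain q where q: "Factorial_Ring.prime q" "q dvd n" using prime_factor_nat by blast
      then obtain k where k: "n = q * k" by (elim dvdE)
      have "k < n" "k \<ge> 1" using k less.prems prime_gt_1_nat[OF q(1)] by (auto simp: Suc_le_eq)
      obtain z where z: "z \<in> carrier G" "z [^] q = x" by (rule prime_divisible[OF q(1) less.prems(2)])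
      obtain y where y: "y \<in> carrier G" "y [^] k = z"
        using less.IH[OF \<open>k < n\<close> \<open>k \<ge> 1\<close> z(1)] by blast
      then have "y [^] n = x" using z by (simp add: k nat_pow_pow[symmetric] mult.commute)
      then show ?thesis using y by blast
    qed
  qed
  then show ?thesis by (auto simp: divisible_group_def)
qed

text \<open>Any prime p dividing the order of an element serves: the p-primary part is invariant,
  contains an element of order p and is closed under p-th roots, so it is infinite and therefore
  everything.\<close>

lemma exists_prime: "\<exists>p. Factorial_Ring.prime p \<and> is_p_group p G"
proof -
  have "\<not> carrier G \<subseteq> {\<one>}" using infinite_carrier finite_subset by blast
  then obtain x where x: "x \<in> carrier G" "x \<noteq> \<one>" by blast
  define n where "n = (LEAST n::nat. n > 0 \<and> x [^] n = \<one>)"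
  have n: "n > 0" "x [^] n = \<one>" and least: "\<And>m. m > 0 \<Longrightarrow> x [^] m = \<one> \<Longrightarrow> n \<le> m"
    using LeastI_ex[OF torsion[OF x(1)]] unfolding n_def by (auto intro: Least_le)
  have "n \<noteq> 1" using n x by auto
  then obtain p where p: "Factorial_Ring.prime p" "p dvd n" using prime_factor_nat by blast
  then obtain k where k: "n = p * k" by (elim dvdE)
  have "k < n" "k > 0" using k n prime_gt_1_nat[OF p(1)] by auto
  define z where "z = x [^] k"
  have z: "z \<in> carrier G" "z \<noteq> \<one>" "z [^] p = \<one>"
    using x n least[OF \<open>k > 0\<close>] \<open>k < n\<close> by (auto simp: z_def nat_pow_pow k mult.commute)
  let ?P = "{x \<in> carrier G. \<exists>k::nat. x [^] (p ^ k) = \<one>}"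
  have mono: "y [^] (p ^ (k + l)) = \<one>" if "y \<in> carrier G" "y [^] (p ^ k) = \<one>" for y k l
    using that by (simp add: power_add nat_pow_pow[symmetric])
  have P: "subgroup ?P G"
  proof (rule subgroupI)
    show "?P \<noteq> {}" by (auto intro: exI[of _ \<one>])
    show "inv y \<in> ?P" if "y \<in> ?P" for y
      using that by (auto simp: nat_pow_inv)
    fix a b assume "a \<in> ?P" "b \<in> ?P"
    then obtain k l where ab: "a \<in> carrier G" "b \<in> carrier G" "a [^] (p ^ k) = \<one>" "b [^] (p ^ l) = \<one>"
      by auto
    then have "(a \<otimes> b) [^] (p ^ (k + l)) = \<one>"
      using mono[of a k l] mono[of b l k] by (simp add: nat_pow_distrib add.commute)
    then show "a \<otimes> b \<in> ?P" using ab by auto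
  qed auto
  moreover have "infinite ?P"
  proof (rule infinite_if_p_divisible[OF P])
    show "z \<in> ?P" using z by (auto intro: exI[of _ 1])
    show "z \<noteq> \<one>" by fact
    show "z [^] (p ^ 1) = \<one>" using z by simp
    fix y assume "y \<in> ?P"
    then obtain k where y: "y \<in> carrier G" "y [^] (p ^ k) = \<one>" by auto
    obtain w where w: "w \<in> carrier G" "w [^] p = y" by (rule prime_divisible[OF p(1) y(1)])
    then have "w [^] (p ^ Suc k) = \<one>" using y by (simp add: nat_pow_pow[symmetric])
    then show "\<exists>w\<in>?P. w [^] p = y" using w by blast
  qed
  moreover have "act h y \<in> ?P" if "h \<in> carrier K" "y \<in> ?P" for h y
    using kernel_pow_invariant[OF that(1)] that(2) by blast
  ultimately have "?P = carrier G" by (rule irreducible)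
  then show ?thesis using p(1) by (auto simp: is_p_group_def)
qed

lemma divisible_p_group_of_finite_rank:
  "\<exists>p. Factorial_Ring.prime p \<and> divisible_group G \<and> is_p_group p G \<and> finite_rank G \<and>
    acts_padic_irreducibly p K G act"
proof -
  obtain p where prime: "Factorial_Ring.prime p" and p_group: "is_p_group p G"
    using exists_prime by blast
  obtain r e where "pruefer_coords G p r e"
    using exists_pruefer_coords[OF prime _ _ finite_kernel_pow[OF prime]] p_group
      prime_divisible[OF prime]
    unfolding is_p_group_def by metis
  then interpret C: pruefer_coords G p r e .
  have "acts_padic_irreducibly p K G act"
    by (rule C.acts_padic_irreducibly[OF infinite_carrier act_hom irreducible])
  then show ?thesis
    using prime p_group divisible C.finite_rank by (intro exI[of _ p] conjI)
qed

end

section \<open>Groups whose infinite normal subgroups have a common core-free supplement\<close>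

context group
begin

section \<open>Conjugation, centralisers and supplements in an arbitrary group\<close>

definition centralizer :: "'a set \<Rightarrow> 'a set" where
  "centralizer S = {g \<in> carrier G. \<forall>x\<in>S. g \<otimes> x = x \<otimes> g}"

lemma normalD:
  assumes "N \<lhd> G"
  shows "x \<in> N \<Longrightarrow> x \<in> carrier G" "\<one> \<in> N" "x \<in> N \<Longrightarrow> y \<in> N \<Longrightarrow> x \<otimes> y \<in> N"
    "x \<in> N \<Longrightarrow> inv x \<in> N" "g \<in> carrier G \<Longrightarrow> x \<in> N \<Longrightarrow> g \<otimes> x \<otimes> inv g \<in> N"
  using assms normal_imp_subgroup[OF assms]
  by (auto simp: normal_inv_iff subgroup.mem_carrier subgroup.one_closed subgroup.m_closed
      subgroup.m_inv_closed)

lemma commute_iff_conj_eq: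
  assumes "g \<in> carrier G" "x \<in> carrier G"
  shows "g \<otimes> x = x \<otimes> g \<longleftrightarrow> g \<otimes> x \<otimes> inv g = x"
  using assms inv_solve_right[of x "g \<otimes> x" g] by auto

lemma conj_mult:
  assumes "g \<in> carrier G" "h \<in> carrier G" "x \<in> carrier G"
  shows "g \<otimes> h \<otimes> x \<otimes> inv (g \<otimes> h) = g \<otimes> (h \<otimes> x \<otimes> inv h) \<otimes> inv g"
  using assms by (simp add: inv_mult_group m_assoc)

lemma conj_mult_distrib:
  assumes "g \<in> carrier G" "x \<in> carrier G" "y \<in> carrier G"
  shows "g \<otimes> (x \<otimes> y) \<otimes> inv g = (g \<otimes> x \<otimes> inv g) \<otimes> (g \<otimes> y \<otimes> inv g)"
proof -
  have "inv g \<otimes> (g \<otimes> (y \<otimes> inv g)) = y \<otimes> inv g"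
    using assms by (simp add: m_assoc[symmetric])
  then show ?thesis using assms by (simp add: m_assoc)
qed

lemma centralizer_normal:
  assumes N: "N \<lhd> G"
  shows "centralizer N \<lhd> G"
proof -
  have Nc: "x \<in> carrier G" if "x \<in> N" for x using normalD(1)[OF N that] .
  have sub: "subgroup (centralizer N) G"
  proof (rule subgroupI)
    show "centralizer N \<subseteq> carrier G" by (auto simp: centralizer_def)
    show "centralizer N \<noteq> {}" using Nc by (auto simp: centralizer_def intro!: exI[of _ \<one>])
  next
    fix a assume "a \<in> centralizer N"
    then have a: "a \<in> carrier G" "\<And>x. x \<in> N \<Longrightarrow> a \<otimes> x = x \<otimes> a" by (auto simp: centralizer_def)
    have "inv a \<otimes> x = x \<otimes> inv a" if x: "x \<in> N" for x
    proof -
      have "inv a \<otimes> x = inv a \<otimes> (x \<otimes> a) \<otimes> inv a"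
        using a(1) Nc[OF x] by (simp add: m_assoc)
      also have "\<dots> = x \<otimes> inv a"
        unfolding a(2)[OF x, symmetric] using a(1) Nc[OF x] by (simp add: m_assoc[symmetric])
      finally show ?thesis .
    qed
    then show "inv a \<in> centralizer N" using a by (simp add: centralizer_def)
  next
    fix a b assume ab: "a \<in> centralizer N" "b \<in> centralizer N"
    have "a \<otimes> b \<otimes> x = x \<otimes> (a \<otimes> b)" if x: "x \<in> N" for x
    proof -
      have "a \<otimes> b \<otimes> x = a \<otimes> (x \<otimes> b)"
        using ab Nc[OF x] x by (simp add: centralizer_def m_assoc)
      also have "\<dots> = a \<otimes> x \<otimes> b"
        using ab Nc[OF x] by (simp add: centralizer_def m_assoc)
      also have "\<dots> = x \<otimes> a \<otimes> b"
        using ab x by (simp add: centralizer_def)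
      finally show ?thesis using ab Nc[OF x] by (simp add: centralizer_def m_assoc)
    qed
    then show "a \<otimes> b \<in> centralizer N" using ab by (simp add: centralizer_def)
  qed
  have "g \<otimes> c \<otimes> inv g \<in> centralizer N" if g: "g \<in> carrier G" and c: "c \<in> centralizer N" for g c
  proof -
    have cc: "c \<in> carrier G" using c by (simp add: centralizer_def)
    have "(g \<otimes> c \<otimes> inv g) \<otimes> x = x \<otimes> (g \<otimes> c \<otimes> inv g)" if x: "x \<in> N" for x
    proof -
      define y where "y = inv g \<otimes> x \<otimes> g"
      have y: "y \<in> N" using normalD(5)[OF N inv_closed[OF g] x] g by (simp add: y_def)
      then have yc: "y \<in> carrier G" by (rule Nc)
      have xy: "x = g \<otimes> y \<otimes> inv g"
      proof -
        have "g \<otimes> (inv g \<otimes> x) = x" using g Nc[OF x] by (simp add: m_assoc[symmetric])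
        then show ?thesis using g Nc[OF x] by (simp add: y_def m_assoc)
      qed
      have "c \<otimes> y = y \<otimes> c" using c y by (simp add: centralizer_def)
      then show ?thesis
        unfolding xy using conj_mult_distrib[OF g cc yc] conj_mult_distrib[OF g yc cc] by simp
    qed
    then show ?thesis using g cc by (simp add: centralizer_def)
  qed
  then show ?thesis using sub by (simp add: normal_inv_iff)
qed

text \<open>The kernel of the action of \<open>K\<close> on a finite normal subgroup has finite index in \<open>K\<close>.\<close>

lemma infinite_Int_centralizer:
  assumes K: "subgroup K G" "infinite K" and N: "N \<lhd> G" "finite N"
  shows "infinite (K \<inter> centralizer N)"
proof
  assume fin: "finite (K \<inter> centralizer N)"
  have Kc: "k \<in> carrier G" if "k \<in> K" for k using subgroup.mem_carrier[OF K(1) that] .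
  have Nc: "x \<in> carrier G" if "x \<in> N" for x using normalD(1)[OF N(1) that] .
  \<comment> \<open>\<open>F k\<close> is the permutation of \<open>N\<close> induced by
    \<open>k\<close>; two elements inducing the same one differ by an element of the
    centraliser.\<close>
  define F where "F k = (\<lambda>x\<in>N. k \<otimes> x \<otimes> inv k)" for k
  have "F ` K \<subseteq> N \<rightarrow>\<^sub>E N"
    using normalD(5)[OF N(1)] Kc by (auto simp: F_def)
  then have "finite (F ` K)" by (rule finite_subset) (auto intro: finite_PiE N(2))
  then obtain k0 where k0: "k0 \<in> K" and inf: "infinite {k \<in> K. F k = F k0}"
    using pigeonhole_infinite[OF K(2)] by blast
  have "(\<lambda>k. inv k0 \<otimes> k) ` {k \<in> K. F k = F k0} \<subseteq> K \<inter> centralizer N"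
  proof (rule image_subsetI)
    fix k assume "k \<in> {k \<in> K. F k = F k0}"
    then have k: "k \<in> K" "F k = F k0" by auto
    have c: "k \<in> carrier G" "k0 \<in> carrier G" using k k0 Kc by auto
    have "(inv k0 \<otimes> k) \<otimes> x = x \<otimes> (inv k0 \<otimes> k)" if x: "x \<in> N" for x
    proof -
      have e: "k \<otimes> x \<otimes> inv k = k0 \<otimes> x \<otimes> inv k0"
        using fun_cong[OF k(2), of x] x by (simp add: F_def)
      have "inv k0 \<otimes> k \<otimes> x \<otimes> inv (inv k0 \<otimes> k) = inv k0 \<otimes> (k \<otimes> x \<otimes> inv k) \<otimes> inv (inv k0)"
        using c Nc[OF x] by (intro conj_mult) auto
      also have "\<dots> = x"
        unfolding e using c Nc[OF x] by (subst conj_mult[symmetric]) auto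
      finally show ?thesis
        using c Nc[OF x] by (subst commute_iff_conj_eq) auto
    qed
    then show "inv k0 \<otimes> k \<in> K \<inter> centralizer N"
      using c k k0 subgroup.m_closed[OF K(1)] subgroup.m_inv_closed[OF K(1)]
      by (simp add: centralizer_def)
  qed
  moreover have "inj_on (\<lambda>k. inv k0 \<otimes> k) {k \<in> K. F k = F k0}"
    using Kc k0 by (intro inj_onI) auto
  ultimately show False using fin inf by (meson finite_imageD finite_subset)
qed

lemma finite_set_mult: "finite M \<Longrightarrow> finite N \<Longrightarrow> finite (M <#> N)"
  by (simp add: set_mult_def)

lemma set_multE:
  assumes "g \<in> A <#> B"
  obtains a b where "a \<in> A" "b \<in> B" "g = a \<otimes> b"
  using assms by (auto simp: set_mult_def)

text \<open>In g = mh, conjugation by h preserves \<open>Y\<close>, and conjugation by m then fixes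
  every element of it.\<close>

lemma normal_if_centralized_by_supplement:
  assumes M: "M \<subseteq> carrier G" and H: "H \<subseteq> carrier G" "M <#> H = carrier G" and Y: "subgroup Y G"
    and comm: "\<And>m y. m \<in> M \<Longrightarrow> y \<in> Y \<Longrightarrow> m \<otimes> y = y \<otimes> m"
    and conj: "\<And>h y. h \<in> H \<Longrightarrow> y \<in> Y \<Longrightarrow> h \<otimes> y \<otimes> inv h \<in> Y"
  shows "Y \<lhd> G"
proof -
  have "g \<otimes> y \<otimes> inv g \<in> Y" if g: "g \<in> carrier G" and y: "y \<in> Y" for g y
  proof -
    obtain m h where mh: "m \<in> M" "h \<in> H" "g = m \<otimes> h"
      using g unfolding H(2)[symmetric] by (rule set_multE)
    have c: "m \<in> carrier G" "h \<in> carrier G" "y \<in> carrier G"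
      using mh M H y subgroup.mem_carrier[OF Y] by auto
    let ?z = "h \<otimes> y \<otimes> inv h"
    have z: "?z \<in> Y" by (rule conj[OF mh(2) y])
    have "g \<otimes> y \<otimes> inv g = m \<otimes> ?z \<otimes> inv m"
      unfolding mh(3) by (rule conj_mult[OF c])
    also have "\<dots> = ?z"
      using comm[OF mh(1) z] c commute_iff_conj_eq[of m ?z] by simp
    finally show ?thesis using z by simp
  qed
  then show ?thesis using Y by (simp add: normal_inv_iff)
qed

end

text \<open>Abstracts a point stabiliser in a transitive permutation group: \<open>core\<close>
  reflects faithfulness on the points, and \<open>supplement\<close> expresses transitivity of
  \<open>N\<close>.\<close>

locale core_free_supplement = group G for G (structure) +
  fixes H
  assumes H: "subgroup H G"
    and core: "N \<lhd> G \<Longrightarrow> N \<subseteq> H \<Longrightarrow> N = {\<one>}"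
    and supplement: "N \<lhd> G \<Longrightarrow> infinite N \<Longrightarrow> N <#> H = carrier G"
    and min_N_H: "min_N (G\<lparr>carrier := H\<rparr>)"
    and large: "\<exists>N. N \<lhd> G \<and> finite N \<and> n \<le> card N"
begin

text \<open>Not the usual socle, which is generated by the minimal normal subgroups, but the union
  of all finite normal subgroups. It is closed under products because the product of two finite
  normal subgroups is finite and normal.\<close>

definition socle where "socle = \<Union>{N. N \<lhd> G \<and> finite N}"

lemma H_carrier: "h \<in> H \<Longrightarrow> h \<in> carrier G"
  using subgroup.mem_carrier[OF H] .

text \<open>Carries min-N from \<open>H\<close> to families of normal subgroups of the whole group,
  at the price that minimality concerns only the traces on \<open>H\<close>.\<close>

lemma minimal_Int_H:
  assumes "\<N> \<noteq> {}" "\<And>N. N \<in> \<N> \<Longrightarrow> N \<lhd> G"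
  obtains M where "M \<in> \<N>" "\<And>N. N \<in> \<N> \<Longrightarrow> N \<inter> H \<subseteq> M \<inter> H \<Longrightarrow> N \<inter> H = M \<inter> H"
proof -
  let ?N = "(\<lambda>N. N \<inter> H) ` \<N>"
  have "?N \<noteq> {} \<and> (\<forall>N\<in>?N. N \<lhd> G\<lparr>carrier := H\<rparr>)"
    using assms normal_Int_subgroup[OF H] by auto
  then have "\<exists>M\<in>?N. \<forall>N\<in>?N. N \<subseteq> M \<longrightarrow> N = M"
    by (rule mp[OF spec[OF min_N_H[unfolded min_N_def]]])
  then show thesis using that by auto
qed

lemma exists_minimal_infinite_normal:
  assumes L: "L \<lhd> G" "infinite L"
  obtains M where "minimal_infinite_normal M G" "M \<subseteq> L"
proof -
  let ?N = "{N. N \<lhd> G \<and> infinite N \<and> N \<subseteq> L}"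
  obtain M where M: "M \<in> ?N" and min: "\<And>N. N \<in> ?N \<Longrightarrow> N \<inter> H \<subseteq> M \<inter> H \<Longrightarrow> N \<inter> H = M \<inter> H"
    by (rule minimal_Int_H[of ?N]) (use L in auto)
  have "N = M" if N: "N \<lhd> G" "infinite N" "N \<subseteq> M" for N
  proof -
    have NH: "N \<inter> H = M \<inter> H" using N M by (intro min) auto
    \<comment> \<open>In m = nh the factor h lies in M \<inter> H, which equals N \<inter>
      H.\<close>
    have "m \<in> N" if m: "m \<in> M" for m
    proof -
      have mc: "m \<in> carrier G" using M m normalD(1) by blast
      then obtain n h where nh: "n \<in> N" "h \<in> H" "m = n \<otimes> h"
        unfolding supplement[OF N(1,2), symmetric] by (rule set_multE)
      have nc: "n \<in> carrier G" using normalD(1)[OF N(1) nh(1)] .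
      have "h = inv n \<otimes> m" using nh nc H_carrier by (simp add: m_assoc[symmetric])
      also have "\<dots> \<in> M"
        using M m N(3) nh(1) normalD(3,4)[of M] by blast
      finally have "h \<in> N" using NH nh(2) by blast
      then show ?thesis using nh normalD(3)[OF N(1)] by simp
    qed
    then show ?thesis using N(3) by blast
  qed
  then show thesis using M by (intro that[of M]) (auto simp: minimal_infinite_normal_def)
qed

lemma socle_normal: "socle \<lhd> G"
proof -
  have "subgroup socle G"
  proof (rule subgroupI)
    show "socle \<subseteq> carrier G" using normalD(1) by (auto simp: socle_def)
    show "socle \<noteq> {}" using large[of 0] normalD(2) by (fastforce simp: socle_def)
    show "inv x \<in> socle" if "x \<in> socle" for x
      using that normalD(4) by (auto simp: socle_def)
    fix x y assume "x \<in> socle" "y \<in> socle"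
    then obtain M N where MN: "M \<lhd> G" "finite M" "x \<in> M" "N \<lhd> G" "finite N" "y \<in> N"
      by (auto simp: socle_def)
    then have "x \<otimes> y \<in> M <#> N" by (auto simp: set_mult_def)
    then show "x \<otimes> y \<in> socle"
      using MN normal_subgroup_set_mult_closed[of M N] finite_set_mult[of M N]
      by (auto simp: socle_def)
  qed
  then show ?thesis using normalD(5) by (auto simp: normal_inv_iff socle_def)
qed

lemma infinite_socle: "infinite socle"
proof
  assume fin: "finite socle"
  obtain N where N: "N \<lhd> G" "finite N" "Suc (card socle) \<le> card N" using large by blast
  then have "N \<subseteq> socle" by (auto simp: socle_def)
  then have "card N \<le> card socle" using fin by (rule card_mono[rotated])
  then show False using N by simp
qed

text \<open>The centraliser of a finite normal subgroup meets \<open>M\<close> in a normal subgroup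
  of finite index in \<open>M\<close>; it is infinite, hence all of \<open>M\<close>.\<close>

lemma minimal_centralizes_socle:
  assumes M: "minimal_infinite_normal M G" and "m \<in> M" "x \<in> socle"
  shows "m \<otimes> x = x \<otimes> m"
proof -
  obtain N where N: "N \<lhd> G" "finite N" "x \<in> N" using assms by (auto simp: socle_def)
  have Mn: "M \<lhd> G" "infinite M" using M by (auto simp: minimal_infinite_normal_def)
  have "M \<inter> centralizer N \<lhd> G"
    by (rule normal_subgroup_intersect[OF Mn(1) centralizer_normal[OF N(1)]])
  moreover have "infinite (M \<inter> centralizer N)"
    by (rule infinite_Int_centralizer[OF normal_imp_subgroup[OF Mn(1)] Mn(2) N(1,2)])
  ultimately have "M \<inter> centralizer N = M"
    using M by (simp add: minimal_infinite_normal_def)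
  then show ?thesis using assms N by (auto simp: centralizer_def)
qed

lemma centralizer_minimal:
  assumes M: "minimal_infinite_normal M G" and ab: "M \<subseteq> socle"
  shows "centralizer M = M" "M \<inter> H = {\<one>}"
proof -
  have Mn: "M \<lhd> G" "infinite M" using M by (auto simp: minimal_infinite_normal_def)
  have Mc: "M \<subseteq> carrier G" using normalD(1)[OF Mn(1)] by blast
  have C: "centralizer M \<lhd> G" by (rule centralizer_normal[OF Mn(1)])
  have MC: "M \<subseteq> centralizer M"
    using minimal_centralizes_socle[OF M] ab Mc by (auto simp: centralizer_def)
  have "centralizer M \<inter> H \<lhd> G"
  proof (rule normal_if_centralized_by_supplement[OF Mc subgroup.subset[OF H] supplement[OF Mn]])
    show "subgroup (centralizer M \<inter> H) G"
      by (rule subgroups_Inter_pair[OF normal_imp_subgroup[OF C] H])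
    show "m \<otimes> y = y \<otimes> m" if "m \<in> M" "y \<in> centralizer M \<inter> H" for m y
      using that by (auto simp: centralizer_def)
    show "h \<otimes> y \<otimes> inv h \<in> centralizer M \<inter> H" if "h \<in> H" "y \<in> centralizer M \<inter> H" for h y
      using that normalD(5)[OF C] H_carrier subgroup.m_closed[OF H] subgroup.m_inv_closed[OF H]
      by auto
  qed
  then have CH: "centralizer M \<inter> H = {\<one>}" by (rule core) auto
  then show "M \<inter> H = {\<one>}"
    using MC normalD(2)[OF Mn(1)] subgroup.one_closed[OF H] by blast
  \<comment> \<open>Dedekind's law again: the factor h of c = mh lies in
    \<open>centralizer M \<inter> H\<close>, which is trivial.\<close>
  have "c \<in> M" if c: "c \<in> centralizer M" for c
  proof -
    have "c \<in> carrier G" using c by (simp add: centralizer_def)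
    then obtain m h where mh: "m \<in> M" "h \<in> H" "c = m \<otimes> h"
      unfolding supplement[OF Mn, symmetric] by (rule set_multE)
    have mc: "m \<in> carrier G" using mh Mc by blast
    have "h = inv m \<otimes> c" using mh mc H_carrier by (simp add: m_assoc[symmetric])
    also have "\<dots> \<in> centralizer M"
      using c mh(1) MC normalD(3,4)[OF C] by blast
    finally have "h = \<one>" using CH mh by blast
    then show ?thesis using mh mc by simp
  qed
  then show "centralizer M = M" using MC by blast
qed

text \<open>Some minimal L lies inside the socle, and the socle centralises L, so socle <= C(L) = L.
  Any minimal M centralises the socle and hence lies in C(socle) = socle, which is itself
  minimal.\<close>

lemma minimal_infinite_normal_iff: "minimal_infinite_normal M G \<longleftrightarrow> M = socle"
proof -
  obtain L where L: "minimal_infinite_normal L G" "L \<subseteq> socle"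
    using exists_minimal_infinite_normal[OF socle_normal infinite_socle] by blast
  have sc: "x \<in> carrier G" if "x \<in> socle" for x using normalD(1)[OF socle_normal that] .
  have "socle \<subseteq> centralizer L"
    using minimal_centralizes_socle[OF L(1)] sc by (auto simp: centralizer_def)
  then have Ls: "L = socle" using centralizer_minimal[OF L] L(2) by blast
  show ?thesis
  proof
    assume M: "minimal_infinite_normal M G"
    then have Mn: "M \<lhd> G" "infinite M" by (auto simp: minimal_infinite_normal_def)
    have "M \<subseteq> centralizer socle"
      using minimal_centralizes_socle[OF M] normalD(1)[OF Mn(1)] by (auto simp: centralizer_def)
    also have "\<dots> = L" using centralizer_minimal(1)[OF L] Ls by simp
    finally show "M = socle" using L(1) Mn Ls by (auto simp: minimal_infinite_normal_def)
  qed (use L Ls in simp)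
qed

lemma centralizer_socle: "centralizer socle = socle" and socle_Int_H: "socle \<inter> H = {\<one>}"
  using centralizer_minimal[of socle] minimal_infinite_normal_iff by auto

lemma socle_comm: "x \<in> socle \<Longrightarrow> y \<in> socle \<Longrightarrow> x \<otimes> y = y \<otimes> x"
  using minimal_centralizes_socle[of socle] minimal_infinite_normal_iff by blast

lemma finite_H: "finite H"
proof -
  let ?N = "centralizer ` {N. N \<lhd> G \<and> finite N}"
  have "?N \<noteq> {}" using large[of 0] by auto
  moreover have "C \<lhd> G" if "C \<in> ?N" for C using that centralizer_normal by auto
  ultimately obtain C where C: "C \<in> ?N" "\<And>D. D \<in> ?N \<Longrightarrow> D \<inter> H \<subseteq> C \<inter> H \<Longrightarrow> D \<inter> H = C \<inter> H"
    by (rule minimal_Int_H) blast+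
  then obtain N where N: "N \<lhd> G" "finite N" "C = centralizer N" by blast
  have Nc: "x \<in> carrier G" if "x \<in> N" for x using normalD(1)[OF N(1) that] .
  have "C \<inter> H \<subseteq> centralizer socle"
  proof
    fix c assume c: "c \<in> C \<inter> H"
    have "c \<otimes> x = x \<otimes> c" if x: "x \<in> socle" for x
    proof -
      obtain L where L: "L \<lhd> G" "finite L" "x \<in> L" using x by (auto simp: socle_def)
      have Lc: "y \<in> carrier G" if "y \<in> L" for y using normalD(1)[OF L(1) that] .
      have NL: "N \<subseteq> N <#> L" "L \<subseteq> N <#> L"
      proof -
        have "y \<otimes> \<one> \<in> N <#> L" if "y \<in> N" for y
          using that normalD(2)[OF L(1)] unfolding set_mult_def by blast
        then show "N \<subseteq> N <#> L" using Nc by auto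
        have "\<one> \<otimes> y \<in> N <#> L" if "y \<in> L" for y
          using that normalD(2)[OF N(1)] unfolding set_mult_def by blast
        then show "L \<subseteq> N <#> L" using Lc by auto
      qed
      \<comment> \<open>Enlarging \<open>N\<close> to its product with \<open>L\<close> can only
        shrink the trace on \<open>H\<close>, so minimality makes the traces equal: elements of
        \<open>H\<close> centralising \<open>N\<close> centralise every finite normal
        \<open>L\<close>.\<close>
      have "centralizer (N <#> L) \<in> ?N"
        using normal_subgroup_set_mult_closed[OF N(1) L(1)] finite_set_mult[OF N(2) L(2)] by blast
      moreover have "centralizer (N <#> L) \<inter> H \<subseteq> C \<inter> H"
        using NL(1) N(3) by (auto simp: centralizer_def)
      ultimately have "c \<in> centralizer (N <#> L)" using C(2) c by blast
      then show ?thesis using NL(2) L(3) by (auto simp: centralizer_def)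
    qed
    then show "c \<in> centralizer socle" using c H_carrier by (auto simp: centralizer_def)
  qed
  then have triv: "C \<inter> H \<subseteq> {\<one>}" using centralizer_socle socle_Int_H by blast
  show ?thesis
  proof (rule ccontr)
    assume "infinite H"
    \<comment> \<open>An infinite \<open>H\<close> would meet the centraliser of the finite
      \<open>N\<close> in an infinite set, yet this trace is trivial.\<close>
    from infinite_Int_centralizer[OF H this N(1,2)] triv show False
      unfolding N(3) by (metis Int_commute finite.emptyI finite_insert finite_subset)
  qed
qed

lemma conj_in_socle: "h \<in> carrier G \<Longrightarrow> x \<in> socle \<Longrightarrow> h \<otimes> x \<otimes> inv h \<in> socle"
  using normalD(5)[OF socle_normal] .

text \<open>If h and k induce the same map, then k^{-1} h lies in C(socle) \<inter> H = socle
  \<inter> H, which is trivial.\<close>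

lemma inj_on_conj_action: "inj_on (conj_action G socle) H"
proof (rule inj_onI)
  fix h k assume h: "h \<in> H" and k: "k \<in> H" and eq: "conj_action G socle h = conj_action G socle k"
  have c: "h \<in> carrier G" "k \<in> carrier G" using h k H_carrier by auto
  have "(inv k \<otimes> h) \<otimes> x = x \<otimes> (inv k \<otimes> h)" if x: "x \<in> socle" for x
  proof -
    have xc: "x \<in> carrier G" using normalD(1)[OF socle_normal x] .
    have e: "h \<otimes> x \<otimes> inv h = k \<otimes> x \<otimes> inv k"
      using fun_cong[OF eq, of x] x by (simp add: conj_action_def)
    have "inv k \<otimes> h \<otimes> x \<otimes> inv (inv k \<otimes> h) = inv k \<otimes> (h \<otimes> x \<otimes> inv h) \<otimes> inv (inv k)"
      using c xc by (intro conj_mult) auto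
    also have "\<dots> = x"
      unfolding e using c xc by (subst conj_mult[symmetric]) auto
    finally show ?thesis using c xc by (subst commute_iff_conj_eq) auto
  qed
  then have "inv k \<otimes> h \<in> centralizer socle" using c by (simp add: centralizer_def)
  then have "inv k \<otimes> h \<in> socle \<inter> H"
    using centralizer_socle h k subgroup.m_closed[OF H] subgroup.m_inv_closed[OF H] by simp
  then have "inv k \<otimes> h = \<one>" using socle_Int_H by blast
  then show "h = k" using c by (metis inv_closed inv_equality inv_inv)
qed

lemma conj_action_mult:
  assumes "h \<in> carrier G" "k \<in> carrier G" "x \<in> socle"
  shows "conj_action G socle (h \<otimes> k) x = conj_action G socle h (conj_action G socle k x)"
  using assms conj_in_socle[of k x] normalD(1)[OF socle_normal]
  by (simp add: conj_action_def conj_mult)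

lemma faithful_conj_action: "faithful_action (G\<lparr>carrier := H\<rparr>) socle (conj_action G socle)"
proof -
  let ?a = "conj_action G socle"
  have ext: "?a h \<in> extensional socle" for h by (simp add: conj_action_def)
  have one: "?a \<one> x = x" if "x \<in> socle" for x
    using that normalD(1)[OF socle_normal that] by (simp add: conj_action_def)
  have cl: "?a h x \<in> socle" if "h \<in> carrier G" "x \<in> socle" for h x
    using that conj_in_socle by (simp add: conj_action_def)
  have bij: "?a h \<in> Bij socle" if h: "h \<in> carrier G" for h
  proof -
    have "bij_betw (?a h) socle socle"
    proof (rule bij_betw_byWitness[where f' = "?a (inv h)"])
      show "\<forall>x\<in>socle. ?a (inv h) (?a h x) = x" "\<forall>x\<in>socle. ?a h (?a (inv h) x) = x"
        using h one by (simp_all add: conj_action_mult[symmetric])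
    qed (use h cl in auto)
    then show ?thesis using ext by (simp add: Bij_def)
  qed
  have "group_hom (G\<lparr>carrier := H\<rparr>) (BijGroup socle) ?a"
  proof (intro group_hom.intro group_hom_axioms.intro)
    show "group (G\<lparr>carrier := H\<rparr>)" by (rule subgroup_imp_group[OF H])
    show "group (BijGroup socle)" by (rule group_BijGroup)
    show "?a \<in> hom (G\<lparr>carrier := H\<rparr>) (BijGroup socle)"
    proof (rule homI)
      fix h k assume "h \<in> carrier (G\<lparr>carrier := H\<rparr>)" "k \<in> carrier (G\<lparr>carrier := H\<rparr>)"
      then have hk: "h \<in> carrier G" "k \<in> carrier G" using H_carrier by auto
      have "?a (h \<otimes> k) = compose socle (?a h) (?a k)"
        using conj_action_mult[OF hk] by (intro extensionalityI[OF ext]) (auto simp: compose_def)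
      then show "?a (h \<otimes>\<^bsub>G\<lparr>carrier := H\<rparr>\<^esub> k) = ?a h \<otimes>\<^bsub>BijGroup socle\<^esub> ?a k"
        using bij hk by (simp add: BijGroup_def)
    qed (use bij H_carrier in \<open>simp add: BijGroup_def\<close>)
  qed
  then show ?thesis
    using inj_on_conj_action
    by (intro faithful_action.intro group_action.intro faithful_action_axioms.intro) simp_all
qed

lemma comm_group_socle: "comm_group (G\<lparr>carrier := socle\<rparr>)"
  using subgroup_imp_group[OF normal_imp_subgroup[OF socle_normal]] socle_comm
  by (intro group.group_comm_groupI) simp_all

lemma irreducible_operators_socle:
  "irreducible_operators (G\<lparr>carrier := socle\<rparr>) (G\<lparr>carrier := H\<rparr>) (conj_action G socle)"
proof (intro irreducible_operators.intro irreducible_operators_axioms.intro comm_group_socle)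
  let ?a = "conj_action G socle" and ?M = "G\<lparr>carrier := socle\<rparr>" and ?H = "G\<lparr>carrier := H\<rparr>"
  have sc: "x \<in> carrier G" if "x \<in> socle" for x using normalD(1)[OF socle_normal that] .
  show "group ?H" by (rule subgroup_imp_group[OF H])
  show "finite (carrier ?H)" using finite_H by simp
  show "?a h \<in> hom ?M ?M" if "h \<in> carrier ?H" for h
    using that H_carrier sc conj_in_socle normalD(3)[OF socle_normal]
    by (intro homI) (simp_all add: conj_action_def conj_mult_distrib)
  show "?a (h \<otimes>\<^bsub>?H\<^esub> k) x = ?a h (?a k x)"
    if "h \<in> carrier ?H" "k \<in> carrier ?H" "x \<in> carrier ?M" for h k x
    using that H_carrier by (simp add: conj_action_mult)
  show "?a \<one>\<^bsub>?H\<^esub> x = x" if "x \<in> carrier ?M" for x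
    using that sc by (simp add: conj_action_def)
  show "infinite (carrier ?M)" using infinite_socle by simp
  show "\<exists>n::nat. n > 0 \<and> x [^]\<^bsub>?M\<^esub> n = \<one>\<^bsub>?M\<^esub>" if x: "x \<in> carrier ?M" for x
  proof -
    obtain N where N: "N \<lhd> G" "finite N" "x \<in> N" using x by (auto simp: socle_def)
    interpret N: group "G\<lparr>carrier := N\<rparr>"
      by (rule subgroup_imp_group[OF normal_imp_subgroup[OF N(1)]])
    \<comment> \<open>Powers do not depend on the carrier, so Lagrange's theorem in the finite
      \<open>N\<close> gives an exponent valid in the socle.\<close>
    have "x [^]\<^bsub>G\<lparr>carrier := N\<rparr>\<^esub> order (G\<lparr>carrier := N\<rparr>) = \<one>\<^bsub>G\<lparr>carrier := N\<rparr>\<^esub>"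
      using N by (intro N.pow_order_eq_1) simp
    moreover have "order (G\<lparr>carrier := N\<rparr>) > 0"
      using N by (auto simp: order_def card_gt_0_iff)
    ultimately show ?thesis
      by (intro exI[of _ "order (G\<lparr>carrier := N\<rparr>)"]) (simp add: nat_pow_def)
  qed
  fix D assume D: "subgroup D ?M" "infinite D"
    and inv: "\<And>h x. h \<in> carrier ?H \<Longrightarrow> x \<in> D \<Longrightarrow> ?a h x \<in> D"
  have Ds: "D \<subseteq> socle" using subgroup.subset[OF D(1)] by simp
  have DG: "subgroup D G"
    by (rule incl_subgroup[OF normal_imp_subgroup[OF socle_normal] D(1)])
  \<comment> \<open>The abelian socle centralises \<open>D\<close>, so invariance under
    \<open>H\<close> already gives normality in the whole group, and minimality of the socle
    applies.\<close>
  have "D \<lhd> G"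
  proof (rule normal_if_centralized_by_supplement[of socle H])
    show "socle \<subseteq> carrier G" using sc by blast
    show "H \<subseteq> carrier G" using H_carrier by blast
    show "socle <#> H = carrier G" by (rule supplement[OF socle_normal infinite_socle])
    show "m \<otimes> y = y \<otimes> m" if "m \<in> socle" "y \<in> D" for m y
      using that Ds socle_comm by blast
    show "h \<otimes> y \<otimes> inv h \<in> D" if "h \<in> H" "y \<in> D" for h y
      using inv[of h y] that Ds by (auto simp: conj_action_def)
  qed (rule DG)
  then show "D = carrier ?M"
    using minimal_infinite_normal_iff[of socle] D(2) Ds by (auto simp: minimal_infinite_normal_def)
qed

end

section \<open>Permutation groups\<close>

text \<open>Conjugation formed in a subgroup and in the ambient group uses two inverse operations
  that are known to agree only on the subgroup, so operators have to be exchanged on the acting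
  group alone.\<close>

lemma irreducible_operators_cong:
  assumes "irreducible_operators G K act" "\<And>h. h \<in> carrier K \<Longrightarrow> act h = act' h"
  shows "irreducible_operators G K act'"
proof -
  interpret irreducible_operators G K act by fact
  interpret K: group K by (rule group_K)
  show ?thesis
  proof (intro irreducible_operators.intro irreducible_operators_axioms.intro comm_group_axioms group_K
      finite_K infinite_carrier torsion)
    fix D assume "subgroup D G" "infinite D" "\<And>h x. h \<in> carrier K \<Longrightarrow> x \<in> D \<Longrightarrow> act' h x \<in> D"
    then show "D = carrier G" using irreducible assms(2) by simp
  qed (use act_hom act_mult act_one assms(2)[symmetric] in simp_all)
qed

lemma faithful_action_cong:
  assumes "faithful_action K E act" "\<And>h. h \<in> carrier K \<Longrightarrow> act h = act' h"
  shows "faithful_action K E act'"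
proof -
  interpret faithful_action K E act by fact
  interpret group_hom K "BijGroup E" act by (rule group_hom)
  have "act' \<in> hom K (BijGroup E)"
    using G.hom_restrict[OF homh] assms(2) by blast
  moreover have "inj_on act' (carrier K)"
    using faithful assms(2) by (simp cong: inj_on_cong)
  ultimately show ?thesis
    by (intro faithful_action.intro group_action.intro faithful_action_axioms.intro
        group_hom.intro group_hom_axioms.intro G.group_axioms H.group_axioms)
qed

lemma BijGroup_mult_apply:
  "g \<in> carrier (BijGroup \<Omega>) \<Longrightarrow> h \<in> carrier (BijGroup \<Omega>) \<Longrightarrow> x \<in> \<Omega> \<Longrightarrow>
    (g \<otimes>\<^bsub>BijGroup \<Omega>\<^esub> h) x = g (h x)"
  by (simp add: BijGroup_def compose_def)

lemma BijGroup_apply_closed: "g \<in> carrier (BijGroup \<Omega>) \<Longrightarrow> x \<in> \<Omega> \<Longrightarrow> g x \<in> \<Omega>"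
  by (auto simp: BijGroup_def Bij_def bij_betw_def)

lemma BijGroup_one_apply: "x \<in> \<Omega> \<Longrightarrow> \<one>\<^bsub>BijGroup \<Omega>\<^esub> x = x"
  by (simp add: BijGroup_def)

lemma BijGroup_eq_oneI:
  "g \<in> carrier (BijGroup \<Omega>) \<Longrightarrow> (\<And>x. x \<in> \<Omega> \<Longrightarrow> g x = x) \<Longrightarrow> g = \<one>\<^bsub>BijGroup \<Omega>\<^esub>"
  by (intro extensionalityI[of _ \<Omega>]) (auto simp: BijGroup_def Bij_def)

lemma transitive_onE:
  assumes "transitive_on N \<Omega>" "x \<in> \<Omega>" "y \<in> \<Omega>"
  obtains g where "g \<in> N" "g x = y"
  using transitive_action.unique_orbit[OF assms] by auto

lemma core_free_supplement_point_stabilizer: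
  assumes G: "subgroup G (BijGroup \<Omega>)"
    and trans: "\<And>N. N \<lhd> subgrp (BijGroup \<Omega>) G \<Longrightarrow> infinite N \<Longrightarrow> transitive_on N \<Omega>"
    and \<alpha>: "\<alpha> \<in> \<Omega>"
    and H: "H = point_stabilizer \<Omega> G \<alpha>" "min_N (subgrp (BijGroup \<Omega>) H)"
    and large: "\<And>n::nat. \<exists>N. N \<lhd> subgrp (BijGroup \<Omega>) G \<and> finite N \<and> n \<le> card N"
  shows "core_free_supplement (subgrp (BijGroup \<Omega>) G) H"
proof -
  let ?B = "BijGroup \<Omega>" and ?G = "subgrp (BijGroup \<Omega>) G"
  interpret B: group ?B by (rule group_BijGroup)
  interpret G: group ?G by (rule B.subgroup_imp_group[OF G])
  have GB: "g \<in> carrier ?B" if "g \<in> G" for g using subgroup.mem_carrier[OF G that] .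
  have invG: "inv\<^bsub>?G\<^esub> g = inv\<^bsub>?B\<^esub> g" if "g \<in> G" for g by (rule B.m_inv_consistent[OF G that])
  have G_normal: "G \<lhd> ?G" using G.normal_self by simp
  \<comment> \<open>Transitivity is assumed for infinite normal subgroups, so it reaches
    \<open>G\<close> itself only after \<open>G\<close> is seen to be infinite.\<close>
  have "infinite G"
  proof
    assume fin: "finite G"
    obtain N where N: "N \<lhd> ?G" "finite N" "Suc (card G) \<le> card N" using large by blast
    have "card N \<le> card G" using G.normalD(1)[OF N(1)] by (intro card_mono[OF fin]) auto
    then show False using N by simp
  qed
  then have transG: "transitive_on G \<Omega>" by (rule trans[OF G_normal])
  have Hmem: "h \<in> H \<longleftrightarrow> h \<in> G \<and> h \<alpha> = \<alpha>" for h by (auto simp: H(1) stabilizer_def)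
  have Hsub: "subgroup H ?G"
    unfolding H(1) using transG \<alpha>
    by (intro group_action.stabilizer_subgroup) (simp_all add: transitive_action_def)
  show ?thesis
  proof (intro core_free_supplement.intro core_free_supplement_axioms.intro G.group_axioms Hsub large)
    fix N assume N: "N \<lhd> ?G" "N \<subseteq> H"
    have "n = \<one>\<^bsub>?B\<^esub>" if n: "n \<in> N" for n
    proof (rule BijGroup_eq_oneI)
      have nG: "n \<in> G" using N(2) n Hmem by blast
      then show nB: "n \<in> carrier ?B" by (rule GB)
      fix x assume "x \<in> \<Omega>"
      \<comment> \<open>The conjugate g^{-1} n g lies in \<open>N\<close>, hence in
        \<open>H\<close>, and fixes \<alpha>; therefore \<open>n\<close> fixes x = g
        \<alpha>.\<close>
      then obtain g where g: "g \<in> G" "g \<alpha> = x" by (rule transitive_onE[OF transG \<alpha>])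
      have gB: "g \<in> carrier ?B" "inv\<^bsub>?B\<^esub> g \<in> carrier ?B" using GB[OF g(1)] by auto
      have "inv\<^bsub>?G\<^esub> g \<otimes>\<^bsub>?G\<^esub> n \<otimes>\<^bsub>?G\<^esub> inv\<^bsub>?G\<^esub> (inv\<^bsub>?G\<^esub> g) \<in> N"
        using g(1) by (intro G.normalD(5)[OF N(1) G.inv_closed n]) simp
      then have "inv\<^bsub>?B\<^esub> g \<otimes>\<^bsub>?B\<^esub> n \<otimes>\<^bsub>?B\<^esub> g \<in> N"
        using g(1) gB by (simp add: invG subgroup.m_inv_closed[OF G])
      then have k: "(inv\<^bsub>?B\<^esub> g \<otimes>\<^bsub>?B\<^esub> n \<otimes>\<^bsub>?B\<^esub> g) \<alpha> = \<alpha>" using N(2) Hmem by blast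
      have "g \<otimes>\<^bsub>?B\<^esub> (inv\<^bsub>?B\<^esub> g \<otimes>\<^bsub>?B\<^esub> n \<otimes>\<^bsub>?B\<^esub> g) = n \<otimes>\<^bsub>?B\<^esub> g"
        using gB nB by (simp add: B.m_assoc[symmetric])
      then have "(n \<otimes>\<^bsub>?B\<^esub> g) \<alpha> = g ((inv\<^bsub>?B\<^esub> g \<otimes>\<^bsub>?B\<^esub> n \<otimes>\<^bsub>?B\<^esub> g) \<alpha>)"
        using BijGroup_mult_apply[OF gB(1) _ \<alpha>, of "inv\<^bsub>?B\<^esub> g \<otimes>\<^bsub>?B\<^esub> n \<otimes>\<^bsub>?B\<^esub> g"] gB nB by simp
      then show "n x = x"
        using k g(2) BijGroup_mult_apply[OF nB gB(1) \<alpha>] by simp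
    qed
    then have "N \<subseteq> {\<one>\<^bsub>?B\<^esub>}" by blast
    then show "N = {\<one>\<^bsub>?G\<^esub>}" using G.normalD(2)[OF N(1)] by auto
  next
    fix N assume N: "N \<lhd> ?G" "infinite N"
    have NG: "n \<in> G" if "n \<in> N" for n using G.normalD(1)[OF N(1) that] by simp
    have "g \<in> N <#>\<^bsub>?G\<^esub> H" if g: "g \<in> G" for g
    proof -
      have "g \<alpha> \<in> \<Omega>" by (rule BijGroup_apply_closed[OF GB[OF g] \<alpha>])
      \<comment> \<open>Frattini argument: when \<open>n\<close> agrees with \<open>g\<close> at
        \<alpha>, the element n^{-1} g lies in the stabiliser.\<close>
      then obtain n where n: "n \<in> N" "n \<alpha> = g \<alpha>" by (rule transitive_onE[OF trans[OF N] \<alpha>])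
      have nB: "n \<in> carrier ?B" "inv\<^bsub>?B\<^esub> n \<in> carrier ?B" using GB[OF NG[OF n(1)]] by auto
      let ?h = "inv\<^bsub>?B\<^esub> n \<otimes>\<^bsub>?B\<^esub> g"
      have "?h \<alpha> = (inv\<^bsub>?B\<^esub> n \<otimes>\<^bsub>?B\<^esub> n) \<alpha>"
        using BijGroup_mult_apply[OF nB(2) GB[OF g] \<alpha>] BijGroup_mult_apply[OF nB(2) nB(1) \<alpha>] n(2)
        by simp
      then have "?h \<alpha> = \<alpha>" using nB \<alpha> by (simp add: BijGroup_one_apply)
      moreover have "?h \<in> G"
        using g NG[OF n(1)] by (simp add: subgroup.m_closed[OF G] subgroup.m_inv_closed[OF G])
      ultimately have "?h \<in> H" by (simp add: Hmem)
      moreover have "g = n \<otimes>\<^bsub>?G\<^esub> ?h"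
        using nB GB[OF g] by (simp add: B.m_assoc[symmetric])
      ultimately show ?thesis using n(1) unfolding set_mult_def by blast
    qed
    moreover have "n \<otimes>\<^bsub>?B\<^esub> h \<in> G" if "n \<in> N" "h \<in> H" for n h
      using that NG Hmem subgroup.m_closed[OF G] by blast
    ultimately show "N <#>\<^bsub>?G\<^esub> H = carrier ?G" by (auto simp: set_mult_def)
  qed (use H(2) in simp)
qed

text \<open>If m fixes x and commutes with an n carrying x to y, then m fixes y. Transitivity thus
  turns one fixed point of m into all points.\<close>

lemma regular_onI:
  assumes M: "M \<subseteq> carrier (BijGroup \<Omega>)" and trans: "transitive_on M \<Omega>" and \<alpha>: "\<alpha> \<in> \<Omega>"
    and comm: "\<And>x y. x \<in> M \<Longrightarrow> y \<in> M \<Longrightarrow> x \<otimes>\<^bsub>BijGroup \<Omega>\<^esub> y = y \<otimes>\<^bsub>BijGroup \<Omega>\<^esub> x"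
  shows "regular_on M \<Omega>"
proof -
  let ?B = "BijGroup \<Omega>"
  interpret A: transitive_action "subgrp ?B M" \<Omega> "\<lambda>g. g" by (rule trans)
  interpret M: group "subgrp ?B M" using A.group_hom by (simp add: group_hom_def)
  have one: "\<one>\<^bsub>?B\<^esub> \<in> M" using M.one_closed by simp
  have "m = \<one>\<^bsub>?B\<^esub>" if m: "m \<in> M" "m x = x" and x: "x \<in> \<Omega>" for m x
  proof (rule BijGroup_eq_oneI)
    show mB: "m \<in> carrier ?B" using m M by blast
    fix y assume "y \<in> \<Omega>"
    then obtain n where n: "n \<in> M" "n x = y" by (rule transitive_onE[OF trans x])
    have nB: "n \<in> carrier ?B" using n M by blast
    have "m y = (m \<otimes>\<^bsub>?B\<^esub> n) x"
      using BijGroup_mult_apply[OF mB nB x] n by simp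
    also have "\<dots> = n (m x)"
      unfolding comm[OF m(1) n(1)] by (rule BijGroup_mult_apply[OF nB mB x])
    finally show "m y = y" using m n by simp
  qed
  then have "point_stabilizer \<Omega> M x \<subseteq> {\<one>\<^bsub>?B\<^esub>}" if "x \<in> \<Omega>" for x
    using that unfolding stabilizer_def by (simp add: subset_iff) blast
  then have "point_stabilizer \<Omega> M x = {\<one>\<^bsub>?B\<^esub>}" if "x \<in> \<Omega>" for x
    using that one BijGroup_one_apply[OF that] by (intro equalityI) (simp_all add: stabilizer_def)
  then show ?thesis using trans by (simp add: regular_on_def)
qed

theorem theorem1p4:
  fixes \<Omega> :: "'a set" and G H :: "('a \<Rightarrow> 'a) set" and \<alpha> :: 'a
  assumes "infinite \<Omega>"
    and "subgroup G (BijGroup \<Omega>)"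
    and "\<And>N. N \<lhd> subgrp (BijGroup \<Omega>) G \<Longrightarrow> infinite N \<Longrightarrow> transitive_on N \<Omega>"
    and "\<alpha> \<in> \<Omega>"
    and "H = point_stabilizer \<Omega> G \<alpha>"
    and "min_N (subgrp (BijGroup \<Omega>) H)"
    and "\<And>n::nat. \<exists>N. N \<lhd> subgrp (BijGroup \<Omega>) G \<and> finite N \<and> n \<le> card N"
  shows "\<exists>M. minimal_infinite_normal M (subgrp (BijGroup \<Omega>) G)
      \<and> (\<forall>M'. minimal_infinite_normal M' (subgrp (BijGroup \<Omega>) G) \<longrightarrow> M' = M)
      \<and> regular_on M \<Omega>
      \<and> finite H
      \<and> faithful_action (subgrp (BijGroup \<Omega>) H) M (conj_action (BijGroup \<Omega>) M)
      \<and> (\<exists>p::nat. Factorial_Ring.prime p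
           \<and> comm_group (subgrp (BijGroup \<Omega>) M)
           \<and> divisible_group (subgrp (BijGroup \<Omega>) M)
           \<and> is_p_group p (subgrp (BijGroup \<Omega>) M)
           \<and> finite_rank (subgrp (BijGroup \<Omega>) M)
           \<and> acts_padic_irreducibly p (subgrp (BijGroup \<Omega>) H) (subgrp (BijGroup \<Omega>) M)
               (conj_action (BijGroup \<Omega>) M))"
proof -
  let ?B = "BijGroup \<Omega>" and ?G = "subgrp (BijGroup \<Omega>) G"
  interpret B: group ?B by (rule group_BijGroup)
  interpret S: core_free_supplement ?G H
    by (rule core_free_supplement_point_stabilizer[OF assms(2-7)])
  let ?M = S.socle
  have min: "minimal_infinite_normal M ?G \<longleftrightarrow> M = ?M" for M by (rule S.minimal_infinite_normal_iff)
  have MG: "?M \<subseteq> G" using S.normalD(1)[OF S.socle_normal] by auto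
  have "transitive_on ?M \<Omega>" by (rule assms(3)[OF S.socle_normal S.infinite_socle])
  then have regular: "regular_on ?M \<Omega>"
    using MG subgroup.subset[OF assms(2)] S.socle_comm by (intro regular_onI[OF _ _ assms(4)]) auto
  \<comment> \<open>On elements of \<open>G\<close> the inverse in \<open>?G\<close> is the inverse
    in \<open>?B\<close>.\<close>
  have conj: "conj_action ?G ?M h = conj_action ?B ?M h" if "h \<in> H" for h
    using that S.H_carrier[of h] B.m_inv_consistent[OF assms(2)] by (simp add: conj_action_def)
  have "faithful_action (subgrp ?B H) ?M (conj_action ?G ?M)"
    using S.faithful_conj_action by simp
  then have faithful: "faithful_action (subgrp ?B H) ?M (conj_action ?B ?M)"
    by (rule faithful_action_cong) (simp add: conj)
  have "irreducible_operators (subgrp ?B ?M) (subgrp ?B H) (conj_action ?G ?M)"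
    using S.irreducible_operators_socle by simp
  then have ops: "irreducible_operators (subgrp ?B ?M) (subgrp ?B H) (conj_action ?B ?M)"
    by (rule irreducible_operators_cong) (simp add: conj)
  have "comm_group (subgrp ?B ?M)" using S.comm_group_socle by simp
  then show ?thesis
    using min regular S.finite_H faithful irreducible_operators.divisible_p_group_of_finite_rank[OF ops]
    by (intro exI[of _ ?M] conjI) blast+
qed

end
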